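(* Let $\Omega\subset\mathbb{R}^N$ be a domain, let $x_1\neq x_2$ be two points of $\Omega$, let $p\in(2,2^* )$, and suppose that $V_n=V+K_n$ and $Q_n$ ($n\in\mathbb{N}$) satisfy conditions (A3) and (A4) stated in the context. Let $u_n$ be a ground state solution of $$-\Delta u+V_n(x)u=Q_n(x)|u|^{p-2}u\ \text{ in }\Omega,\qquad u=0\ \text{on }\partial\Omega,\qquad u(x)\to0\ \text{as }|x|\to\infty.\qquad(\mathrm{P}_n)$$ Then, for $n$ large, $u_n$ concentrates at $x_1$ or $x_2$. More precisely, for each $\varepsilon>0$ we have, passing to a subsequence, $$\lim_{n\to\infty}\frac{\int_{\Omega\setminus B_\varepsilon(x_j)}(|\nabla u_n|^2+V_nu_n^2)\,dx}{\int_\Omega(|\nabla u_n|^2+V_nu_n^2)\,dx}=0 \quad\text{and}\quad \lim_{n\to\infty}\frac{\int_{\Omega\setminus B_\varepsilon(x_j)}Q_n|u_n|^p\,dx}{\int_\Omega Q_n|u_n|^p\,dx}=0$$ for $j=1$ or $2$ (but not for $j=1$ and $2$).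
   Context: $\Omega$ may be bounded or unbounded (including $\Omega=\mathbb{R}^N$); the boundary condition in $(\mathrm{P}_n)$ is void if $\Omega=\mathbb{R}^N$, and the condition at infinity is void if $\Omega$ is bounded. $2^*:=2N/(N-2)$ if $N\ge3$, $2^*:=\infty$ if $N=1,2$. $B_r(a)$ is the open ball of radius $r$ centred at $a$. Functions are real-valued. (A3) $V\in L^\infty(\Omega)$, $V\ge0$, and $\sigma(-\Delta+V)\subset(0,\infty)$, where the spectrum $\sigma$ is realized in $H^1_0(\Omega)$. $V_n=V+K_n$ with $K_n\in L^\infty(\Omega)$, and there is a constant $B$ with $\|K_n\|_\infty\le B$ for all $n$. Moreover, for each $\varepsilon>0$ there is $N_\varepsilon$ such that $\operatorname{supp}K_n\subset B_\varepsilon(x_1)\cup B_\varepsilon(x_2)$ whenever $n\ge N_\varepsilon$. (A4) $Q_n\in L^\infty(\Omega)$, $Q_n>0$ in a neighbourhood of $\{x_1\}\cup\{x_2\}$, and there is a constant $C$ with $\|Q_n\|_\infty\le C$ for all $n$. Moreover, for each $\varepsilon>0$ there exist constants $\delta_\varepsilon>0$ and $N_\varepsilon$ such that $Q_n(x)\le-\delta_\varepsilon$ whenever $x\in\Omega$, $x\notin B_\varepsilon(x_1)\cup B_\varepsilon(x_2)$ and $n\ge N_\varepsilon$. Put $\|u\|_n:=\left(\int_\Omega(|\nabla u|^2+V_nu^2)\,dx\right)^{1/2}$; for all large $n$ this is a norm on $H^1_0(\Omega)$ equivalent to the usual one, and only such $n$ are considered. Put $J_n(u):=\int_\Omega Q_n|u|^p\,dx$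 and $$s_n:=\inf\left\{\frac{\|u\|_n^2}{J_n(u)^{2/p}}:\ u\in H^1_0(\Omega),\ J_n(u)>0\right\}.$$ Solutions of $(\mathrm{P}_n)$ are weak solutions in $H^1_0(\Omega)$. A ground state solution is a nontrivial solution $u$ (so $J_n(u)=\|u\|_n^2>0$) at which $s_n$ is attained, i.e. $\|u\|_n^2/J_n(u)^{2/p}=s_n$.
   Formalization: The clause "but not for j=1 and 2" is stated only for 0 < ε < |x_1 − x_2|; for ε > |x_1 − x_2| it is false, since B_ε(x_1) and B_ε(x_2) each contain both points and both limits hold for j=1 and j=2. *)

theory Defs
  imports "HOL-Analysis.Analysis" "HOL-Probability.Essential_Supremum"
begin

text \<open>
  The space \<open>\<real>\<^sup>N\<close> is an arbitrary Euclidean space \<open>'a\<close> with \<open>N = DIM('a)\<close>. Elements of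
  Lebesgue and Sobolev spaces over \<open>\<Omega>\<close> are represented by functions on all of \<open>'a\<close>, of which only the
  values on \<open>\<Omega>\<close> matter, up to null sets. Accordingly all pointwise conditions on such functions are
  required almost everywhere.
\<close>

subsection \<open>Lebesgue spaces\<close>

definition L2 :: "'a::euclidean_space set \<Rightarrow> ('a \<Rightarrow> 'b::euclidean_space) set" where
  "L2 \<Omega> = {f \<in> borel_measurable (lebesgue_on \<Omega>). integrable (lebesgue_on \<Omega>) (\<lambda>x. (norm (f x))\<^sup>2)}"

definition L2_nrm :: "'a::euclidean_space set \<Rightarrow> ('a \<Rightarrow> 'b::euclidean_space) \<Rightarrow> real" where
  "L2_nrm \<Omega> f = sqrt (LINT x|lebesgue_on \<Omega>. (norm (f x))\<^sup>2)"

definition Linf_nrm :: "'a::euclidean_space set \<Rightarrow> ('a \<Rightarrow> real) \<Rightarrow> ereal" where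
  "Linf_nrm \<Omega> f = esssup (lebesgue_on \<Omega>) (\<lambda>x. ereal \<bar>f x\<bar>)"

definition Linf :: "'a::euclidean_space set \<Rightarrow> ('a \<Rightarrow> real) set" where
  "Linf \<Omega> = {f \<in> borel_measurable (lebesgue_on \<Omega>). Linf_nrm \<Omega> f < \<infinity>}"

text \<open>
  The support of an almost-everywhere class: the complement in \<open>\<Omega>\<close> of the largest relatively open
  subset of \<open>\<Omega>\<close> on which the function vanishes almost everywhere.
\<close>

definition ess_supp :: "'a::euclidean_space set \<Rightarrow> ('a \<Rightarrow> real) \<Rightarrow> 'a set" where
  "ess_supp \<Omega> f =
     {x \<in> \<Omega>. \<forall>U. open U \<and> x \<in> U \<longrightarrow> \<not> (AE y in lebesgue_on \<Omega>. y \<in> U \<longrightarrow> f y = 0)}"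

subsection \<open>Sobolev spaces\<close>

primrec Ck :: "nat \<Rightarrow> ('a::euclidean_space \<Rightarrow> real) \<Rightarrow> bool" where
  "Ck 0 f \<longleftrightarrow> continuous_on UNIV f"
| "Ck (Suc k) f \<longleftrightarrow>
     (\<forall>x. f differentiable (at x)) \<and> (\<forall>b\<in>Basis. Ck k (\<lambda>x. frechet_derivative f (at x) b))"

text \<open>The space \<open>C\<^sub>c\<^sup>\<infinity>(\<Omega>)\<close>, its elements being extended by zero to the whole space.\<close>

definition test_fun :: "'a::euclidean_space set \<Rightarrow> ('a \<Rightarrow> real) set" where
  "test_fun \<Omega> = {\<phi>. (\<forall>k. Ck k \<phi>) \<and> compact (closure {x. \<phi> x \<noteq> 0}) \<and> closure {x. \<phi> x \<noteq> 0} \<subseteq> \<Omega>}"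

definition weak_gradient :: "'a::euclidean_space set \<Rightarrow> ('a \<Rightarrow> real) \<Rightarrow> ('a \<Rightarrow> 'a) \<Rightarrow> bool" where
  "weak_gradient \<Omega> u g \<longleftrightarrow>
     (\<forall>\<phi>\<in>test_fun \<Omega>. \<forall>b\<in>Basis.
        (LINT x|lebesgue_on \<Omega>. u x * frechet_derivative \<phi> (at x) b) =
        - (LINT x|lebesgue_on \<Omega>. (g x \<bullet> b) * \<phi> x))"

definition H1 :: "'a::euclidean_space set \<Rightarrow> ('a \<Rightarrow> real) set" where
  "H1 \<Omega> = {u \<in> L2 \<Omega>. \<exists>g\<in>L2 \<Omega>. weak_gradient \<Omega> u g}"

text \<open>The weak gradient of an element of \<open>H\<^sup>1(\<Omega>)\<close>, which is unique almost everywhere in \<open>\<Omega>\<close>.\<close>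

definition wgrad :: "'a::euclidean_space set \<Rightarrow> ('a \<Rightarrow> real) \<Rightarrow> 'a \<Rightarrow> 'a" where
  "wgrad \<Omega> u = (SOME g. g \<in> L2 \<Omega> \<and> weak_gradient \<Omega> u g)"

definition H1_nrm :: "'a::euclidean_space set \<Rightarrow> ('a \<Rightarrow> real) \<Rightarrow> real" where
  "H1_nrm \<Omega> u = sqrt (LINT x|lebesgue_on \<Omega>. (norm (wgrad \<Omega> u x))\<^sup>2 + (u x)\<^sup>2)"

definition H10 :: "'a::euclidean_space set \<Rightarrow> ('a \<Rightarrow> real) set" where
  "H10 \<Omega> = {u \<in> H1 \<Omega>. \<exists>\<phi>::nat \<Rightarrow> 'a \<Rightarrow> real.
     (\<forall>k. \<phi> k \<in> test_fun \<Omega>) \<and> (\<lambda>k. H1_nrm \<Omega> (\<lambda>x. \<phi> k x - u x)) \<longlonglongrightarrow> 0}"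

subsection \<open>The Dirichlet realization of \<open>-\<Delta> + V\<close> and its spectrum\<close>

text \<open>
  The graph of the operator in \<open>L\<^sup>2(\<Omega>)\<close> given by the form \<open>\<integral> \<nabla>u \<bullet> \<nabla>\<phi> + V u \<phi>\<close> on \<open>H\<^sup>1\<^sub>0(\<Omega>)\<close>:
  \<open>u\<close> lies in its domain and is mapped to \<open>f\<close>.
\<close>

definition schroedinger_graph ::
    "'a::euclidean_space set \<Rightarrow> ('a \<Rightarrow> real) \<Rightarrow> ('a \<Rightarrow> real) \<Rightarrow> ('a \<Rightarrow> real) \<Rightarrow> bool" where
  "schroedinger_graph \<Omega> V u f \<longleftrightarrow> u \<in> H10 \<Omega> \<and> f \<in> L2 \<Omega> \<and>
     (\<forall>\<phi>\<in>H10 \<Omega>. (LINT x|lebesgue_on \<Omega>. wgrad \<Omega> u x \<bullet> wgrad \<Omega> \<phi> x + V x * u x * \<phi> x) =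
                  (LINT x|lebesgue_on \<Omega>. f x * \<phi> x))"

text \<open>
  The resolvent set: \<open>-\<Delta> + V - \<mu>\<close> is onto \<open>L\<^sup>2(\<Omega>)\<close> and has a bounded inverse; the estimate contains
  injectivity. The operator is self-adjoint, so that only real \<open>\<mu>\<close> need be considered.
\<close>

definition resolvent_set :: "'a::euclidean_space set \<Rightarrow> ('a \<Rightarrow> real) \<Rightarrow> real set" where
  "resolvent_set \<Omega> V = {\<mu>.
     (\<forall>f\<in>L2 \<Omega>. \<exists>u. schroedinger_graph \<Omega> V u (\<lambda>x. f x + \<mu> * u x)) \<and>
     (\<exists>C. \<forall>f\<in>L2 \<Omega>. \<forall>u. schroedinger_graph \<Omega> V u (\<lambda>x. f x + \<mu> * u x) \<longrightarrow>
        L2_nrm \<Omega> u \<le> C * L2_nrm \<Omega> f)}"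

definition spectrum :: "'a::euclidean_space set \<Rightarrow> ('a \<Rightarrow> real) \<Rightarrow> real set" where
  "spectrum \<Omega> V = - resolvent_set \<Omega> V"

subsection \<open>Assumptions on the coefficients\<close>

definition crit_exponent :: "nat \<Rightarrow> ereal" where
  "crit_exponent N = (if N \<ge> 3 then ereal (2 * real N / (real N - 2)) else \<infinity>)"

definition condition_A3 ::
    "'a::euclidean_space set \<Rightarrow> 'a \<Rightarrow> 'a \<Rightarrow> ('a \<Rightarrow> real) \<Rightarrow> (nat \<Rightarrow> 'a \<Rightarrow> real) \<Rightarrow> bool" where
  "condition_A3 \<Omega> x1 x2 V K \<longleftrightarrow>
     V \<in> Linf \<Omega> \<and> (AE x in lebesgue_on \<Omega>. 0 \<le> V x) \<and> spectrum \<Omega> V \<subseteq> {0<..} \<and>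
     (\<forall>n. K n \<in> Linf \<Omega>) \<and> (\<exists>B::real. \<forall>n. Linf_nrm \<Omega> (K n) \<le> ereal B) \<and>
     (\<forall>\<epsilon>>0. \<exists>M. \<forall>n\<ge>M. ess_supp \<Omega> (K n) \<subseteq> ball x1 \<epsilon> \<union> ball x2 \<epsilon>)"

definition condition_A4 ::
    "'a::euclidean_space set \<Rightarrow> 'a \<Rightarrow> 'a \<Rightarrow> (nat \<Rightarrow> 'a \<Rightarrow> real) \<Rightarrow> bool" where
  "condition_A4 \<Omega> x1 x2 Q \<longleftrightarrow>
     (\<forall>n. Q n \<in> Linf \<Omega>) \<and>
     (\<forall>n. \<exists>U. open U \<and> {x1} \<union> {x2} \<subseteq> U \<and> (AE x in lebesgue_on \<Omega>. x \<in> U \<longrightarrow> 0 < Q n x)) \<and>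
     (\<exists>C::real. \<forall>n. Linf_nrm \<Omega> (Q n) \<le> ereal C) \<and>
     (\<forall>\<epsilon>>0. \<exists>\<delta>>0. \<exists>M. \<forall>n\<ge>M.
        AE x in lebesgue_on \<Omega>. x \<notin> ball x1 \<epsilon> \<union> ball x2 \<epsilon> \<longrightarrow> Q n x \<le> - \<delta>)"

subsection \<open>Ground states and concentration\<close>

text \<open>
  The part over \<open>A \<subseteq> \<Omega>\<close> of \<open>\<parallel>u\<parallel>\<^sup>2 = \<integral> |\<nabla>u|\<^sup>2 + V u\<^sup>2\<close> and of \<open>J(u) = \<integral> Q |u|\<^sup>p\<close>. Only the square of
  the norm is used, as the integral may be negative for the finitely many \<open>n\<close> that are disregarded.
\<close>

definition energy ::
    "'a::euclidean_space set \<Rightarrow> 'a set \<Rightarrow> ('a \<Rightarrow> real) \<Rightarrow> ('a \<Rightarrow> real) \<Rightarrow> real" where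
  "energy \<Omega> A V u = (LINT x|lebesgue_on A. (norm (wgrad \<Omega> u x))\<^sup>2 + V x * (u x)\<^sup>2)"

definition Jfun ::
    "'a::euclidean_space set \<Rightarrow> real \<Rightarrow> ('a \<Rightarrow> real) \<Rightarrow> ('a \<Rightarrow> real) \<Rightarrow> real" where
  "Jfun A p Q u = (LINT x|lebesgue_on A. Q x * \<bar>u x\<bar> powr p)"

definition s_inf ::
    "'a::euclidean_space set \<Rightarrow> real \<Rightarrow> ('a \<Rightarrow> real) \<Rightarrow> ('a \<Rightarrow> real) \<Rightarrow> real" where
  "s_inf \<Omega> p V Q =
     Inf {energy \<Omega> \<Omega> V u / Jfun \<Omega> p Q u powr (2 / p) |u. u \<in> H10 \<Omega> \<and> 0 < Jfun \<Omega> p Q u}"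

definition weak_solution ::
    "'a::euclidean_space set \<Rightarrow> real \<Rightarrow> ('a \<Rightarrow> real) \<Rightarrow> ('a \<Rightarrow> real) \<Rightarrow> ('a \<Rightarrow> real) \<Rightarrow> bool" where
  "weak_solution \<Omega> p V Q u \<longleftrightarrow> u \<in> H10 \<Omega> \<and>
     (\<forall>\<phi>\<in>H10 \<Omega>. (LINT x|lebesgue_on \<Omega>. wgrad \<Omega> u x \<bullet> wgrad \<Omega> \<phi> x + V x * u x * \<phi> x) =
                  (LINT x|lebesgue_on \<Omega>. Q x * \<bar>u x\<bar> powr (p - 2) * u x * \<phi> x))"

definition ground_state ::
    "'a::euclidean_space set \<Rightarrow> real \<Rightarrow> ('a \<Rightarrow> real) \<Rightarrow> ('a \<Rightarrow> real) \<Rightarrow> ('a \<Rightarrow> real) \<Rightarrow> bool" where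
  "ground_state \<Omega> p V Q u \<longleftrightarrow> weak_solution \<Omega> p V Q u \<and>
     \<not> (AE x in lebesgue_on \<Omega>. u x = 0) \<and> 0 < Jfun \<Omega> p Q u \<and>
     energy \<Omega> \<Omega> V u / Jfun \<Omega> p Q u powr (2 / p) = s_inf \<Omega> p V Q"

definition vanishes_off_ball ::
    "'a::euclidean_space set \<Rightarrow> real \<Rightarrow> (nat \<Rightarrow> 'a \<Rightarrow> real) \<Rightarrow> (nat \<Rightarrow> 'a \<Rightarrow> real) \<Rightarrow>
     (nat \<Rightarrow> 'a \<Rightarrow> real) \<Rightarrow> 'a \<Rightarrow> real \<Rightarrow> bool" where
  "vanishes_off_ball \<Omega> p V Q u a \<epsilon> \<longleftrightarrow>
     (\<lambda>n. energy \<Omega> (\<Omega> - ball a \<epsilon>) (V n) (u n) / energy \<Omega> \<Omega> (V n) (u n)) \<longlonglongrightarrow> 0 \<and>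
     (\<lambda>n. Jfun (\<Omega> - ball a \<epsilon>) p (Q n) (u n) / Jfun \<Omega> p (Q n) (u n)) \<longlonglongrightarrow> 0"

end

theory Submission
  imports Defs "HOL-Real_Asymp.Real_Asymp"
begin

text \<open>
  A ground state cannot split between the two points, because the largest nonlinear term that a given
  energy can produce grows superlinearly, like the power \<open>p/2\<close> of the energy; and it cannot spread, because off
  the two points the nonlinear term acts as an absorption.

  Let \<open>u\<^sub>n\<close> be a ground state and \<open>E\<^sub>n = \<parallel>u\<^sub>n\<parallel>\<^sub>n\<^sup>2 = J\<^sub>n(u\<^sub>n)\<close>. Only small balls about the two points contribute
  positively to \<open>J\<^sub>n\<close>, and for a subcritical exponent the part of the \<open>p\<close>-th power integral over small balls
  is a small fraction of the \<open>p\<close>-th power of the norm. So \<open>J\<^sub>n(u) \<le> o(1) \<parallel>u\<parallel>\<^sub>n\<^sup>p\<close>, which forces \<open>E\<^sub>n \<rightarrow> \<infinity>\<close>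
  (\<open>E_at_top\<close>). On the other hand \<open>Q\<^sub>n \<le> -\<delta>\<close> off the two balls. Testing the equation there with a high power of
  a cutoff function times \<open>u\<^sub>n\<close> and absorbing the error by Young's inequality, in the manner of Keller and
  Osserman, bounds both the energy of \<open>u\<^sub>n\<close> and the integral of \<open>|Q\<^sub>n| |u\<^sub>n|\<^sup>p\<close> off the balls by a constant
  independent of \<open>n\<close> (\<open>local_bound\<close>).

  Compared with \<open>E\<^sub>n\<close> it therefore costs nothing to cut \<open>u\<^sub>n\<close> into two bumps \<open>\<beta>\<^sub>1 u\<^sub>n\<close> and \<open>\<beta>\<^sub>2 u\<^sub>n\<close>, one near each
  point. Put \<open>e\<^sub>j = \<parallel>\<beta>\<^sub>j u\<^sub>n\<parallel>\<^sub>n\<^sup>2\<close>. Then \<open>e\<^sub>1 + e\<^sub>2 = E\<^sub>n + O(1)\<close> and \<open>e\<^sub>j = J\<^sub>n(\<beta>\<^sub>j u\<^sub>n) + O(1)\<close>, while minimality of \<open>u\<^sub>n\<close> gives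
  \<open>J\<^sub>n(v) \<le> E\<^sub>n (\<parallel>v\<parallel>\<^sub>n\<^sup>2 / E\<^sub>n) powr (p/2)\<close>. A limit \<open>l\<close> of \<open>e\<^sub>1 / E\<^sub>n\<close> along a subsequence thus satisfies
  \<open>l \<le> l powr (p/2)\<close> with \<open>p/2 > 1\<close>, so that \<open>l\<close> is \<open>0\<close> or \<open>1\<close> (\<open>dichotomy\<close>).

  If \<open>l = 1\<close>, then \<open>e\<^sub>2 / E\<^sub>n \<rightarrow> 0\<close>, and the inequality \<open>e\<^sub>2 \<le> e\<^sub>2 (e\<^sub>2 / E\<^sub>n) powr (p/2 - 1) + O(1)\<close> improves this to
  \<open>e\<^sub>2 = O(1)\<close>. So everything off a ball about \<open>x\<^sub>1\<close> is bounded (\<open>off_ball_bounded\<close>), whereas \<open>E\<^sub>n \<rightarrow> \<infinity>\<close>. Boundedness of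
  \<open>e\<^sub>2\<close>, rather than \<open>e\<^sub>2 = o(E\<^sub>n)\<close>, matters when the sphere about \<open>x\<^sub>1\<close> passes through \<open>x\<^sub>2\<close>: it cuts through the second
  bump, where \<open>V\<^sub>n\<close> and \<open>Q\<^sub>n\<close> may change sign, and the integrals over a part of that bump are only
  controlled by absolute values. If \<open>l = 0\<close>, the two points change their roles.

  The analytic background consists of the uniqueness of weak gradients (\<open>weak_gradient_unique\<close>), the
  subcritical Sobolev inequality (\<open>sobolev_embedding_subcritical\<close>) and the coercivity of the energy
  (\<open>energy_coercive\<close>).
\<close>

section \<open>Smooth functions and cutoffs\<close>

lemma Ck_SucI:
  assumes "\<And>x. (f has_derivative D x) (at x)" "\<And>b. b \<in> Basis \<Longrightarrow> Ck k (\<lambda>x. D x b)"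
  shows "Ck (Suc k) f"
proof -
  have "frechet_derivative f (at x) = D x" for x
    using frechet_derivative_at[OF assms(1)] by simp
  then show ?thesis
    using assms by (auto simp: differentiable_def)
qed

lemma Ck_continuous: "Ck k f \<Longrightarrow> continuous_on UNIV f"
  by (cases k) (auto simp: continuous_on_eq_continuous_at differentiable_imp_continuous_within)

lemma Ck_SucD: "Ck (Suc k) f \<Longrightarrow> Ck k f"
proof (induction k arbitrary: f)
  case 0
  then show ?case by (auto intro: Ck_continuous[of "Suc 0"])
next
  case (Suc k)
  then show ?case by (metis Ck.simps(2))
qed

lemma Ck_has_derivative:
  "Ck (Suc k) f \<Longrightarrow> (f has_derivative frechet_derivative f (at x)) (at x)"
  by (simp add: frechet_derivative_works)

lemma Ck_const: "Ck k (\<lambda>x. c)"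
proof (induction k arbitrary: c)
  case (Suc k)
  show ?case by (rule Ck_SucI[of _ "\<lambda>x h. 0"]) (auto intro: Suc derivative_eq_intros)
qed auto

lemma Ck_add: "Ck k f \<Longrightarrow> Ck k g \<Longrightarrow> Ck k (\<lambda>x. f x + g x)"
proof (induction k arbitrary: f g)
  case 0 then show ?case by (auto intro: continuous_intros)
next
  case (Suc k)
  show ?case
    by (rule Ck_SucI[of _ "\<lambda>x h. frechet_derivative f (at x) h + frechet_derivative g (at x) h"])
       (use Suc in \<open>auto intro!: has_derivative_add simp: frechet_derivative_works\<close>)
qed

lemma Ck_mult: "Ck k f \<Longrightarrow> Ck k g \<Longrightarrow> Ck k (\<lambda>x. f x * g x)"
proof (induction k arbitrary: f g)
  case 0 then show ?case by (auto intro: continuous_intros)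
next
  case (Suc k)
  have "Ck k f" "Ck k g" using Suc.prems Ck_SucD by blast+
  then show ?case
    by (intro Ck_SucI[of _ "\<lambda>x h. f x * frechet_derivative g (at x) h + frechet_derivative f (at x) h * g x"]
        has_derivative_mult Ck_add Suc.IH)
       (use Suc.prems in \<open>auto simp: frechet_derivative_works\<close>)
qed

lemma Ck_diff: "Ck k f \<Longrightarrow> Ck k g \<Longrightarrow> Ck k (\<lambda>x. f x - g x)"
  using Ck_add[OF _ Ck_mult[OF Ck_const[of k "-1"]], of f g] by simp

lemma Ck_sum: "(\<And>i. i \<in> I \<Longrightarrow> Ck k (f i)) \<Longrightarrow> Ck k (\<lambda>x. \<Sum>i\<in>I. f i x)"
  by (induction I rule: infinite_finite_induct) (auto intro: Ck_const Ck_add)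

lemma Ck_prod: "(\<And>i. i \<in> I \<Longrightarrow> Ck k (f i)) \<Longrightarrow> Ck k (\<lambda>x. \<Prod>i\<in>I. f i x)"
  by (induction I rule: infinite_finite_induct) (auto intro: Ck_const Ck_mult)

lemma Ck_inner: "Ck k (\<lambda>x. (x - a) \<bullet> v)"
proof (cases k)
  case 0 then show ?thesis by (auto intro!: continuous_intros)
next
  case (Suc m)
  show ?thesis unfolding Suc
    by (rule Ck_SucI[of _ "\<lambda>x h. h \<bullet> v"]) (auto intro!: derivative_eq_intros Ck_const)
qed

lemma Ck_inverse:
  assumes "Ck k g" "\<And>x. g x \<noteq> 0"
  shows "Ck k (\<lambda>x. inverse (g x))"
  using assms(1)
proof (induction k)
  case 0 then show ?case using assms(2) by (auto intro!: continuous_intros)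
next
  case (Suc k)
  have "Ck k g" using Suc.prems Ck_SucD by blast
  have d: "((\<lambda>x. inverse (g x)) has_derivative
      (\<lambda>h. (-1) * (inverse (g x) * inverse (g x)) * frechet_derivative g (at x) h)) (at x)" for x
    using Deriv.has_derivative_inverse[OF assms(2) Ck_has_derivative[OF Suc.prems]]
    by (simp add: algebra_simps)
  show ?case
    by (intro Ck_SucI[OF d] Ck_mult Ck_const Suc.IH \<open>Ck k g\<close>) (use Suc.prems in auto)
qed

text \<open>
  The derivative of each of these functions is a linear combination of two others, so that an
  induction on the order of differentiability covers all of them at once.
\<close>

definition flat_exp :: "nat \<Rightarrow> real \<Rightarrow> real" where
  "flat_exp m x = (if x \<le> 0 then 0 else exp (- (1 / x)) / x ^ m)"

lemma flat_exp_nonneg: "0 \<le> flat_exp m x"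
  by (simp add: flat_exp_def)

lemma flat_exp_pos_iff: "0 < flat_exp m x \<longleftrightarrow> 0 < x"
  by (simp add: flat_exp_def)

lemma power_div_fact_le_exp:
  assumes "0 \<le> (z::real)"
  shows "z ^ n / fact n \<le> exp z"
proof -
  have "(\<Sum>k\<in>{n}. z ^ k /\<^sub>R fact k) \<le> (\<Sum>k. z ^ k /\<^sub>R fact k)"
    using exp_converges[of z] assms by (intro sum_le_suminf) (auto simp: sums_iff)
  also have "\<dots> = exp z" using exp_converges[of z] by (simp add: sums_iff)
  finally have "(\<Sum>k\<in>{n}. z ^ k /\<^sub>R fact k) \<le> exp z" .
  then show ?thesis by (simp add: divide_inverse_commute)
qed

lemma flat_exp_le:
  assumes "0 < x"
  shows "flat_exp m x \<le> fact (m + 2) * x\<^sup>2"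
proof -
  have "1 \<le> fact (m + 2) * x ^ (m + 2) * exp (1 / x)"
    using power_div_fact_le_exp[of "1 / x" "m + 2"] assms
    by (simp add: divide_le_eq le_divide_eq power_one_over mult_ac)
  then have "1 / (exp (1 / x) * x ^ m) \<le> fact (m + 2) * x\<^sup>2"
    using assms by (simp add: divide_le_eq power_add mult_ac power2_eq_square)
  then show ?thesis
    using assms by (simp add: flat_exp_def exp_minus divide_inverse mult_ac)
qed

lemma flat_exp_DERIV: "(flat_exp m has_real_derivative (flat_exp (m + 2) x - m * flat_exp (m + 1) x)) (at x)"
proof -
  consider "x < 0" | "x = 0" | "0 < x" by linarith
  then show ?thesis
  proof cases
    case 1
    have "((\<lambda>x. 0) has_real_derivative (flat_exp (m + 2) x - m * flat_exp (m + 1) x)) (at x)"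
      using 1 by (auto simp: flat_exp_def)
    then show ?thesis
      by (rule has_field_derivative_transform_within_open[where S="{..<0}"]) (use 1 in \<open>auto simp: flat_exp_def\<close>)
  next
    case 2
    \<comment> \<open>At the origin the quadratic bound makes the difference quotient vanish.\<close>
    have le: "\<bar>flat_exp m h / h\<bar> \<le> fact (m + 2) * \<bar>h\<bar>" for h :: real
    proof (cases "0 < h")
      case True
      have "flat_exp m h / h \<le> fact (m + 2) * h"
        using flat_exp_le[OF True, of m] True by (simp only: divide_le_eq power2_eq_square mult.assoc if_True)
      then show ?thesis using True flat_exp_nonneg[of m h] by simp
    next
      case False
      have "0 \<le> fact (m + 2) * \<bar>h\<bar>" by (intro mult_nonneg_nonneg) auto
      with False show ?thesis by (simp only: flat_exp_def not_less if_True div_0 abs_zero)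
    qed
    have "(\<lambda>h. flat_exp m h / h) \<midarrow>0\<rightarrow> 0"
      by (rule Lim_null_comparison[of _ "\<lambda>h. fact (m + 2) * \<bar>h\<bar>"])
         (auto intro!: tendsto_eq_intros always_eventually simp: le[simplified])
    then show ?thesis
      using 2 by (simp add: DERIV_def flat_exp_def[of _ 0])
  next
    case 3
    have "((\<lambda>x. exp (- (1 / x)) / x ^ m) has_real_derivative (flat_exp (m + 2) x - m * flat_exp (m + 1) x)) (at x)"
    proof -
      have dx: "((\<lambda>x. x ^ m) has_real_derivative m * x ^ m / x) (at x)"
        using DERIV_pow[of m x UNIV] 3 by (cases m) (auto simp: mult.commute)
      have "((\<lambda>x. exp (- (1 / x)) / x ^ m) has_real_derivative
          (exp (- (1 / x)) * (1 / x\<^sup>2) * x ^ m - exp (- (1 / x)) * (m * x ^ m / x)) / (x ^ m * x ^ m)) (at x)"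
        using 3 by (intro DERIV_divide dx) (auto intro!: derivative_eq_intros simp: power2_eq_square)
      also have "(exp (- (1 / x)) * (1 / x\<^sup>2) * x ^ m - exp (- (1 / x)) * (m * x ^ m / x)) / (x ^ m * x ^ m)
          = flat_exp (m + 2) x - m * flat_exp (m + 1) x"
        using 3 by (simp add: flat_exp_def field_simps power2_eq_square)
      finally show ?thesis .
    qed
    then show ?thesis
      by (rule has_field_derivative_transform_within_open[where S="{0<..}"]) (use 3 in \<open>auto simp: flat_exp_def\<close>)
  qed
qed

lemma Ck_flat_exp: "Ck k g \<Longrightarrow> Ck k (\<lambda>x. flat_exp m (g x))"
proof (induction k arbitrary: m)
  case 0
  have "continuous_on UNIV (flat_exp m)"
    by (meson DERIV_isCont continuous_at_imp_continuous_on flat_exp_DERIV)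
  then show ?case using 0 by (auto intro: continuous_on_compose2)
next
  case (Suc k)
  have "Ck k g" using Suc.prems Ck_SucD by blast
  have d: "((\<lambda>x. flat_exp m (g x)) has_derivative
      (\<lambda>h. (flat_exp (m + 2) (g x) - m * flat_exp (m + 1) (g x)) * frechet_derivative g (at x) h)) (at x)" for x
    using has_derivative_compose[OF Ck_has_derivative[OF Suc.prems]
      flat_exp_DERIV[unfolded has_field_derivative_def]] .
  show ?case
    by (intro Ck_SucI[OF d] Ck_mult Ck_diff Ck_const Suc.IH \<open>Ck k g\<close>) (use Suc.prems in auto)
qed

abbreviation smooth :: "('a::euclidean_space \<Rightarrow> real) \<Rightarrow> bool" where
  "smooth f \<equiv> \<forall>k. Ck k f"

definition grad :: "('a::euclidean_space \<Rightarrow> real) \<Rightarrow> 'a \<Rightarrow> 'a" where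
  "grad f x = (\<Sum>b\<in>Basis. frechet_derivative f (at x) b *\<^sub>R b)"

lemma has_derivative_grad:
  assumes "f differentiable (at x)"
  shows "(f has_derivative (\<lambda>h. grad f x \<bullet> h)) (at x)"
proof -
  have d: "(f has_derivative frechet_derivative f (at x)) (at x)"
    using assms by (simp add: frechet_derivative_works)
  interpret linear "frechet_derivative f (at x)"
    using has_derivative_linear[OF d] .
  have "frechet_derivative f (at x) h = grad f x \<bullet> h" for h
  proof -
    have "frechet_derivative f (at x) h = frechet_derivative f (at x) (\<Sum>b\<in>Basis. (h \<bullet> b) *\<^sub>R b)"
      by (simp add: euclidean_representation)
    also have "\<dots> =
        (\<Sum>b\<in>Basis. (h \<bullet> b) * frechet_derivative f (at x) b)"
      by (simp add: sum scale)
    finally show ?thesis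
      by (simp add: grad_def inner_sum_left inner_commute[of h] mult.commute)
  qed
  then have "frechet_derivative f (at x) = (\<lambda>h. grad f x \<bullet> h)" by blast
  with d show ?thesis by simp
qed

lemma smooth_differentiable: "smooth f \<Longrightarrow> f differentiable (at x)"
  using Ck.simps(2) by blast

lemma frechet_derivative_eq_grad: "f differentiable (at x) \<Longrightarrow> frechet_derivative f (at x) h = grad f x \<bullet> h"
  using frechet_derivative_at[OF has_derivative_grad] by metis

lemma grad_unique:
  assumes "(f has_derivative (\<lambda>h. v \<bullet> h)) (at x)"
  shows "grad f x = v"
proof -
  have "frechet_derivative f (at x) = (\<lambda>h. v \<bullet> h)"
    using frechet_derivative_at[OF assms] by simp
  then show ?thesis by (simp add: grad_def euclidean_representation)
qed

lemma grad_mult: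
  assumes "f differentiable (at x)" "g differentiable (at x)"
  shows "grad (\<lambda>x. f x * g x) x = f x *\<^sub>R grad g x + g x *\<^sub>R grad f x"
  by (rule grad_unique)
     (use has_derivative_mult[OF assms[THEN has_derivative_grad]] in \<open>simp add: inner_add_left algebra_simps\<close>)

lemma continuous_on_grad:
  assumes "smooth f"
  shows "continuous_on UNIV (grad f)"
proof -
  have "Ck 1 f" using assms by blast
  then have "continuous_on UNIV (\<lambda>x. frechet_derivative f (at x) b)" if "b \<in> Basis" for b
    using that by simp
  then show ?thesis unfolding grad_def by (intro continuous_intros) auto
qed

lemma grad_eq_0_outside:
  assumes "x \<notin> closure {x. f x \<noteq> 0}"
  shows "grad f x = 0"
proof (rule grad_unique)
  have "((\<lambda>x. 0) has_derivative (\<lambda>h. 0 \<bullet> h)) (at x)" by simp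
  then show "(f has_derivative (\<lambda>h. 0 \<bullet> h)) (at x)"
    by (rule has_derivative_transform_within_open[where s="- closure {x. f x \<noteq> 0}"])
       (use assms closure_subset[of "{x. f x \<noteq> 0}"] in \<open>auto\<close>)
qed

lemma smooth_norm_diff_sq: "smooth (\<lambda>x. (norm (x - a))\<^sup>2)"
proof -
  have "(\<lambda>x. (norm (x - a))\<^sup>2) = (\<lambda>x. \<Sum>b\<in>Basis. ((x - a) \<bullet> b) * ((x - a) \<bullet> b))"
    by (subst power2_norm_eq_inner, subst euclidean_inner) (rule refl)
  then show ?thesis by (auto intro!: Ck_sum Ck_mult Ck_inner)
qed

text \<open>
  The quotient \<open>A / (A + B)\<close> of flat functions, where \<open>A\<close> vanishes outside the large ball and
  \<open>B\<close> inside the small one.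
\<close>

lemma smooth_cutoff:
  fixes a :: "'a::euclidean_space"
  assumes "0 < s" "s < t"
  obtains \<eta> where "smooth \<eta>" "\<And>x. 0 \<le> \<eta> x" "\<And>x. \<eta> x \<le> 1"
    "\<And>x. dist a x \<le> s \<Longrightarrow> \<eta> x = 1" "\<And>x. t \<le> dist a x \<Longrightarrow> \<eta> x = 0"
proof -
  define A where "A = (\<lambda>x. flat_exp 0 (t\<^sup>2 - (norm (x - a))\<^sup>2))"
  define B where "B = (\<lambda>x. flat_exp 0 ((norm (x - a))\<^sup>2 - s\<^sup>2))"
  have sm: "smooth A" "smooth B"
    unfolding A_def B_def by (auto intro!: Ck_flat_exp Ck_diff Ck_const smooth_norm_diff_sq[rule_format])
  have nn: "0 \<le> A x" "0 \<le> B x" for x by (auto simp: A_def B_def flat_exp_nonneg)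
  have st: "s\<^sup>2 < t\<^sup>2" using assms by (simp add: power_strict_mono)
  have pos: "0 < A x + B x" for x
  proof (cases "(norm (x - a))\<^sup>2 < t\<^sup>2")
    case True
    then have "0 < A x" by (simp add: A_def flat_exp_pos_iff)
    then show ?thesis using nn[of x] by linarith
  next
    case False
    then have "0 < B x" using st by (simp add: B_def flat_exp_pos_iff)
    then show ?thesis using nn[of x] by linarith
  qed
  define \<eta> where "\<eta> = (\<lambda>x. A x * inverse (A x + B x))"
  show thesis
  proof
    show "smooth \<eta>" unfolding \<eta>_def
      using pos by (auto intro!: Ck_mult Ck_inverse Ck_add sm[rule_format] simp: less_imp_neq[symmetric])
    show "0 \<le> \<eta> x" "\<eta> x \<le> 1" for x
      using nn[of x] pos[of x] by (auto simp: \<eta>_def field_simps)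
    show "\<eta> x = 1" if "dist a x \<le> s" for x
    proof -
      have "(norm (x - a))\<^sup>2 \<le> s\<^sup>2" using that assms by (simp add: dist_norm norm_minus_commute power_mono)
      then have "B x = 0" by (simp add: B_def flat_exp_def)
      then show ?thesis using pos[of x] by (simp add: \<eta>_def)
    qed
    show "\<eta> x = 0" if "t \<le> dist a x" for x
    proof -
      have "t\<^sup>2 \<le> (norm (x - a))\<^sup>2" using that assms by (simp add: dist_norm norm_minus_commute power_mono)
      then have "A x = 0" by (simp add: A_def flat_exp_def)
      then show ?thesis by (simp add: \<eta>_def)
    qed
  qed
qed

text \<open>
  The functions that generate indicator functions of open sets: \<open>flat_exp\<close> detects the
  positive half line, and a box is an intersection of half spaces.
\<close>

lemma smooth_positive_on_box:
  fixes a b :: "'a::euclidean_space"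
  obtains \<beta> where "smooth \<beta>" "\<And>x. 0 \<le> \<beta> x" "\<And>x. 0 < \<beta> x \<longleftrightarrow> x \<in> box a b"
proof
  let ?f = "\<lambda>i x. flat_exp 0 ((x - a) \<bullet> i) * flat_exp 0 ((x - b) \<bullet> (-i))"
  let ?\<beta> = "\<lambda>x. \<Prod>i\<in>Basis. ?f i x"
  show "smooth ?\<beta>"
    by (intro allI Ck_prod Ck_mult Ck_flat_exp Ck_inner)
  show nn: "0 \<le> ?\<beta> x" for x
    by (intro prod_nonneg) (auto simp: flat_exp_nonneg)
  show "0 < ?\<beta> x \<longleftrightarrow> x \<in> box a b" for x
  proof -
    have "0 < ?\<beta> x \<longleftrightarrow> (\<forall>i\<in>Basis. ?f i x \<noteq> 0)"
      using nn[of x] by (auto simp: less_le prod_zero_iff)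
    also have "\<dots> \<longleftrightarrow> x \<in> box a b"
      by (auto simp: mem_box flat_exp_def inner_diff_left not_le)
    finally show ?thesis .
  qed
qed

section \<open>Test functions and integration by parts\<close>

lemma integral_lebesgue_on_eq:
  fixes f :: "'a::euclidean_space \<Rightarrow> 'b::euclidean_space"
  assumes "\<Omega> \<in> sets lebesgue" "\<And>x. x \<notin> \<Omega> \<Longrightarrow> f x = 0"
  shows "(LINT x|lebesgue_on \<Omega>. f x) = (LINT x|lebesgue. f x)"
proof -
  have "(\<lambda>x. indicator \<Omega> x *\<^sub>R f x) = f" using assms(2) by (auto simp: indicator_def)
  then show ?thesis using assms(1) by (simp add: integral_restrict_space)
qed

lemma integrable_lebesgue_on_eq:
  fixes f :: "'a::euclidean_space \<Rightarrow> 'b::euclidean_space"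
  assumes "\<Omega> \<in> sets lebesgue" "\<And>x. x \<notin> \<Omega> \<Longrightarrow> f x = 0"
  shows "integrable (lebesgue_on \<Omega>) f \<longleftrightarrow> integrable lebesgue f"
proof -
  have "(\<lambda>x. indicator \<Omega> x *\<^sub>R f x) = f" using assms(2) by (auto simp: indicator_def)
  then show ?thesis using assms(1) by (simp add: integrable_restrict_space)
qed

lemma integrable_continuous_compact_support:
  fixes f :: "'a::euclidean_space \<Rightarrow> 'b::euclidean_space"
  assumes "continuous_on UNIV f" "compact K" "\<And>x. x \<notin> K \<Longrightarrow> f x = 0"
  shows "integrable lborel f" "integrable lebesgue f"
proof -
  have "(\<lambda>x. indicator K x *\<^sub>R f x) = f" using assms(3) by (auto simp: indicator_def)
  then show *: "integrable lborel f"
    using borel_integrable_compact[OF assms(2) continuous_on_subset[OF assms(1)]] by simp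
  then show "integrable lebesgue f"
    by (simp add: integrable_completion)
qed

lemma test_funE:
  assumes "\<phi> \<in> test_fun \<Omega>"
  obtains K where "smooth \<phi>" "compact K" "K \<subseteq> \<Omega>"
    "\<And>x. x \<notin> K \<Longrightarrow> \<phi> x = 0" "\<And>x. x \<notin> K \<Longrightarrow> grad \<phi> x = 0"
proof (rule that[of "closure {x. \<phi> x \<noteq> 0}"])
  show "smooth \<phi>" "compact (closure {x. \<phi> x \<noteq> 0})" "closure {x. \<phi> x \<noteq> 0} \<subseteq> \<Omega>"
    using assms by (simp_all add: test_fun_def)
  show "\<phi> x = 0" if "x \<notin> closure {x. \<phi> x \<noteq> 0}" for x
    using that closure_subset[of "{x. \<phi> x \<noteq> 0}"] by blast
qed (rule grad_eq_0_outside)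

lemma test_funD:
  assumes "\<phi> \<in> test_fun \<Omega>"
  shows "smooth \<phi>" "\<And>x. x \<notin> \<Omega> \<Longrightarrow> \<phi> x = 0" "\<And>x. x \<notin> \<Omega> \<Longrightarrow> grad \<phi> x = 0"
  using assms by (auto elim!: test_funE simp: subset_iff)

lemma test_funI:
  assumes "smooth \<phi>" "compact K" "K \<subseteq> \<Omega>" "\<And>x. x \<notin> K \<Longrightarrow> \<phi> x = 0"
  shows "\<phi> \<in> test_fun \<Omega>"
proof -
  have "closure {x. \<phi> x \<noteq> 0} \<subseteq> K"
    using assms by (intro closure_minimal) (auto intro: compact_imp_closed)
  moreover from this have "compact (closure {x. \<phi> x \<noteq> 0})"
    using assms(2) closed_closure by (metis closed_Int_compact inf.absorb_iff1)
  ultimately show ?thesis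
    using assms by (auto simp: test_fun_def)
qed

lemma test_fun_mult_smooth:
  assumes "smooth \<eta>" "\<phi> \<in> test_fun \<Omega>"
  shows "(\<lambda>x. \<eta> x * \<phi> x) \<in> test_fun \<Omega>"
  using assms(2)
proof (rule test_funE)
  fix K assume K: "smooth \<phi>" "compact K" "K \<subseteq> \<Omega>" "\<And>x. x \<notin> K \<Longrightarrow> \<phi> x = 0"
  show ?thesis
    by (rule test_funI[OF _ K(2,3)]) (use assms(1) K(1) Ck_mult in blast, simp add: K(4))
qed

lemma test_fun_mono: "\<Omega> \<subseteq> \<Omega>' \<Longrightarrow> \<phi> \<in> test_fun \<Omega> \<Longrightarrow> \<phi> \<in> test_fun \<Omega>'"
  by (auto simp: test_fun_def)

lemma bounded_compact_support:
  fixes f :: "'a::euclidean_space \<Rightarrow> 'b::real_normed_vector"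
  assumes "continuous_on UNIV f" "compact K" "\<And>x. x \<notin> K \<Longrightarrow> f x = 0"
  obtains L where "0 \<le> L" "\<And>x. norm (f x) \<le> L"
proof -
  have "bounded (f ` K)"
    using assms by (intro compact_imp_bounded compact_continuous_image) (auto intro: continuous_on_subset)
  then obtain B where B: "\<And>x. x \<in> K \<Longrightarrow> norm (f x) \<le> B" by (auto simp: bounded_iff)
  have "norm (f x) \<le> max B 0" for x
    using B[of x] assms(3)[of x] by (cases "x \<in> K") auto
  then show thesis using that[of "max B 0"] by simp
qed

text \<open>The difference quotients of a test function integrate to zero, as Lebesgue measure is translation invariant.\<close>

lemma integral_frechet_derivative_eq_0:
  fixes \<phi> :: "'a::euclidean_space \<Rightarrow> real"
  assumes "\<phi> \<in> test_fun UNIV"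
  shows "(LINT x|lebesgue. frechet_derivative \<phi> (at x) b) = 0"
proof -
  obtain K where \<phi>: "smooth \<phi>" "compact K" "K \<subseteq> UNIV"
      "\<And>x. x \<notin> K \<Longrightarrow> \<phi> x = 0" "\<And>x. x \<notin> K \<Longrightarrow> grad \<phi> x = 0"
    using test_funE[OF assms] by blast
  have der: "(\<phi> has_derivative (\<lambda>h. grad \<phi> x \<bullet> h)) (at x)" for x
    by (rule has_derivative_grad[OF smooth_differentiable[OF \<phi>(1)]])
  have cont: "continuous_on UNIV \<phi>" using \<phi>(1) Ck_continuous by blast
  have cg: "continuous_on UNIV (grad \<phi>)" using \<phi>(1) continuous_on_grad by blast
  obtain L where L: "0 \<le> L" "\<And>x. norm (grad \<phi> x) \<le> L"
    using bounded_compact_support[OF cg \<phi>(2,5)] by auto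
  obtain R where R: "\<And>x. x \<in> K \<Longrightarrow> norm x \<le> R" "0 \<le> R"
    using compact_imp_bounded[OF \<phi>(2)] bounded_pos by (metis less_imp_le)
  define D where "D n x = (\<phi> (x + (1 / (real n + 1)) *\<^sub>R b) - \<phi> x) / (1 / (real n + 1))" for n x
  let ?C = "cball 0 (R + norm b) :: 'a set"
  have lip: "\<bar>\<phi> y - \<phi> x\<bar> \<le> L * norm (y - x)" for x y
  proof -
    have "onorm (\<lambda>h. grad \<phi> x \<bullet> h) \<le> L" for x
      using L by (intro onorm_le order_trans[OF Cauchy_Schwarz_ineq2[folded real_norm_def]] mult_right_mono) auto
    then show ?thesis
      using differentiable_bound[of UNIV \<phi> "\<lambda>x h. grad \<phi> x \<bullet> h" L y x] der
      by (auto simp: has_derivative_at_withinI)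
  qed
  have bound: "\<bar>D n x\<bar> \<le> indicator ?C x * (L * norm b)" for n x
  proof (cases "x \<in> ?C")
    case True
    have "\<bar>\<phi> (x + (1 / (real n + 1)) *\<^sub>R b) - \<phi> x\<bar> \<le> L * norm b * (1 / (real n + 1))"
      using lip[of "x + (1 / (real n + 1)) *\<^sub>R b" x] by simp
    then have "\<bar>D n x\<bar> \<le> L * norm b"
      unfolding D_def abs_divide by (subst divide_le_eq) (auto simp: field_simps)
    then show ?thesis using True by simp
  next
    case False
    have "norm ((1 / (real n + 1)) *\<^sub>R b) \<le> norm b"
      by (auto simp: divide_le_eq mult_le_cancel_left1)
    moreover have "norm x > R + norm b" using False by (simp add: not_le)
    moreover have "norm x \<le> norm (x + (1 / (real n + 1)) *\<^sub>R b) + norm ((1 / (real n + 1)) *\<^sub>R b)"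
      by (metis add_diff_cancel norm_triangle_ineq4)
    ultimately have "x + (1 / (real n + 1)) *\<^sub>R b \<notin> K" "x \<notin> K"
      using R by (smt (verit) norm_ge_zero)+
    then show ?thesis using \<phi>(4) False by (simp add: D_def)
  qed
  have intD: "(LINT x|lborel. D n x) = 0" for n
  proof -
    have i1: "integrable lborel \<phi>"
      by (rule integrable_continuous_compact_support(1)[OF cont \<phi>(2,4)])
    let ?h = "(1 / (real n + 1)) *\<^sub>R b"
    have tr: "integrable lborel (\<lambda>x. \<phi> (?h + x))" "(LINT x|lborel. \<phi> (?h + x)) = (LINT x|lborel. \<phi> x)"
      using integrable_distr_eq[of "\<lambda>x. ?h + x" lborel borel \<phi>] integral_distr[of "\<lambda>x. ?h + x" lborel borel \<phi>] i1
      by (simp_all add: lborel_distr_plus borel_measurable_integrable)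
    show ?thesis unfolding D_def using tr i1 by (simp add: add.commute[of _ ?h])
  qed
  have lim: "(\<lambda>n. D n x) \<longlonglongrightarrow> grad \<phi> x \<bullet> b" for x
  proof -
    have "((\<lambda>t. \<phi> (x + t *\<^sub>R b)) has_derivative (\<lambda>t. grad \<phi> x \<bullet> (t *\<^sub>R b))) (at 0)"
      by (rule has_derivative_compose[where g=\<phi>]) (auto intro!: derivative_eq_intros der)
    then have "((\<lambda>t. \<phi> (x + t *\<^sub>R b)) has_real_derivative (grad \<phi> x \<bullet> b)) (at 0)"
      by (simp add: has_field_derivative_def mult_commute_abs)
    then have "((\<lambda>h. (\<phi> (x + (0 + h) *\<^sub>R b) - \<phi> (x + 0 *\<^sub>R b)) / h) \<longlongrightarrow> grad \<phi> x \<bullet> b) (at 0)"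
      by (simp only: DERIV_def)
    moreover have "filterlim (\<lambda>n. 1 / (real n + 1)) (at 0) sequentially"
      by real_asymp
    ultimately have "(\<lambda>n. (\<phi> (x + (0 + 1 / (real n + 1)) *\<^sub>R b) - \<phi> (x + 0 *\<^sub>R b)) / (1 / (real n + 1)))
        \<longlonglongrightarrow> grad \<phi> x \<bullet> b"
      by (rule filterlim_compose)
    then show ?thesis by (simp add: D_def)
  qed
  have "(\<lambda>n. LINT x|lborel. D n x) \<longlonglongrightarrow> (LINT x|lborel. grad \<phi> x \<bullet> b)"
  proof (rule integral_dominated_convergence[where w="\<lambda>x. indicator ?C x * (L * norm b)"])
    show "(\<lambda>x. grad \<phi> x \<bullet> b) \<in> borel_measurable lborel" "D n \<in> borel_measurable lborel" for n
      using cont cg by (auto intro!: borel_measurable_continuous_onI continuous_intros continuous_on_compose2[OF cont] simp: D_def)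
    show "integrable lborel (\<lambda>x. indicator ?C x * (L * norm b))"
      using borel_integrable_compact[of ?C "\<lambda>x. L * norm b"] by simp
  qed (use lim bound in auto)
  then have "(LINT x|lborel. grad \<phi> x \<bullet> b) = 0"
    unfolding intD by (simp add: LIMSEQ_const_iff)
  then show ?thesis
    using cg by (subst integral_completion)
      (auto simp: frechet_derivative_eq_grad[OF smooth_differentiable[OF \<phi>(1)]]
        intro!: borel_measurable_continuous_onI continuous_intros)
qed

text \<open>
  Integration by parts is the vanishing of the integral of the derivative of \<open>\<phi> \<psi>\<close>, which is a
  test function as soon as one factor is a test function and the other is smooth.
\<close>

lemma weak_gradient_smooth:
  assumes "open \<Omega>" "smooth \<phi>"
  shows "weak_gradient \<Omega> \<phi> (grad \<phi>)"
  unfolding weak_gradient_def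
proof (intro ballI)
  fix \<psi> b assume \<psi>: "\<psi> \<in> test_fun \<Omega>" and b: "b \<in> (Basis :: 'a set)"
  obtain K where t: "smooth \<psi>" "compact K" "K \<subseteq> \<Omega>"
      "\<And>x. x \<notin> K \<Longrightarrow> \<psi> x = 0" "\<And>x. x \<notin> K \<Longrightarrow> grad \<psi> x = 0"
    using test_funE[OF \<psi>] by blast
  have \<Omega>: "\<Omega> \<in> sets lebesgue" using assms(1) by auto
  note d = smooth_differentiable[OF assms(2)] smooth_differentiable[OF t(1)]
  note c = Ck_continuous[OF assms(2)[rule_format]] Ck_continuous[OF t(1)[rule_format]]
    continuous_on_grad[OF assms(2)] continuous_on_grad[OF t(1)]
  have i: "integrable lebesgue (\<lambda>x. \<phi> x * (grad \<psi> x \<bullet> b))" "integrable lebesgue (\<lambda>x. (grad \<phi> x \<bullet> b) * \<psi> x)"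
    by (rule integrable_continuous_compact_support(2)[OF _ t(2)], intro continuous_intros c, simp add: t(4,5))+
  have "(\<lambda>x. \<phi> x * \<psi> x) \<in> test_fun UNIV"
    by (rule test_fun_mono[OF _ test_fun_mult_smooth[OF assms(2) \<psi>]]) simp
  note e = integral_frechet_derivative_eq_0[OF this, of b]
  have "frechet_derivative (\<lambda>x. \<phi> x * \<psi> x) (at x) b = \<phi> x * (grad \<psi> x \<bullet> b) + (grad \<phi> x \<bullet> b) * \<psi> x" for x
    using d by (subst frechet_derivative_eq_grad) (simp_all add: grad_mult[OF d] inner_add_left mult.commute)
  with e i have "(LINT x|lebesgue. \<phi> x * (grad \<psi> x \<bullet> b)) = - (LINT x|lebesgue. (grad \<phi> x \<bullet> b) * \<psi> x)"
    by simp
  then show "(LINT x|lebesgue_on \<Omega>. \<phi> x * frechet_derivative \<psi> (at x) b) =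
      - (LINT x|lebesgue_on \<Omega>. (grad \<phi> x \<bullet> b) * \<psi> x)"
    by (simp add: frechet_derivative_eq_grad[OF d(2)] integral_lebesgue_on_eq[OF \<Omega>] test_funD(2,3)[OF \<psi>])
qed

section \<open>Uniqueness of weak gradients\<close>

lemma L2D:
  assumes "f \<in> L2 \<Omega>"
  shows "f \<in> borel_measurable (lebesgue_on \<Omega>)" "integrable (lebesgue_on \<Omega>) (\<lambda>x. (norm (f x))\<^sup>2)"
  using assms by (auto simp: L2_def)

lemma L2_mult_integrable:
  fixes f g :: "'a::euclidean_space \<Rightarrow> 'b::euclidean_space"
  assumes "f \<in> L2 \<Omega>" "g \<in> L2 \<Omega>"
  shows "integrable (lebesgue_on \<Omega>) (\<lambda>x. f x \<bullet> g x)"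
proof (rule Bochner_Integration.integrable_bound)
  show "integrable (lebesgue_on \<Omega>) (\<lambda>x. (norm (f x))\<^sup>2 + (norm (g x))\<^sup>2)"
    using assms by (auto dest: L2D)
  show "(\<lambda>x. f x \<bullet> g x) \<in> borel_measurable (lebesgue_on \<Omega>)"
    using assms[THEN L2D(1)] by measurable
  have "\<bar>f x \<bullet> g x\<bar> \<le> (norm (f x))\<^sup>2 + (norm (g x))\<^sup>2" for x
    using Cauchy_Schwarz_ineq2[of "f x" "g x"] sum_squares_bound[of "norm (f x)" "norm (g x)"]
      zero_le_power2[of "norm (f x)"] zero_le_power2[of "norm (g x)"] by linarith
  then show "AE x in lebesgue_on \<Omega>. norm (f x \<bullet> g x) \<le> norm ((norm (f x))\<^sup>2 + (norm (g x))\<^sup>2)"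
    by (auto simp: abs_of_nonneg)
qed

lemma norm_add_square_le: "(norm (a + b :: 'a::real_normed_vector))\<^sup>2 \<le> 2 * (norm a)\<^sup>2 + 2 * (norm b)\<^sup>2"
proof -
  have "(norm (a + b))\<^sup>2 \<le> (norm a + norm b)\<^sup>2"
    by (intro power_mono norm_triangle_ineq) auto
  also have "\<dots> \<le> 2 * (norm a)\<^sup>2 + 2 * (norm b)\<^sup>2"
    using sum_squares_bound[of "norm a" "norm b"] by (simp add: power2_sum)
  finally show ?thesis .
qed

lemma L2_add:
  fixes f g :: "'a::euclidean_space \<Rightarrow> 'b::euclidean_space"
  assumes "f \<in> L2 \<Omega>" "g \<in> L2 \<Omega>"
  shows "(\<lambda>x. f x + g x) \<in> L2 \<Omega>"
proof -
  note m = assms[THEN L2D(1)]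
  have "integrable (lebesgue_on \<Omega>) (\<lambda>x. (norm (f x + g x))\<^sup>2)"
  proof (rule Bochner_Integration.integrable_bound)
    show "integrable (lebesgue_on \<Omega>) (\<lambda>x. 2 * (norm (f x))\<^sup>2 + 2 * (norm (g x))\<^sup>2)"
      by (intro Bochner_Integration.integrable_add integrable_mult_right assms[THEN L2D(2)])
    show "(\<lambda>x. (norm (f x + g x))\<^sup>2) \<in> borel_measurable (lebesgue_on \<Omega>)"
      using m by measurable
    show "AE x in lebesgue_on \<Omega>. norm ((norm (f x + g x))\<^sup>2) \<le> norm (2 * (norm (f x))\<^sup>2 + 2 * (norm (g x))\<^sup>2)"
      by (intro AE_I2) (simp add: norm_add_square_le)
  qed
  with m show ?thesis by (simp add: L2_def)
qed

lemma L2_bounded_scaleR: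
  fixes f :: "'a::euclidean_space \<Rightarrow> 'b::euclidean_space"
  assumes "f \<in> L2 \<Omega>" "\<eta> \<in> borel_measurable (lebesgue_on \<Omega>)" "AE x in lebesgue_on \<Omega>. \<bar>\<eta> x\<bar> \<le> c"
  shows "(\<lambda>x. \<eta> x *\<^sub>R f x) \<in> L2 \<Omega>"
proof -
  note m = assms(1)[THEN L2D(1)]
  have "integrable (lebesgue_on \<Omega>) (\<lambda>x. (norm (\<eta> x *\<^sub>R f x))\<^sup>2)"
  proof (rule Bochner_Integration.integrable_bound)
    show "integrable (lebesgue_on \<Omega>) (\<lambda>x. c\<^sup>2 * (norm (f x))\<^sup>2)"
      by (intro integrable_mult_right assms(1)[THEN L2D(2)])
    show "(\<lambda>x. (norm (\<eta> x *\<^sub>R f x))\<^sup>2) \<in> borel_measurable (lebesgue_on \<Omega>)"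
      using m assms(2) by measurable
    show "AE x in lebesgue_on \<Omega>. norm ((norm (\<eta> x *\<^sub>R f x))\<^sup>2) \<le> norm (c\<^sup>2 * (norm (f x))\<^sup>2)"
      using assms(3)
    proof eventually_elim
      case (elim x)
      have "\<bar>\<eta> x\<bar>\<^sup>2 \<le> c\<^sup>2" using elim by (intro power_mono) auto
      then show ?case by (simp add: power_mult_distrib mult_right_mono)
    qed
  qed
  with m assms(2) show ?thesis by (simp add: L2_def)
qed

lemma L2_scaleR: "f \<in> L2 \<Omega> \<Longrightarrow> (\<lambda>x. c *\<^sub>R f x) \<in> L2 \<Omega>"
  by (rule L2_bounded_scaleR[where c="\<bar>c\<bar>"]) auto

lemma L2_diff: "f \<in> L2 \<Omega> \<Longrightarrow> g \<in> L2 \<Omega> \<Longrightarrow> (\<lambda>x. f x - g x) \<in> L2 \<Omega>"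
  using L2_add[OF _ L2_scaleR[of g \<Omega> "-1"]] by simp

lemma L2_product_integrable:
  fixes u v :: "'a::euclidean_space \<Rightarrow> real"
  shows "u \<in> L2 \<Omega> \<Longrightarrow> v \<in> L2 \<Omega> \<Longrightarrow> integrable (lebesgue_on \<Omega>) (\<lambda>x. u x * v x)"
  using L2_mult_integrable[of u \<Omega> v] by simp

lemma L2_inner_Basis:
  assumes "f \<in> L2 \<Omega>" "b \<in> Basis"
  shows "(\<lambda>x. f x \<bullet> b) \<in> L2 \<Omega>"
proof -
  note m = L2D(1)[OF assms(1)]
  have "integrable (lebesgue_on \<Omega>) (\<lambda>x. (norm (f x \<bullet> b))\<^sup>2)"
  proof (rule Bochner_Integration.integrable_bound[OF L2D(2)[OF assms(1)]])
    show "(\<lambda>x. (norm (f x \<bullet> b))\<^sup>2) \<in> borel_measurable (lebesgue_on \<Omega>)" using m by measurable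
    have "(norm (f x \<bullet> b))\<^sup>2 \<le> (norm (f x))\<^sup>2" for x
      using Basis_le_norm[OF assms(2), of "f x"] by (intro power_mono) auto
    then show "AE x in lebesgue_on \<Omega>. norm ((norm (f x \<bullet> b))\<^sup>2) \<le> norm ((norm (f x))\<^sup>2)"
      by (intro AE_I2) simp
  qed
  with m show ?thesis by (simp add: L2_def)
qed

lemma continuous_compact_support_L2:
  fixes f :: "'a::euclidean_space \<Rightarrow> 'b::euclidean_space"
  assumes "open \<Omega>" "continuous_on UNIV f" "compact K" "\<And>x. x \<notin> K \<Longrightarrow> f x = 0" "K \<subseteq> \<Omega>"
  shows "f \<in> L2 \<Omega>"
proof -
  have "f \<in> borel_measurable lebesgue"
    using assms(2) by (auto intro!: measurable_completion borel_measurable_continuous_onI)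
  then have m: "f \<in> borel_measurable (lebesgue_on \<Omega>)" by (rule measurable_restrict_space1)
  have "integrable lebesgue (\<lambda>x. (norm (f x))\<^sup>2)"
    by (rule integrable_continuous_compact_support(2)[OF _ assms(3)])
       (auto intro!: continuous_intros assms(2) simp: assms(4))
  moreover have "(norm (f x))\<^sup>2 = 0" if "x \<notin> \<Omega>" for x using assms(4,5) that by auto
  ultimately have "integrable (lebesgue_on \<Omega>) (\<lambda>x. (norm (f x))\<^sup>2)"
    using assms(1) by (subst integrable_lebesgue_on_eq) auto
  with m show ?thesis by (simp add: L2_def)
qed

lemma test_fun_L2:
  assumes "open \<Omega>" "\<phi> \<in> test_fun \<Omega>"
  shows "\<phi> \<in> L2 \<Omega>" "grad \<phi> \<in> L2 \<Omega>"
proof -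
  obtain K where K: "smooth \<phi>" "compact K" "K \<subseteq> \<Omega>"
    "\<And>x. x \<notin> K \<Longrightarrow> \<phi> x = 0" "\<And>x. x \<notin> K \<Longrightarrow> grad \<phi> x = 0"
    using test_funE[OF assms(2)] by blast
  show "\<phi> \<in> L2 \<Omega>"
    by (rule continuous_compact_support_L2[OF assms(1) Ck_continuous[OF K(1)[rule_format]] K(2,4,3)])
  show "grad \<phi> \<in> L2 \<Omega>"
    by (rule continuous_compact_support_L2[OF assms(1) continuous_on_grad[OF K(1)] K(2,5,3)])
qed

lemma weak_gradient_integrable:
  fixes u :: "'a::euclidean_space \<Rightarrow> real"
  assumes "open \<Omega>" "\<phi> \<in> test_fun \<Omega>" "b \<in> Basis" "u \<in> L2 \<Omega>" "g \<in> L2 \<Omega>"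
  shows "integrable (lebesgue_on \<Omega>) (\<lambda>x. u x * frechet_derivative \<phi> (at x) b)"
    "integrable (lebesgue_on \<Omega>) (\<lambda>x. (g x \<bullet> b) * \<phi> x)"
proof -
  note t = test_fun_L2[OF assms(1,2)]
  have "(\<lambda>x. u x *\<^sub>R b) \<in> L2 \<Omega>"
    using assms(3,4) by (auto simp: L2_def power_mult_distrib)
  from L2_mult_integrable[OF this t(2)]
  show "integrable (lebesgue_on \<Omega>) (\<lambda>x. u x * frechet_derivative \<phi> (at x) b)"
    by (simp add: frechet_derivative_eq_grad[OF smooth_differentiable[OF test_funD(1)[OF assms(2)]]] inner_commute)
  have "(\<lambda>x. \<phi> x *\<^sub>R b) \<in> L2 \<Omega>"
    using assms(3) t(1) by (auto simp: L2_def power_mult_distrib)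
  from L2_mult_integrable[OF assms(5) this]
  show "integrable (lebesgue_on \<Omega>) (\<lambda>x. (g x \<bullet> b) * \<phi> x)"
    by (simp add: mult.commute)
qed

lemma abs_le_square_add_one: "\<bar>t :: real\<bar> \<le> t\<^sup>2 + 1"
proof -
  have "0 \<le> (\<bar>t\<bar> - 1)\<^sup>2" by simp
  then show ?thesis by (simp add: power2_diff)
qed

text \<open>On a set of finite measure a square integrable function is dominated by \<open>F\<^sup>2 + 1\<close>.\<close>

lemma square_integrable_mult_bounded:
  fixes F \<psi> :: "'a::euclidean_space \<Rightarrow> real"
  assumes F: "F \<in> borel_measurable lebesgue" "integrable lebesgue (\<lambda>x. (F x)\<^sup>2)"
    and C: "C \<in> lmeasurable" and \<psi>: "\<psi> \<in> borel_measurable lebesgue" "\<And>x. \<bar>\<psi> x\<bar> \<le> indicator C x"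
  shows "integrable lebesgue (\<lambda>x. F x * \<psi> x)"
    and "integrable lebesgue (\<lambda>x. (F x)\<^sup>2 + indicator C x)" and "\<And>x. \<bar>F x * \<psi> x\<bar> \<le> (F x)\<^sup>2 + indicator C x"
proof -
  show i: "integrable lebesgue (\<lambda>x. (F x)\<^sup>2 + indicator C x)"
    using F(2) C by (intro Bochner_Integration.integrable_add) (auto simp flip: lmeasurable_iff_integrable)
  show le: "\<bar>F x * \<psi> x\<bar> \<le> (F x)\<^sup>2 + indicator C x" for x
  proof (cases "x \<in> C")
    case True
    have "\<bar>F x * \<psi> x\<bar> \<le> \<bar>F x\<bar> * 1"
      unfolding abs_mult using \<psi>(2)[of x] True by (intro mult_left_mono) auto
    then show ?thesis using True abs_le_square_add_one[of "F x"] by simp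
  next
    case False
    then show ?thesis using \<psi>(2)[of x] by simp
  qed
  show "integrable lebesgue (\<lambda>x. F x * \<psi> x)"
    by (rule Bochner_Integration.integrable_bound[OF i])
       (use F(1) \<psi>(1) order_trans[OF le abs_ge_self] in auto)
qed

lemma square_integrable_orthogonal_limit:
  fixes F \<psi> :: "'a::euclidean_space \<Rightarrow> real"
  assumes F: "F \<in> borel_measurable lebesgue" "integrable lebesgue (\<lambda>x. (F x)\<^sup>2)"
    and C: "C \<in> lmeasurable" and \<phi>: "\<And>j. \<phi> j \<in> borel_measurable lebesgue" "\<And>j x. \<bar>\<phi> j x\<bar> \<le> indicator C x"
    and \<psi>: "\<psi> \<in> borel_measurable lebesgue" "AE x in lebesgue. (\<lambda>j::nat. \<phi> j x) \<longlonglongrightarrow> \<psi> x"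
    and orth: "\<And>j. (LINT x|lebesgue. F x * \<phi> j x) = 0"
  shows "(LINT x|lebesgue. F x * \<psi> x) = 0"
proof -
  note b = square_integrable_mult_bounded[OF F C \<phi>]
  have "(\<lambda>j. LINT x|lebesgue. F x * \<phi> j x) \<longlonglongrightarrow> (LINT x|lebesgue. F x * \<psi> x)"
  proof (rule integral_dominated_convergence[where w="\<lambda>x. (F x)\<^sup>2 + indicator C x"])
    show "AE x in lebesgue. (\<lambda>j. F x * \<phi> j x) \<longlonglongrightarrow> F x * \<psi> x"
      using \<psi>(2) by eventually_elim (intro tendsto_mult tendsto_const)
    show "AE x in lebesgue. norm (F x * \<phi> j x) \<le> (F x)\<^sup>2 + indicator C x" for j
      using b(3) by simp
  qed (use F(1) \<phi>(1) \<psi>(1) b(2) in auto)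
  then show ?thesis by (simp add: orth LIMSEQ_const_iff)
qed

text \<open>
  The test functions \<open>\<beta> / (\<beta> + 1 / (j + 1))\<close> increase to the indicator function of the set
  where \<open>\<beta>\<close> is positive.
\<close>

lemma test_fun_orthogonal_positive_set:
  fixes F \<beta> :: "'a::euclidean_space \<Rightarrow> real"
  assumes F: "F \<in> borel_measurable lebesgue" "integrable lebesgue (\<lambda>x. (F x)\<^sup>2)"
    and orth: "\<And>\<phi>. \<phi> \<in> test_fun \<Omega> \<Longrightarrow> (LINT x|lebesgue. F x * \<phi> x) = 0"
    and \<beta>: "smooth \<beta>" "\<And>x. 0 \<le> \<beta> x" "compact C" "C \<subseteq> \<Omega>" "\<And>x. x \<notin> C \<Longrightarrow> \<beta> x = 0"
  shows "(LINT x|lebesgue. F x * indicator {x. 0 < \<beta> x} x) = 0"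
proof -
  define \<phi> where "\<phi> j x = \<beta> x * inverse (\<beta> x + 1 / (real j + 1))" for j x
  have pos: "0 < \<beta> x + 1 / (real j + 1)" for j x
    using \<beta>(2)[of x] by (simp add: add_nonneg_pos)
  have \<phi>: "\<phi> j \<in> test_fun \<Omega>" for j
  proof (rule test_funI[OF _ \<beta>(3,4)])
    show "smooth (\<phi> j)" unfolding \<phi>_def
      using \<beta>(1) pos by (intro allI Ck_mult Ck_inverse Ck_add Ck_const) (auto simp: less_imp_neq[symmetric])
  qed (simp add: \<phi>_def \<beta>(5))
  have \<phi>01: "0 \<le> \<phi> j x" "\<phi> j x \<le> 1" for j x
    using \<beta>(2)[of x] pos[of x j] by (auto simp: \<phi>_def field_simps)
  have b: "\<beta> \<in> borel_measurable borel"
    using \<beta>(1) Ck_continuous by (auto intro: borel_measurable_continuous_onI)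
  show ?thesis
  proof (rule square_integrable_orthogonal_limit[OF F lmeasurable_compact[OF \<beta>(3)]])
    show "\<phi> j \<in> borel_measurable lebesgue" for j
      using Ck_continuous[OF test_funD(1)[OF \<phi>, rule_format, of j]]
      by (auto intro!: measurable_completion borel_measurable_continuous_onI)
    show "\<bar>\<phi> j x\<bar> \<le> indicator C x" for j x
      using \<phi>01[of j x] \<beta>(5)[of x] by (cases "x \<in> C") (auto simp: \<phi>_def)
    show "indicator {x. 0 < \<beta> x} \<in> borel_measurable lebesgue"
      using b by (auto intro!: borel_measurable_indicator simp: borel_measurable_iff_greater)
    have "(\<lambda>j. \<phi> j x) \<longlonglongrightarrow> indicator {x. 0 < \<beta> x} x" for x
    proof (cases "0 < \<beta> x")
      case True
      then have "(\<lambda>j. \<phi> j x) \<longlonglongrightarrow> 1" unfolding \<phi>_def by real_asymp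
      with True show ?thesis by simp
    next
      case False
      then have "\<beta> x = 0" using \<beta>(2)[of x] by simp
      then show ?thesis by (simp add: \<phi>_def)
    qed
    then show "AE x in lebesgue. (\<lambda>j. \<phi> j x) \<longlonglongrightarrow> indicator {x. 0 < \<beta> x} x" by simp
  qed (rule orth[OF \<phi>])
qed

text \<open>
  An open set is a countable union of boxes with closures inside it. These need not be
  disjoint, because a finite sum of functions that are positive on boxes is positive exactly
  on their union.
\<close>

lemma test_fun_orthogonal_open:
  fixes F :: "'a::euclidean_space \<Rightarrow> real"
  assumes F: "F \<in> borel_measurable lebesgue" "integrable lebesgue (\<lambda>x. (F x)\<^sup>2)"
    and orth: "\<And>\<phi>. \<phi> \<in> test_fun \<Omega> \<Longrightarrow> (LINT x|lebesgue. F x * \<phi> x) = 0"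
    and U: "open U" "bounded U" "U \<subseteq> \<Omega>"
  shows "(LINT x|lebesgue. F x * indicator U x) = 0"
proof (cases "U = {}")
  case False
  define \<B> where "\<B> = {box a b |a b. cbox a b \<subseteq> U}"
  have "\<Union>\<B> = U"
  proof
    show "\<Union>\<B> \<subseteq> U" unfolding \<B>_def using box_subset_cbox by blast
    show "U \<subseteq> \<Union>\<B>"
    proof
      fix x assume "x \<in> U"
      then obtain a b where "cbox a b \<subseteq> U" "x \<in> box a b"
        using open_contains_cbox[OF U(1)] by metis
      then show "x \<in> \<Union>\<B>" unfolding \<B>_def by blast
    qed
  qed
  moreover have "open B" if "B \<in> \<B>" for B
    using that by (auto simp: \<B>_def)
  ultimately obtain \<C> where \<C>: "\<C> \<subseteq> \<B>" "countable \<C>" "\<Union>\<C> = U"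
    using Lindelof[of \<B>] by metis
  with False have "\<C> \<noteq> {}" by auto
  define B where "B = from_nat_into \<C>"
  have B: "range B = \<C>"
    unfolding B_def by (rule range_from_nat_into[OF \<open>\<C> \<noteq> {}\<close> \<C>(2)])
  have "\<exists>a b. B i = box a b \<and> cbox a b \<subseteq> U" for i
  proof -
    have "B i \<in> \<B>" using B \<C>(1) by blast
    then show ?thesis unfolding \<B>_def by blast
  qed
  then obtain a b where ab: "\<And>i. B i = box (a i) (b i)" "\<And>i. cbox (a i) (b i) \<subseteq> U"
    by metis
  have "\<exists>\<beta>. smooth \<beta> \<and> (\<forall>x. 0 \<le> \<beta> x) \<and> (\<forall>x. 0 < \<beta> x \<longleftrightarrow> x \<in> B i)" for i
    using smooth_positive_on_box[of "a i" "b i"] ab(1) by metis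
  then obtain \<beta> where \<beta>: "\<And>i. smooth (\<beta> i)" "\<And>i x. 0 \<le> \<beta> i x" "\<And>i x. 0 < \<beta> i x \<longleftrightarrow> x \<in> B i"
    by metis
  define S where "S m x = (\<Sum>i<m. \<beta> i x)" for m x
  have S0: "0 \<le> S m x" for m x
    using \<beta>(2) by (auto simp: S_def intro: sum_nonneg)
  have Spos: "0 < S m x \<longleftrightarrow> (\<exists>i<m. x \<in> B i)" for m x
  proof -
    have nz: "\<beta> i x \<noteq> 0 \<longleftrightarrow> x \<in> B i" for i
      using \<beta>(2)[of i x] \<beta>(3)[of i x] by auto
    have "0 < S m x \<longleftrightarrow> S m x \<noteq> 0" using S0[of m x] by auto
    also have "\<dots> \<longleftrightarrow> (\<exists>i<m. \<beta> i x \<noteq> 0)"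
      unfolding S_def using \<beta>(2) by (subst sum_nonneg_eq_0_iff) auto
    also have "\<dots> \<longleftrightarrow> (\<exists>i<m. x \<in> B i)"
      using nz by simp
    finally show ?thesis .
  qed
  have z: "(LINT x|lebesgue. F x * indicator {x. 0 < S m x} x) = 0" for m
  proof (rule test_fun_orthogonal_positive_set[OF F orth])
    show "smooth (S m)" unfolding S_def using \<beta>(1) by (intro allI Ck_sum) blast
    show "compact (\<Union>i<m. cbox (a i) (b i))" by auto
    show "(\<Union>i<m. cbox (a i) (b i)) \<subseteq> \<Omega>" using ab(2) U(3) by blast
    show "S m x = 0" if "x \<notin> (\<Union>i<m. cbox (a i) (b i))" for x
    proof -
      have "\<not> 0 < S m x" using that ab(1) box_subset_cbox by (fastforce simp: Spos)
      then show ?thesis using S0[of m x] by simp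
    qed
  qed (use S0 in auto)
  show ?thesis
  proof (rule square_integrable_orthogonal_limit[OF F lmeasurable_open[OF U(2,1)] _ _ _ _ z])
    have eq: "{x. 0 < S m x} = (\<Union>i<m. box (a i) (b i))" for m
      by (auto simp: Spos ab(1))
    show "indicator {x. 0 < S m x} \<in> borel_measurable lebesgue" for m
      unfolding eq by (intro borel_measurable_indicator) auto
    show "indicator U \<in> borel_measurable lebesgue"
      using U(1) by (intro borel_measurable_indicator) auto
    have "x \<in> U" if "0 < S m x" for m x using that B \<C>(3) by (auto simp: Spos)
    then show "\<bar>indicator {x. 0 < S m x} x\<bar> \<le> (indicator U x :: real)" for m x
      by (auto simp: indicator_def)
    have "(\<lambda>m. indicator {x. 0 < S m x} x :: real) \<longlonglongrightarrow> indicator U x" for x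
    proof (cases "x \<in> U")
      case True
      then obtain i where i: "x \<in> B i" using B \<C>(3) by blast
      have "\<forall>\<^sub>F m in sequentially. indicator {x. 0 < S m x} x = (1::real)"
        using eventually_gt_at_top[of i] by eventually_elim (use i Spos in \<open>auto simp: indicator_def\<close>)
      with True show ?thesis by (simp add: tendsto_eventually)
    next
      case False
      then have "\<not> 0 < S m x" for m using B \<C>(3) by (auto simp: Spos)
      with False show ?thesis by simp
    qed
    then show "AE x in lebesgue. (\<lambda>m. indicator {x. 0 < S m x} x :: real) \<longlonglongrightarrow> indicator U x" by simp
  qed
qed simp

text \<open>
  Up to a null set, the set where \<open>F\<close> is positive is a decreasing limit of open sets, over
  each of which \<open>F\<close> integrates to zero. So the integral of \<open>F\<close> over the set where it is
  positive vanishes. Restriction to balls keeps the measures finite.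
\<close>

lemma test_fun_orthogonal_AE_nonpos:
  fixes F :: "'a::euclidean_space \<Rightarrow> real"
  assumes F: "F \<in> borel_measurable lebesgue" "integrable lebesgue (\<lambda>x. (F x)\<^sup>2)"
    and orth: "\<And>\<phi>. \<phi> \<in> test_fun \<Omega> \<Longrightarrow> (LINT x|lebesgue. F x * \<phi> x) = 0"
    and \<Omega>: "open \<Omega>"
  shows "AE x in lebesgue. x \<in> \<Omega> \<longrightarrow> F x \<le> 0"
proof -
  have ball: "AE x in lebesgue. x \<in> \<Omega> \<inter> ball 0 (real R) \<longrightarrow> F x \<le> 0" for R :: nat
  proof -
    let ?V = "\<Omega> \<inter> ball 0 (real R)"
    define S where "S = {x \<in> ?V. 0 < F x}"
    have "{x. 0 < F x} \<in> sets lebesgue"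
      using measurable_sets[OF F(1), of "{0<..}"] by (simp add: vimage_def)
    then have S: "S \<in> sets lebesgue"
      unfolding S_def using \<Omega> by (auto intro!: sets.Int simp: Collect_conj_eq Int_def[symmetric])
    obtain C T where CT: "gdelta C" "T \<in> null_sets lebesgue" "S \<union> T = C"
      using lebesgue_set_almost_gdelta[OF S] by metis
    obtain G :: "nat \<Rightarrow> 'a set" where G: "\<And>n. open (G n)" "C = (\<Inter>n. G n)"
      using CT(1) by (auto elim!: gdelta.cases)
    define W where "W n = ?V \<inter> (\<Inter>i\<le>n. G i)" for n
    have W: "open (W n)" "W n \<subseteq> ?V" for n
      unfolding W_def using G \<Omega> by (auto intro!: open_Int open_INT)
    have bV: "bounded ?V" by (auto intro: bounded_subset[OF bounded_ball])
    have z: "(LINT x|lebesgue. F x * indicator (W n) x) = 0" for n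
      using W[of n] bV by (intro test_fun_orthogonal_open[OF F orth]) (auto intro: bounded_subset)
    have VL: "?V \<in> lmeasurable" using \<Omega> bV by (intro lmeasurable_open) auto
    have SV: "indicator S \<in> borel_measurable lebesgue" "\<bar>indicator S x\<bar> \<le> (indicator ?V x :: real)" for x
      using S by (auto intro!: borel_measurable_indicator simp: S_def indicator_def)
    have 0: "(LINT x|lebesgue. F x * indicator S x) = 0"
    proof (rule square_integrable_orthogonal_limit[OF F VL _ _ SV(1) _ z])
      show "indicator (W n) \<in> borel_measurable lebesgue" for n
        using W by (intro borel_measurable_indicator) auto
      show "\<bar>indicator (W n) x\<bar> \<le> (indicator ?V x :: real)" for n x
        using W(2)[of n] by (auto simp: indicator_def)
      have "AE x in lebesgue. x \<notin> T" using CT(2) by (rule AE_not_in)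
      then show "AE x in lebesgue. (\<lambda>n. indicator (W n) x :: real) \<longlonglongrightarrow> indicator S x"
      proof eventually_elim
        case (elim x)
        show ?case
        proof (cases "x \<in> S")
          case True
          then have "x \<in> W n" for n using CT(3) G(2) by (auto simp: W_def S_def)
          with True show ?thesis by simp
        next
          case False
          show ?thesis
          proof (cases "x \<in> ?V")
            case True
            from False elim have "x \<notin> C" using CT(3) by auto
            then obtain i where i: "x \<notin> G i" using G(2) by auto
            have "\<forall>\<^sub>F n in sequentially. indicator (W n) x = (0::real)"
              using eventually_ge_at_top[of i] by eventually_elim (use i in \<open>auto simp: W_def indicator_def\<close>)
            with False show ?thesis by (simp add: tendsto_eventually)
          qed (use False in \<open>auto simp: W_def\<close>)
        qed
      qed
    qed
    note int = square_integrable_mult_bounded(1)[OF F VL SV]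
    have "AE x in lebesgue. F x * indicator S x = 0"
      by (subst integral_nonneg_eq_0_iff_AE[OF int, symmetric]) (use 0 in \<open>auto simp: S_def indicator_def\<close>)
    then show ?thesis by eventually_elim (auto simp: S_def indicator_def)
  qed
  have "AE x in lebesgue. \<forall>R. x \<in> \<Omega> \<inter> ball 0 (real R) \<longrightarrow> F x \<le> 0"
    unfolding AE_all_countable using ball by blast
  then show ?thesis
    by eventually_elim (metis IntI mem_ball_0 reals_Archimedean2)
qed

text \<open>The fundamental lemma of the calculus of variations.\<close>

lemma test_fun_orthogonal_AE_zero:
  fixes f :: "'a::euclidean_space \<Rightarrow> real"
  assumes \<Omega>: "open \<Omega>" and f: "f \<in> L2 \<Omega>"
    and orth: "\<And>\<phi>. \<phi> \<in> test_fun \<Omega> \<Longrightarrow> (LINT x|lebesgue_on \<Omega>. f x * \<phi> x) = 0"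
  shows "AE x in lebesgue_on \<Omega>. f x = 0"
proof -
  define F where "F x = (if x \<in> \<Omega> then f x else 0)" for x
  have \<Omega>': "\<Omega> \<in> sets lebesgue" using \<Omega> by auto
  have m: "F \<in> borel_measurable lebesgue"
    unfolding F_def using L2D(1)[OF f] \<Omega>' by (simp add: borel_measurable_if)
  have i: "integrable lebesgue (\<lambda>x. (F x)\<^sup>2)"
  proof -
    have "integrable (lebesgue_on \<Omega>) (\<lambda>x. (F x)\<^sup>2)"
      using L2D(2)[OF f] Bochner_Integration.integrable_cong[OF refl, of "lebesgue_on \<Omega>" "\<lambda>x. (F x)\<^sup>2" "\<lambda>x. (norm (f x))\<^sup>2"]
      by (simp add: F_def)
    then show ?thesis by (subst (asm) integrable_lebesgue_on_eq[OF \<Omega>']) (auto simp: F_def)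
  qed
  have z: "(LINT x|lebesgue. F x * \<phi> x) = 0" if "\<phi> \<in> test_fun \<Omega>" for \<phi>
  proof -
    have "(LINT x|lebesgue. F x * \<phi> x) = (LINT x|lebesgue_on \<Omega>. F x * \<phi> x)"
      by (subst integral_lebesgue_on_eq[OF \<Omega>']) (auto simp: F_def)
    also have "\<dots> = (LINT x|lebesgue_on \<Omega>. f x * \<phi> x)"
      by (intro Bochner_Integration.integral_cong) (auto simp: F_def)
    finally show ?thesis using orth[OF that] by simp
  qed
  have "AE x in lebesgue. x \<in> \<Omega> \<longrightarrow> F x \<le> 0"
    by (rule test_fun_orthogonal_AE_nonpos[OF m i z \<Omega>])
  moreover have "AE x in lebesgue. x \<in> \<Omega> \<longrightarrow> - F x \<le> 0"
    by (rule test_fun_orthogonal_AE_nonpos[OF _ _ _ \<Omega>]) (use m i z in auto)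
  ultimately have "AE x in lebesgue. x \<in> \<Omega> \<longrightarrow> f x = 0"
    by eventually_elim (auto simp: F_def)
  then show ?thesis using \<Omega>' by (simp add: AE_restrict_space_iff)
qed

text \<open>This lets \<open>wgrad\<close>, a mere choice, be computed from any weak gradient.\<close>

lemma weak_gradient_unique:
  assumes \<Omega>: "open \<Omega>" and u: "u \<in> L2 \<Omega>" and g: "weak_gradient \<Omega> u g" "g \<in> L2 \<Omega>" and h: "weak_gradient \<Omega> u h" "h \<in> L2 \<Omega>"
  shows "AE x in lebesgue_on \<Omega>. g x = h x"
proof -
  have "AE x in lebesgue_on \<Omega>. (g x - h x) \<bullet> b = 0" if b: "b \<in> Basis" for b
  proof (rule test_fun_orthogonal_AE_zero[OF \<Omega>])
    show "(\<lambda>x. (g x - h x) \<bullet> b) \<in> L2 \<Omega>"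
      by (rule L2_inner_Basis[OF L2_diff[OF g(2) h(2)] b])
    fix \<phi> assume \<phi>: "\<phi> \<in> test_fun \<Omega>"
    note i = weak_gradient_integrable(2)[OF \<Omega> \<phi> b u]
    have "integrable (lebesgue_on \<Omega>) (\<lambda>x. (g x \<bullet> b) * \<phi> x)" "integrable (lebesgue_on \<Omega>) (\<lambda>x. (h x \<bullet> b) * \<phi> x)"
      by (rule i[OF g(2)], rule i[OF h(2)])
    moreover have "(LINT x|lebesgue_on \<Omega>. (g x \<bullet> b) * \<phi> x) = (LINT x|lebesgue_on \<Omega>. (h x \<bullet> b) * \<phi> x)"
      using g(1)[unfolded weak_gradient_def, rule_format, OF \<phi> b] h(1)[unfolded weak_gradient_def, rule_format, OF \<phi> b] by simp
    ultimately show "(LINT x|lebesgue_on \<Omega>. (g x - h x) \<bullet> b * \<phi> x) = 0"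
      by (simp add: inner_diff_left left_diff_distrib)
  qed
  then have "AE x in lebesgue_on \<Omega>. \<forall>b\<in>Basis. (g x - h x) \<bullet> b = 0"
    by (simp add: AE_finite_all)
  then show ?thesis
    by eventually_elim (metis euclidean_eq_iff inner_zero_left right_minus_eq)
qed

section \<open>Subcritical Sobolev inequalities for smooth functions\<close>

abbreviation dirichlet :: "('a::euclidean_space \<Rightarrow> real) \<Rightarrow> ennreal" where
  "dirichlet \<phi> \<equiv> \<integral>\<^sup>+x. ennreal ((norm (grad \<phi> x))\<^sup>2) \<partial>lborel"

abbreviation square_mass :: "('a::euclidean_space \<Rightarrow> real) \<Rightarrow> ennreal" where
  "square_mass \<phi> \<equiv> \<integral>\<^sup>+x. ennreal ((\<phi> x)\<^sup>2) \<partial>lborel"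

abbreviation powr_mass :: "real \<Rightarrow> ('a::euclidean_space \<Rightarrow> real) \<Rightarrow> ennreal" where
  "powr_mass q \<phi> \<equiv> \<integral>\<^sup>+x. ennreal (\<bar>\<phi> x\<bar> powr q) \<partial>lborel"

lemma nn_integral_lborel_affine:
  fixes f :: "'a::euclidean_space \<Rightarrow> ennreal"
  assumes "f \<in> borel_measurable borel" "c \<noteq> 0"
  shows "(\<integral>\<^sup>+x. f x \<partial>lborel) = ennreal (\<bar>c\<bar> ^ DIM('a)) * (\<integral>\<^sup>+z. f (a + c *\<^sub>R z) \<partial>lborel)"
  using assms
  by (subst lborel_affine[of c a]) (simp_all add: nn_integral_density nn_integral_distr nn_integral_cmult)

lemma square_integral_le_integral_square:
  fixes g :: "real \<Rightarrow> real"
  assumes "continuous_on {0..1} g"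
  shows "(integral {0..1} g)\<^sup>2 \<le> integral {0..1} (\<lambda>s. (g s)\<^sup>2)"
proof -
  define m where "m = integral {0..1} g"
  have i: "g integrable_on {0..1}" "(\<lambda>s. (g s)\<^sup>2) integrable_on {0..1}"
    using assms by (auto intro!: integrable_continuous_interval continuous_intros)
  have "0 \<le> integral {0..1} (\<lambda>s. (g s - m)\<^sup>2)"
    using assms by (intro Henstock_Kurzweil_Integration.integral_nonneg integrable_continuous_interval continuous_intros) auto
  also have "integral {0..1} (\<lambda>s. (g s - m)\<^sup>2) = integral {0..1} (\<lambda>s. (g s)\<^sup>2 - 2 * m * g s + m\<^sup>2)"
    by (simp add: power2_diff algebra_simps)
  also have "\<dots> = integral {0..1} (\<lambda>s. (g s)\<^sup>2) - 2 * m * m + m\<^sup>2"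
  proof (rule integral_unique)
    have "((\<lambda>s. (g s)\<^sup>2 - 2 * m * g s + m\<^sup>2) has_integral
        integral {0..1} (\<lambda>s. (g s)\<^sup>2) - 2 * m * integral {0..1} g + (1 - 0) *\<^sub>R m\<^sup>2) {0..1}"
      using i by (intro has_integral_add has_integral_diff has_integral_mult_right integrable_integral) (use has_integral_const_real[of "m\<^sup>2" 0 1] in auto)
    then show "((\<lambda>s. (g s)\<^sup>2 - 2 * m * g s + m\<^sup>2) has_integral
        integral {0..1} (\<lambda>s. (g s)\<^sup>2) - 2 * m * m + m\<^sup>2) {0..1}"
      by (simp add: m_def)
  qed
  finally show ?thesis by (simp add: m_def power2_eq_square)
qed

text \<open>
  Along the segment from \<open>x - h\<close> to \<open>x\<close> the difference is the mean of a directional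
  derivative. The square of a mean is at most the mean of the square, and the integral in \<open>x\<close>
  is translation invariant.
\<close>

lemma translation_estimate:
  fixes \<phi> :: "'a::euclidean_space \<Rightarrow> real"
  assumes "smooth \<phi>"
  shows "(\<integral>\<^sup>+x. ennreal ((\<phi> x - \<phi> (x - h))\<^sup>2) \<partial>lborel) \<le> ennreal ((norm h)\<^sup>2) * dirichlet \<phi>"
proof -
  note der = has_derivative_grad[OF smooth_differentiable[OF assms]]
  note cg = continuous_on_grad[OF assms]
  have cg': "continuous_on S (\<lambda>x. grad \<phi> (f x))" if "continuous_on S f" for f :: "'c::topological_space \<Rightarrow> 'a" and S
    by (rule continuous_on_compose2[OF cg that]) auto
  define g where "g x s = grad \<phi> (x - s *\<^sub>R h) \<bullet> h" for x s
  have cont: "continuous_on {0..1} (g x)" for x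
    unfolding g_def by (intro continuous_intros cg')
  have meas: "(\<lambda>(x, s). g x s) \<in> borel_measurable (lborel \<Otimes>\<^sub>M lborel)"
  proof -
    have "continuous_on UNIV (\<lambda>z. g (fst z) (snd z))"
      unfolding g_def by (intro continuous_intros cg')
    then show ?thesis
      by (simp add: lborel_prod case_prod_beta borel_measurable_continuous_onI)
  qed
  have mg: "grad \<phi> \<in> borel_measurable borel"
    using cg by (rule borel_measurable_continuous_onI)
  have pt: "ennreal ((\<phi> x - \<phi> (x - h))\<^sup>2) \<le> (\<integral>\<^sup>+s. ennreal ((g x s)\<^sup>2) * indicator {0..1} s \<partial>lborel)" for x
  proof -
    have "((\<lambda>s. \<phi> (x - s *\<^sub>R h)) has_derivative (\<lambda>s. grad \<phi> (x - t *\<^sub>R h) \<bullet> (- (s *\<^sub>R h)))) (at t within {0..1})" for t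
      by (rule has_derivative_compose[where g=\<phi>, OF _ der]) (auto intro!: derivative_eq_intros)
    then have "((\<lambda>s. \<phi> (x - s *\<^sub>R h)) has_vector_derivative - g x t) (at t within {0..1})" for t
      by (simp add: has_vector_derivative_def g_def)
    then have "((\<lambda>s. - g x s) has_integral (\<phi> (x - 1 *\<^sub>R h) - \<phi> (x - 0 *\<^sub>R h))) {0..1}"
      by (intro fundamental_theorem_of_calculus) auto
    then have "(g x has_integral (\<phi> x - \<phi> (x - h))) {0..1}"
      by (auto dest: has_integral_neg)
    then have "integral {0..1} (g x) = \<phi> x - \<phi> (x - h)" by (rule integral_unique)
    then have "(\<phi> x - \<phi> (x - h))\<^sup>2 \<le> integral {0..1} (\<lambda>s. (g x s)\<^sup>2)"
      using square_integral_le_integral_square[OF cont[of x]] by metis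
    moreover have "((\<lambda>s. (g x s)\<^sup>2) has_integral integral {0..1} (\<lambda>s. (g x s)\<^sup>2)) {0..1}"
      by (intro integrable_integral integrable_continuous_interval continuous_intros cont)
    ultimately show ?thesis
      by (subst nn_integral_has_integral_lebesgue') (auto simp: ennreal_leI)
  qed
  have sq: "(g x s)\<^sup>2 \<le> (norm h)\<^sup>2 * (norm (grad \<phi> (x - s *\<^sub>R h)))\<^sup>2" for x s
    using power_mono[OF Cauchy_Schwarz_ineq2[of "grad \<phi> (x - s *\<^sub>R h)" h], of 2]
    by (simp add: g_def power_mult_distrib mult.commute)
  let ?D = "dirichlet \<phi>"
  have "(\<integral>\<^sup>+x. ennreal ((\<phi> x - \<phi> (x - h))\<^sup>2) \<partial>lborel)
      \<le> (\<integral>\<^sup>+x. \<integral>\<^sup>+s. ennreal ((g x s)\<^sup>2) * indicator {0..1} s \<partial>lborel \<partial>lborel)"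
    using pt by (intro nn_integral_mono)
  also have "\<dots> = (\<integral>\<^sup>+s. \<integral>\<^sup>+x. ennreal ((g x s)\<^sup>2) * indicator {0..1} s \<partial>lborel \<partial>lborel)"
  proof (rule lborel_pair.Fubini'[symmetric])
    have "(\<lambda>z. (case z of (x, s) \<Rightarrow> g x s)\<^sup>2) \<in> borel_measurable (lborel \<Otimes>\<^sub>M lborel)"
      using meas by measurable
    then have "(\<lambda>z. ennreal ((case z of (x, s) \<Rightarrow> g x s)\<^sup>2) * indicator {0..1} (snd z)) \<in> borel_measurable (lborel \<Otimes>\<^sub>M lborel)"
      by measurable
    then show "(\<lambda>(x, s). ennreal ((g x s)\<^sup>2) * indicator {0..1} s) \<in> borel_measurable (lborel \<Otimes>\<^sub>M lborel)"
      by (simp add: case_prod_beta)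
  qed
  also have "\<dots> \<le> (\<integral>\<^sup>+s. ennreal ((norm h)\<^sup>2) * ?D * indicator {0..1::real} s \<partial>lborel)"
  proof (rule nn_integral_mono)
    fix s :: real
    have "(\<integral>\<^sup>+x. ennreal ((g x s)\<^sup>2) \<partial>lborel) \<le> (\<integral>\<^sup>+x. ennreal ((norm h)\<^sup>2) * ennreal ((norm (grad \<phi> (- (s *\<^sub>R h) + 1 *\<^sub>R x)))\<^sup>2) \<partial>lborel)"
      using sq by (intro nn_integral_mono) (simp add: ennreal_mult[symmetric] ennreal_leI)
    also have "\<dots> = ennreal ((norm h)\<^sup>2) * (\<integral>\<^sup>+x. ennreal ((norm (grad \<phi> (- (s *\<^sub>R h) + 1 *\<^sub>R x)))\<^sup>2) \<partial>lborel)"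
    proof (rule nn_integral_cmult)
      have "(\<lambda>x. grad \<phi> (- (s *\<^sub>R h) + 1 *\<^sub>R x)) \<in> borel_measurable borel"
        by (rule measurable_compose[OF _ mg]) measurable
      then show "(\<lambda>x. ennreal ((norm (grad \<phi> (- (s *\<^sub>R h) + 1 *\<^sub>R x)))\<^sup>2)) \<in> borel_measurable lborel"
        by measurable
    qed
    also have "\<dots> = ennreal ((norm h)\<^sup>2) * ?D"
      using mg by (subst nn_integral_lborel_affine[of "\<lambda>x. ennreal ((norm (grad \<phi> x))\<^sup>2)" 1 "- (s *\<^sub>R h)"]) auto
    finally show "(\<integral>\<^sup>+x. ennreal ((g x s)\<^sup>2) * indicator {0..1} s \<partial>lborel) \<le> ennreal ((norm h)\<^sup>2) * ?D * indicator {0..1::real} s"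
      by (auto simp: indicator_def)
  qed
  also have "\<dots> = ennreal ((norm h)\<^sup>2) * ?D"
    by (simp add: nn_integral_cmult)
  finally show ?thesis .
qed

text \<open>
  Where \<open>\<phi>\<close> is at least twice the bound \<open>m\<close> for its averages over balls of radius \<open>t\<close>, half of
  \<open>|\<phi>|\<close> is accounted for by the oscillation at scale \<open>t\<close>, whose mean square is at most \<open>t\<^sup>2\<close>
  times the Dirichlet integral.
\<close>

lemma level_set_estimate:
  fixes \<phi> :: "'a::euclidean_space \<Rightarrow> real"
  assumes sm: "smooth \<phi>" and t: "0 < t" and m: "0 < m"
    and avg: "\<And>x. (\<integral>\<^sup>+z. ennreal \<bar>\<phi> (x - t *\<^sub>R z)\<bar> * indicator (ball 0 1) z \<partial>lborel) \<le> ennreal m * emeasure lborel (ball 0 1 :: 'a set)"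
  shows "(\<integral>\<^sup>+x. ennreal ((\<phi> x)\<^sup>2) * indicator {x. 2 * m \<le> \<bar>\<phi> x\<bar>} x \<partial>lborel)
    \<le> ennreal (4 * t\<^sup>2) * dirichlet \<phi>"
proof -
  let ?B = "ball 0 1 :: 'a set" and ?D = "dirichlet \<phi>"
  define b where "b = measure lborel ?B"
  have b: "emeasure lborel ?B = ennreal b" "0 < b"
    unfolding b_def using content_ball_pos[of 1 "0::'a"] emeasure_lborel_ball_finite[of "0::'a" 1]
    by (auto simp: emeasure_eq_ennreal_measure)
  have c: "continuous_on UNIV \<phi>" using sm Ck_continuous by blast
  have c': "continuous_on S (\<lambda>x. \<phi> (f x))" if "continuous_on S f" for f :: "'c::topological_space \<Rightarrow> 'a" and S
    by (rule continuous_on_compose2[OF c that]) auto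
  have mf: "\<phi> \<in> borel_measurable borel" using c by (rule borel_measurable_continuous_onI)
  have mt: "(\<lambda>z. \<phi> (x - t *\<^sub>R z)) \<in> borel_measurable borel" for x
    by (intro borel_measurable_continuous_onI c' continuous_intros)
  \<comment> \<open>With \<open>a = |\<phi> x| / 2\<close> the mean of \<open>|\<phi> x - \<phi> (x - t z)|\<close> is at least \<open>a\<close>, and \<open>2 a |y| \<le> y\<^sup>2 + a\<^sup>2\<close> turns this into a bound on squares.\<close>
  have pt: "ennreal (b * (\<phi> x)\<^sup>2) * indicator {x. 2 * m \<le> \<bar>\<phi> x\<bar>} x
      \<le> 4 * (\<integral>\<^sup>+z. ennreal ((\<phi> x - \<phi> (x - t *\<^sub>R z))\<^sup>2) * indicator ?B z \<partial>lborel)" for x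
  proof (cases "2 * m \<le> \<bar>\<phi> x\<bar>")
    case True
    define a where "a = \<bar>\<phi> x\<bar> / 2"
    have a: "0 < a" "m \<le> a" using True m by (auto simp: a_def)
    let ?I = "\<integral>\<^sup>+z. ennreal ((\<phi> x - \<phi> (x - t *\<^sub>R z))\<^sup>2) * indicator ?B z \<partial>lborel"
    have el: "3 * a\<^sup>2 \<le> (\<phi> x - y)\<^sup>2 + 2 * a * \<bar>y\<bar>" for y
    proof -
      have d: "2 * a - \<bar>y\<bar> \<le> \<bar>\<phi> x - y\<bar>" by (simp add: a_def)
      have "0 \<le> (\<bar>\<phi> x - y\<bar> - a)\<^sup>2" by simp
      then have "2 * a * \<bar>\<phi> x - y\<bar> \<le> (\<phi> x - y)\<^sup>2 + a\<^sup>2"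
        by (simp add: power2_diff[of "\<bar>\<phi> x - y\<bar>"] mult_ac)
      moreover have "2 * a * (2 * a - \<bar>y\<bar>) \<le> 2 * a * \<bar>\<phi> x - y\<bar>"
        using d a by (intro mult_left_mono) auto
      ultimately show ?thesis by (simp add: algebra_simps power2_eq_square)
    qed
    have "ennreal (3 * a\<^sup>2) * ennreal b = (\<integral>\<^sup>+z. ennreal (3 * a\<^sup>2) * indicator ?B z \<partial>lborel)"
      using b by (subst nn_integral_cmult_indicator) auto
    also have "\<dots> \<le> (\<integral>\<^sup>+z. ennreal ((\<phi> x - \<phi> (x - t *\<^sub>R z))\<^sup>2) * indicator ?B z
        + ennreal (2 * a) * (ennreal \<bar>\<phi> (x - t *\<^sub>R z)\<bar> * indicator ?B z) \<partial>lborel)"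
      using el a by (intro nn_integral_mono) (auto simp: indicator_def ennreal_mult[symmetric] ennreal_plus[symmetric] intro!: ennreal_leI simp del: ennreal_plus)
    also have "\<dots> = ?I + ennreal (2 * a) * (\<integral>\<^sup>+z. ennreal \<bar>\<phi> (x - t *\<^sub>R z)\<bar> * indicator ?B z \<partial>lborel)"
    proof -
      have "(\<lambda>z. ennreal ((\<phi> x - \<phi> (x - t *\<^sub>R z))\<^sup>2) * indicator ?B z) \<in> borel_measurable lborel"
        "(\<lambda>z. ennreal \<bar>\<phi> (x - t *\<^sub>R z)\<bar> * indicator ?B z) \<in> borel_measurable lborel"
        using mt[of x] by (auto intro!: borel_measurable_times_ennreal borel_measurable_indicator)
      then show ?thesis by (simp add: nn_integral_add nn_integral_cmult)
    qed
    also have "\<dots> \<le> ?I + ennreal (2 * a) * (ennreal m * ennreal b)"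
      using avg[of x] by (intro add_left_mono mult_left_mono) (auto simp: b)
    also have "\<dots> \<le> ?I + ennreal (2 * a\<^sup>2 * b)"
      using a m b by (intro add_left_mono) (auto simp: ennreal_mult[symmetric] power2_eq_square intro!: ennreal_leI)
    finally have le: "ennreal (3 * a\<^sup>2 * b) \<le> ?I + ennreal (2 * a\<^sup>2 * b)"
      using b by (simp add: ennreal_mult)
    have "ennreal (a\<^sup>2 * b) \<le> ?I"
    proof (cases ?I)
      case (real r)
      have "3 * a\<^sup>2 * b \<le> r + 2 * a\<^sup>2 * b"
        using le b real by (simp add: ennreal_plus[symmetric] ennreal_le_iff del: ennreal_plus)
      then show ?thesis using real by (simp add: ennreal_leI mult.commute)
    qed simp
    then have "4 * ennreal (a\<^sup>2 * b) \<le> 4 * ?I" by (rule mult_left_mono) simp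
    moreover have "4 * ennreal (a\<^sup>2 * b) = ennreal (b * (\<phi> x)\<^sup>2)"
    proof -
      have e: "b * (\<phi> x)\<^sup>2 = 4 * (a\<^sup>2 * b)" by (simp add: a_def power_divide)
      have "ennreal (4 * (a\<^sup>2 * b)) = ennreal 4 * ennreal (a\<^sup>2 * b)"
        using b by (intro ennreal_mult) auto
      then show ?thesis unfolding e by simp
    qed
    ultimately show ?thesis using True by simp
  qed simp
  have mm: "(\<lambda>p::'a \<times> 'a. ennreal ((\<phi> (fst p) - \<phi> (fst p - t *\<^sub>R snd p))\<^sup>2) * indicator ?B (snd p)) \<in> borel_measurable (lborel \<Otimes>\<^sub>M lborel)"
  proof (rule borel_measurable_times_ennreal)
    have "continuous_on UNIV (\<lambda>p::'a \<times> 'a. \<phi> (fst p) - \<phi> (fst p - t *\<^sub>R snd p))"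
      by (intro continuous_intros c')
    then have "(\<lambda>p::'a \<times> 'a. \<phi> (fst p) - \<phi> (fst p - t *\<^sub>R snd p)) \<in> borel_measurable (lborel \<Otimes>\<^sub>M lborel)"
      by (simp add: lborel_prod borel_measurable_continuous_onI)
    then show "(\<lambda>p::'a \<times> 'a. ennreal ((\<phi> (fst p) - \<phi> (fst p - t *\<^sub>R snd p))\<^sup>2)) \<in> borel_measurable (lborel \<Otimes>\<^sub>M lborel)"
      by measurable
    show "(\<lambda>p::'a \<times> 'a. indicator ?B (snd p) :: ennreal) \<in> borel_measurable (lborel \<Otimes>\<^sub>M lborel)"
      by (rule measurable_compose[OF measurable_snd borel_measurable_indicator]) simp
  qed
  have "ennreal b * (\<integral>\<^sup>+x. ennreal ((\<phi> x)\<^sup>2) * indicator {x. 2 * m \<le> \<bar>\<phi> x\<bar>} x \<partial>lborel)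
      = (\<integral>\<^sup>+x. ennreal (b * (\<phi> x)\<^sup>2) * indicator {x. 2 * m \<le> \<bar>\<phi> x\<bar>} x \<partial>lborel)"
    using mf b by (subst nn_integral_cmult[symmetric]) (auto simp: ennreal_mult mult.assoc)
  also have "\<dots> \<le> (\<integral>\<^sup>+x. 4 * (\<integral>\<^sup>+z. ennreal ((\<phi> x - \<phi> (x - t *\<^sub>R z))\<^sup>2) * indicator ?B z \<partial>lborel) \<partial>lborel)"
    by (intro nn_integral_mono pt)
  also have "\<dots> = 4 * (\<integral>\<^sup>+x. \<integral>\<^sup>+z. ennreal ((\<phi> x - \<phi> (x - t *\<^sub>R z))\<^sup>2) * indicator ?B z \<partial>lborel \<partial>lborel)"
    by (rule nn_integral_cmult, rule lborel.borel_measurable_nn_integral) (use mm in \<open>simp add: case_prod_beta\<close>)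
  also have "(\<integral>\<^sup>+x. \<integral>\<^sup>+z. ennreal ((\<phi> x - \<phi> (x - t *\<^sub>R z))\<^sup>2) * indicator ?B z \<partial>lborel \<partial>lborel)
      = (\<integral>\<^sup>+z. \<integral>\<^sup>+x. ennreal ((\<phi> x - \<phi> (x - t *\<^sub>R z))\<^sup>2) * indicator ?B z \<partial>lborel \<partial>lborel)"
    by (rule lborel_pair.Fubini'[symmetric]) (use mm in \<open>simp add: case_prod_beta\<close>)
  also have "\<dots> \<le> (\<integral>\<^sup>+z. (ennreal (t\<^sup>2) * ?D) * indicator ?B z \<partial>lborel)"
  proof (rule nn_integral_mono)
    fix z :: 'a
    show "(\<integral>\<^sup>+x. ennreal ((\<phi> x - \<phi> (x - t *\<^sub>R z))\<^sup>2) * indicator ?B z \<partial>lborel) \<le> (ennreal (t\<^sup>2) * ?D) * indicator ?B z"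
    proof (cases "z \<in> ?B")
      case True
      have "(norm (t *\<^sub>R z))\<^sup>2 \<le> t\<^sup>2"
        using True t by (intro power_mono) (auto simp: mult_le_cancel_left1)
      then have "ennreal ((norm (t *\<^sub>R z))\<^sup>2) * ?D \<le> ennreal (t\<^sup>2) * ?D"
        by (intro mult_right_mono ennreal_leI) auto
      with translation_estimate[OF sm, of "t *\<^sub>R z"] show ?thesis
        using True by simp
    qed simp
  qed
  also have "\<dots> = ennreal b * (ennreal (t\<^sup>2) * ?D)"
    by (subst nn_integral_cmult_indicator) (auto simp: b mult.commute)
  finally have "ennreal b * (\<integral>\<^sup>+x. ennreal ((\<phi> x)\<^sup>2) * indicator {x. 2 * m \<le> \<bar>\<phi> x\<bar>} x \<partial>lborel)
      \<le> 4 * (ennreal b * (ennreal (t\<^sup>2) * ?D))"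
    by (simp add: mult_left_mono)
  also have "\<dots> = ennreal b * (ennreal (4 * t\<^sup>2) * ?D)"
    using b by (simp add: ennreal_mult mult_ac)
  finally show ?thesis
    using b(2) by (subst (asm) ennreal_mult_le_mult_iff) auto
qed

text \<open>
  Young's inequality in this form takes the place of Hoelder's inequality in bounding an
  average by a \<open>q\<close>-th power integral.
\<close>

lemma abs_le_powr_split:
  assumes "0 < a" "1 \<le> (q::real)"
  shows "\<bar>y\<bar> \<le> a + a powr (1 - q) * \<bar>y\<bar> powr q"
proof (cases "\<bar>y\<bar> \<le> a")
  case True
  moreover have "0 \<le> a powr (1 - q) * \<bar>y\<bar> powr q" by simp
  ultimately show ?thesis by linarith
next
  case False
  then have "\<bar>y\<bar> powr (1 - q) \<le> a powr (1 - q)"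
    using assms by (intro powr_mono2') auto
  then have "\<bar>y\<bar> powr (1 - q) * \<bar>y\<bar> powr q \<le> a powr (1 - q) * \<bar>y\<bar> powr q"
    by (intro mult_right_mono) auto
  moreover have "\<bar>y\<bar> powr (1 - q) * \<bar>y\<bar> powr q = \<bar>y\<bar>"
    using False assms by (simp flip: powr_add)
  ultimately show ?thesis using assms by linarith
qed


text \<open>
  The scale \<open>t\<close> is chosen so that a bound \<open>M\<close> for the \<open>q\<close>-th power integral keeps the averages
  over balls of radius \<open>t\<close> below \<open>m\<close>. A larger level \<open>m\<close> permits a smaller \<open>t\<close>, hence a better
  estimate.
\<close>

lemma superlevel_estimate:
  fixes \<phi> :: "'a::euclidean_space \<Rightarrow> real"
  assumes sm: "smooth \<phi>" and q: "1 \<le> q" and M: "0 < M" "powr_mass q \<phi> \<le> ennreal M"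
    and m: "0 < m"
  shows "(\<integral>\<^sup>+x. ennreal ((\<phi> x)\<^sup>2) * indicator {x. 2 * m \<le> \<bar>\<phi> x\<bar>} x \<partial>lborel)
    \<le> ennreal (4 * (M / measure lborel (ball 0 1 :: 'a set)) powr (2 / DIM('a)) * (2 / m) powr (2 * q / DIM('a)))
      * dirichlet \<phi>"
proof -
  let ?B = "ball 0 1 :: 'a set"
  define b where "b = measure lborel ?B"
  have b: "emeasure lborel ?B = ennreal b" "0 < b"
    unfolding b_def using content_ball_pos[of 1 "0::'a"] emeasure_lborel_ball_finite[of "0::'a" 1]
    by (auto simp: emeasure_eq_ennreal_measure)
  \<comment> \<open>The scale at which the average of \<open>|\<phi>| powr q\<close> is at most \<open>(m / 2) powr q\<close>.\<close>
  define t where "t = (M / b * (2 / m) powr q) powr (1 / DIM('a))"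
  have t: "0 < t" using M b m by (simp add: t_def)
  have tN: "t ^ DIM('a) = M / b * (2 / m) powr q"
    using M b m by (simp add: t_def powr_powr flip: powr_realpow)
  have t2: "t\<^sup>2 = (M / b) powr (2 / DIM('a)) * (2 / m) powr (2 * q / DIM('a))"
  proof -
    have "t\<^sup>2 = (M / b * (2 / m) powr q) powr (2 / DIM('a))"
      using M b m by (simp add: t_def powr_powr flip: powr_realpow)
    also have "\<dots> = (M / b) powr (2 / DIM('a)) * ((2 / m) powr q) powr (2 / DIM('a))"
      by (rule powr_mult)
    finally show ?thesis by (simp add: powr_powr mult.commute)
  qed
  have c: "continuous_on UNIV \<phi>" using sm Ck_continuous by blast
  have mf: "\<phi> \<in> borel_measurable borel" using c by (rule borel_measurable_continuous_onI)
  have mt: "(\<lambda>z. \<phi> (x - t *\<^sub>R z)) \<in> borel_measurable borel" for x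
    by (intro borel_measurable_continuous_onI continuous_on_compose2[OF c] continuous_intros) auto
  have avg: "(\<integral>\<^sup>+z. ennreal \<bar>\<phi> (x - t *\<^sub>R z)\<bar> * indicator ?B z \<partial>lborel) \<le> ennreal m * emeasure lborel ?B" for x
  proof -
    let ?P = "\<lambda>z. ennreal (\<bar>\<phi> (x - t *\<^sub>R z)\<bar> powr q)"
    let ?c = "ennreal ((m / 2) powr (1 - q))"
    have "ennreal (t ^ DIM('a)) * (\<integral>\<^sup>+z. ?P z \<partial>lborel) \<le> ennreal M"
      using nn_integral_lborel_affine[of "\<lambda>y. ennreal (\<bar>\<phi> y\<bar> powr q)" "- t" x] mf t M by simp
    then have P: "(\<integral>\<^sup>+z. ?P z \<partial>lborel) \<le> ennreal (M / t ^ DIM('a))"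
    proof (cases "\<integral>\<^sup>+z. ?P z \<partial>lborel")
      case top
      assume le: "ennreal (t ^ DIM('a)) * (\<integral>\<^sup>+z. ?P z \<partial>lborel) \<le> ennreal M"
      have "ennreal (t ^ DIM('a)) * (\<integral>\<^sup>+z. ?P z \<partial>lborel) = top" using t top by (simp add: ennreal_mult_top)
      with le show ?thesis by (simp add: top_unique)
    next
      case (real r)
      assume "ennreal (t ^ DIM('a)) * (\<integral>\<^sup>+z. ?P z \<partial>lborel) \<le> ennreal M"
      with real t M have "t ^ DIM('a) * r \<le> M" by (simp add: ennreal_mult[symmetric])
      with real t show ?thesis by (simp add: ennreal_leI pos_le_divide_eq mult.commute)
    qed
    have "(\<integral>\<^sup>+z. ennreal \<bar>\<phi> (x - t *\<^sub>R z)\<bar> * indicator ?B z \<partial>lborel) \<le>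
        (\<integral>\<^sup>+z. ennreal (m / 2) * indicator ?B z + ?c * ?P z \<partial>lborel)"
      using abs_le_powr_split[of "m / 2" q] m q
      by (intro nn_integral_mono) (auto simp: indicator_def ennreal_mult[symmetric] ennreal_plus[symmetric] intro!: ennreal_leI simp del: ennreal_plus)
    also have "\<dots> = ennreal (m / 2) * ennreal b + ?c * (\<integral>\<^sup>+z. ?P z \<partial>lborel)"
      using mt[of x] by (subst nn_integral_add) (auto simp: nn_integral_cmult nn_integral_cmult_indicator b intro!: borel_measurable_times_ennreal borel_measurable_indicator)
    also have "\<dots> \<le> ennreal (m / 2) * ennreal b + ?c * ennreal (M / t ^ DIM('a))"
      by (intro add_left_mono mult_left_mono P) auto
    also have "M / t ^ DIM('a) = b * (m / 2) powr q"
      using M b m unfolding tN by (simp add: powr_divide field_simps)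
    also have "?c * ennreal (b * (m / 2) powr q) = ennreal (m / 2) * ennreal b"
    proof -
      have "(m / 2) powr (1 - q) * (b * (m / 2) powr q) = (m / 2) * b"
        using m by (simp add: powr_diff)
      then show ?thesis using m b by (simp add: ennreal_mult[symmetric])
    qed
    also have "ennreal (m / 2) * ennreal b + ennreal (m / 2) * ennreal b = ennreal m * emeasure lborel ?B"
      using m b by (simp add: ennreal_mult[symmetric] ennreal_plus[symmetric] del: ennreal_plus)
    finally show ?thesis .
  qed
  show ?thesis
    using level_set_estimate[OF sm t m avg] by (simp add: t2 b_def mult.assoc)
qed

text \<open>
  The inequality is stated for functions whose square and Dirichlet integrals are at most \<open>1\<close>;
  the general case follows by scaling (\<open>sobolev_scaled\<close>).
\<close>

definition sobolev_embedding :: "'a::euclidean_space itself \<Rightarrow> real \<Rightarrow> bool" where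
  "sobolev_embedding _ q \<longleftrightarrow> (\<exists>C>0. \<forall>\<phi>::'a \<Rightarrow> real. smooth \<phi> \<longrightarrow>
     square_mass \<phi> \<le> 1 \<longrightarrow> dirichlet \<phi> \<le> 1 \<longrightarrow>
     powr_mass q \<phi> \<le> ennreal C)"

lemma dyadic_bracket:
  assumes "2 \<le> (y::real)"
  obtains k where "2 * 2 ^ k \<le> y" "y < 2 ^ (k + 2)"
proof -
  define n where "n = (LEAST n. y < 2 ^ n)"
  have "\<exists>n. y < 2 ^ n" using real_arch_pow[of 2 y] by auto
  then have n: "y < 2 ^ n" unfolding n_def by (rule LeastI_ex)
  have "n \<noteq> 0" "n \<noteq> 1"
    using n assms by (cases "n = 0"; cases "n = 1"; simp)+
  then obtain k where k: "n = k + 2" by (metis One_nat_def add_2_eq_Suc' not0_implies_Suc)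
  have "\<not> y < 2 ^ (k + 1)"
    using not_less_Least[of "k + 1" "\<lambda>n. y < 2 ^ n"] k by (simp add: n_def)
  with n k that[of k] show thesis by simp
qed

text \<open>
  On the level \<open>2\<^sup>k\<close> the superlevel estimate gains \<open>2 powr (- 2 k q / N)\<close>, where \<open>N\<close> is the
  dimension, against the weight \<open>2 powr (k (r - 2))\<close> of \<open>|\<phi>| powr (r - 2)\<close>. The sum over all
  levels is a geometric series, which converges for \<open>r < 2 + 2 q / N\<close>.
\<close>

lemma sobolev_embedding_step:
  assumes Sq: "sobolev_embedding TYPE('a::euclidean_space) q"
    and q: "2 \<le> q" "q \<le> r" "r < 2 + 2 * q / DIM('a)"
  shows "sobolev_embedding TYPE('a) r"
proof -
  obtain C where C: "0 < C" "\<And>\<phi>::'a \<Rightarrow> real. smooth \<phi> \<Longrightarrow>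
     square_mass \<phi> \<le> 1 \<Longrightarrow> dirichlet \<phi> \<le> 1 \<Longrightarrow>
     powr_mass q \<phi> \<le> ennreal C"
    using Sq unfolding sobolev_embedding_def by blast
  let ?N = "real DIM('a)"
  define b where "b = measure lborel (ball 0 1 :: 'a set)"
  have b: "0 < b" unfolding b_def by (rule content_ball_pos) simp
  define A where "A = 2 powr (2 * (r - 2)) * (4 * (C / b) powr (2 / ?N)) * 2 powr (2 * q / ?N)"
  define \<rho> where "\<rho> = 2 powr (r - 2 - 2 * q / ?N)"
  have A: "0 < A" using C b by (simp add: A_def)
  have \<rho>: "0 < \<rho>" "\<rho> < 1"
    using q(3) powr_less_mono[of "r - 2 - 2 * q / ?N" 0 2] by (auto simp: \<rho>_def)
  define c where "c k = 2 powr ((real k + 2) * (r - 2))" for k :: nat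
  have ck: "c k * (4 * (C / b) powr (2 / ?N) * (2 / 2 ^ k) powr (2 * q / ?N)) = A * \<rho> ^ k" for k
  proof -
    have 1: "(2 / 2 ^ k) powr (2 * q / ?N) = 2 powr (2 * q / ?N) * 2 powr (- (real k * (2 * q / ?N)))"
    proof -
      have "2 / 2 ^ k = (2 :: real) powr (1 - real k)" by (simp add: powr_diff powr_realpow)
      then show ?thesis by (simp add: powr_powr algebra_simps diff_divide_distrib flip: powr_add)
    qed
    have 2: "c k = 2 powr (2 * (r - 2)) * 2 powr (real k * (r - 2))"
      unfolding c_def powr_add[symmetric] by (simp add: algebra_simps)
    have 3: "\<rho> ^ k = 2 powr (real k * (r - 2)) * 2 powr (- (real k * (2 * q / ?N)))"
      unfolding \<rho>_def powr_add[symmetric] by (simp add: powr_powr algebra_simps flip: powr_realpow)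
    show ?thesis unfolding 1 2 3 A_def by (simp only: mult_ac)
  qed
  define C' where "C' = 2 powr (r - q) * C + A / (1 - \<rho>)"
  have C': "0 < C'" using C A \<rho> by (simp add: C'_def add_pos_pos)
  have "powr_mass r \<phi> \<le> ennreal C'"
    if sm: "smooth \<phi>" and L: "square_mass \<phi> \<le> 1"
      and D: "dirichlet \<phi> \<le> 1" for \<phi> :: "'a \<Rightarrow> real"
  proof -
    note Lq = C(2)[OF sm L D]
    have mf: "\<phi> \<in> borel_measurable borel"
      using sm Ck_continuous by (auto intro: borel_measurable_continuous_onI)
    let ?T = "\<lambda>k x. ennreal ((\<phi> x)\<^sup>2) * indicator {x. 2 * 2 ^ k \<le> \<bar>\<phi> x\<bar>} x"
    have pt: "ennreal (\<bar>\<phi> x\<bar> powr r) \<le> ennreal (2 powr (r - q)) * ennreal (\<bar>\<phi> x\<bar> powr q) + (\<Sum>k. ennreal (c k) * ?T k x)" for x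
    proof (cases "2 \<le> \<bar>\<phi> x\<bar>")
      case False
      have "\<bar>\<phi> x\<bar> powr r = \<bar>\<phi> x\<bar> powr (r - q) * \<bar>\<phi> x\<bar> powr q" by (simp flip: powr_add)
      also have "\<dots> \<le> 2 powr (r - q) * \<bar>\<phi> x\<bar> powr q"
        using False q by (intro mult_right_mono powr_mono2) auto
      finally have "ennreal (\<bar>\<phi> x\<bar> powr r) \<le> ennreal (2 powr (r - q)) * ennreal (\<bar>\<phi> x\<bar> powr q)"
        by (simp add: ennreal_mult[symmetric] ennreal_leI)
      then show ?thesis by (rule order_trans) simp
    next
      case True
      then obtain k where k: "2 * 2 ^ k \<le> \<bar>\<phi> x\<bar>" "\<bar>\<phi> x\<bar> < 2 ^ (k + 2)" by (rule dyadic_bracket)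
      have "\<bar>\<phi> x\<bar> powr r = \<bar>\<phi> x\<bar> powr (r - 2) * (\<phi> x)\<^sup>2"
        using True by (simp add: powr_diff)
      also have "\<dots> \<le> (2 ^ (k + 2)) powr (r - 2) * (\<phi> x)\<^sup>2"
        using k q by (intro mult_right_mono powr_mono2) auto
      also have "(2 ^ (k + 2)) powr (r - 2) = c k"
        unfolding c_def by (subst powr_realpow[symmetric]) (auto simp: powr_powr add.commute)
      finally have "ennreal (\<bar>\<phi> x\<bar> powr r) \<le> ennreal (c k) * ?T k x"
        using k(1) by (simp add: ennreal_mult[symmetric] ennreal_leI c_def)
      also have "\<dots> = (\<Sum>k\<in>{k}. ennreal (c k) * ?T k x)" by simp
      also have "\<dots> \<le> (\<Sum>k. ennreal (c k) * ?T k x)" by (rule sum_le_suminf) auto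
      finally show ?thesis by (rule order_trans) simp
    qed
    have mT: "?T k \<in> borel_measurable borel" for k using mf by measurable
    have "powr_mass r \<phi> \<le>
        (\<integral>\<^sup>+x. ennreal (2 powr (r - q)) * ennreal (\<bar>\<phi> x\<bar> powr q) + (\<Sum>k. ennreal (c k) * ?T k x) \<partial>lborel)"
      by (intro nn_integral_mono pt)
    also have "\<dots> = ennreal (2 powr (r - q)) * powr_mass q \<phi> + (\<Sum>k. ennreal (c k) * (\<integral>\<^sup>+x. ?T k x \<partial>lborel))"
      using mf mT by (subst nn_integral_add) (auto simp: nn_integral_cmult nn_integral_suminf intro!: borel_measurable_suminf_order)
    also have "\<dots> \<le> ennreal (2 powr (r - q)) * ennreal C + (\<Sum>k. ennreal (A * \<rho> ^ k))"
    proof (intro add_mono mult_left_mono Lq suminf_le summableI)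
      fix k
      have "(\<integral>\<^sup>+x. ?T k x \<partial>lborel) \<le> ennreal (4 * (C / b) powr (2 / ?N) * (2 / 2 ^ k) powr (2 * q / ?N)) * dirichlet \<phi>"
        unfolding b_def by (rule superlevel_estimate[OF sm _ C(1) Lq]) (use q in auto)
      also have "\<dots> \<le> ennreal (4 * (C / b) powr (2 / ?N) * (2 / 2 ^ k) powr (2 * q / ?N)) * 1"
        by (intro mult_left_mono D) simp
      finally have "ennreal (c k) * (\<integral>\<^sup>+x. ?T k x \<partial>lborel) \<le> ennreal (c k) * ennreal (4 * (C / b) powr (2 / ?N) * (2 / 2 ^ k) powr (2 * q / ?N))"
        by (intro mult_left_mono) auto
      moreover have "ennreal (A * \<rho> ^ k) = ennreal (c k) * ennreal (4 * (C / b) powr (2 / ?N) * (2 / 2 ^ k) powr (2 * q / ?N))"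
        unfolding ck[symmetric] by (rule ennreal_mult) (auto simp: c_def)
      ultimately show "ennreal (c k) * (\<integral>\<^sup>+x. ?T k x \<partial>lborel) \<le> ennreal (A * \<rho> ^ k)"
        by simp
    qed auto
    also have "(\<Sum>k. ennreal (A * \<rho> ^ k)) = ennreal (A / (1 - \<rho>))"
    proof (rule suminf_ennreal_eq)
      show "(\<lambda>k. A * \<rho> ^ k) sums (A / (1 - \<rho>))"
        using sums_mult[OF geometric_sums[of \<rho>], of A] \<rho> by simp
    qed (use A \<rho> in simp)
    also have "ennreal (2 powr (r - q)) * ennreal C + ennreal (A / (1 - \<rho>)) = ennreal C'"
      using C A \<rho> by (simp add: C'_def ennreal_mult[symmetric] ennreal_plus[symmetric] del: ennreal_plus)
    finally show ?thesis .
  qed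
  with C' show ?thesis unfolding sobolev_embedding_def by blast
qed

text \<open>
  The critical exponent is the positive fixed point of \<open>q \<mapsto> 2 + 2 q / N\<close>, or infinite if there
  is none. Up to a subcritical exponent \<open>p\<close> the gain of a step is bounded below by some \<open>\<delta> >
  0\<close>, so that finitely many steps lead from \<open>2\<close> to \<open>p\<close>, in every dimension.
\<close>

lemma sobolev_embedding_subcritical:
  assumes p: "2 \<le> p" "ereal p < crit_exponent DIM('a::euclidean_space)"
  shows "sobolev_embedding TYPE('a) p"
proof -
  let ?N = "real DIM('a)"
  have N: "1 \<le> ?N" using DIM_positive[where 'a='a] by linarith
  define \<delta> where "\<delta> = min (4 / ?N) (2 + 2 * p / ?N - p)"
  have "0 < 2 + 2 * p / ?N - p"
  proof (cases "3 \<le> DIM('a)")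
    case True
    then have "p < 2 * ?N / (?N - 2)" using p by (simp add: crit_exponent_def)
    with True show ?thesis by (simp add: field_simps)
  next
    case False
    then have "?N \<le> 2" by linarith
    then have "p * ?N \<le> p * 2" using p by (intro mult_left_mono) auto
    then have "p * ?N < p * 2 + ?N * 2" using N by linarith
    then show ?thesis using N by (simp add: field_simps)
  qed
  then have \<delta>: "0 < \<delta>" using N by (simp add: \<delta>_def)
  have gain: "\<delta> \<le> 2 + 2 * q / ?N - q" if "2 \<le> q" "q \<le> p" for q
  proof (cases "?N \<le> 2")
    case True
    then have "0 \<le> (q - 2) * (2 / ?N - 1)" using that N by (intro mult_nonneg_nonneg) (auto simp: field_simps)
    then have "4 / ?N \<le> 2 + 2 * q / ?N - q" using N by (simp add: field_simps)
    then show ?thesis by (simp add: \<delta>_def)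
  next
    case False
    then have "0 \<le> (p - q) * (1 - 2 / ?N)" using that N by (intro mult_nonneg_nonneg) (auto simp: field_simps)
    moreover have "(p - q) * (1 - 2 / ?N) = (2 + 2 * q / ?N - q) - (2 + 2 * p / ?N - p)"
      using N by (simp add: field_simps)
    ultimately have "2 + 2 * p / ?N - p \<le> 2 + 2 * q / ?N - q" by linarith
    then show ?thesis by (simp add: \<delta>_def)
  qed
  have S: "sobolev_embedding TYPE('a) (min p (2 + real n * (\<delta> / 2)))" for n
  proof (induction n)
    case 0
    have "sobolev_embedding TYPE('a) 2"
      unfolding sobolev_embedding_def by (intro exI[of _ 1]) simp
    then show ?case using p by simp
  next
    case (Suc n)
    let ?q = "min p (2 + real n * (\<delta> / 2))"
    have q: "2 \<le> ?q" "?q \<le> p" using p \<delta> by auto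
    have "?q \<le> min p (2 + real (Suc n) * (\<delta> / 2))" using \<delta> by (simp add: min_le_iff_disj algebra_simps)
    moreover have "min p (2 + real (Suc n) * (\<delta> / 2)) \<le> ?q + \<delta> / 2"
      using \<delta> by (simp add: min_def algebra_simps add_divide_distrib)
    then have "min p (2 + real (Suc n) * (\<delta> / 2)) < 2 + 2 * ?q / ?N"
      using gain[OF q] \<delta> by linarith
    ultimately show ?case using sobolev_embedding_step[OF Suc q(1)] by blast
  qed
  obtain n :: nat where "p / (\<delta> / 2) < real n" using reals_Archimedean2 by blast
  then have "p < 2 + real n * (\<delta> / 2)" using \<delta> by (simp add: field_simps)
  then show ?thesis using S[of n] by (simp add: min_def)
qed

section \<open>The space of Sobolev functions vanishing on the boundary\<close>

lemma weak_gradient_diff: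
  assumes "open \<Omega>" "weak_gradient \<Omega> u g" "weak_gradient \<Omega> v h" "u \<in> L2 \<Omega>" "g \<in> L2 \<Omega>" "v \<in> L2 \<Omega>" "h \<in> L2 \<Omega>"
  shows "weak_gradient \<Omega> (\<lambda>x. u x - v x) (\<lambda>x. g x - h x)"
  unfolding weak_gradient_def
proof (intro ballI)
  fix \<phi> b assume \<phi>: "\<phi> \<in> test_fun \<Omega>" and b: "b \<in> (Basis :: 'a set)"
  note i = weak_gradient_integrable[OF assms(1) \<phi> b assms(4,5)] weak_gradient_integrable[OF assms(1) \<phi> b assms(6,7)]
  show "(LINT x|lebesgue_on \<Omega>. (u x - v x) * frechet_derivative \<phi> (at x) b) =
        - (LINT x|lebesgue_on \<Omega>. ((g x - h x) \<bullet> b) * \<phi> x)"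
    using i assms(2,3)[unfolded weak_gradient_def, rule_format, OF \<phi> b]
    by (simp add: left_diff_distrib inner_diff_left)
qed

lemma wgradD:
  assumes "u \<in> H1 \<Omega>"
  shows "u \<in> L2 \<Omega>" "wgrad \<Omega> u \<in> L2 \<Omega>" "weak_gradient \<Omega> u (wgrad \<Omega> u)"
proof -
  show "u \<in> L2 \<Omega>" using assms by (simp add: H1_def)
  have "\<exists>g. g \<in> L2 \<Omega> \<and> weak_gradient \<Omega> u g" using assms by (auto simp: H1_def)
  then have "wgrad \<Omega> u \<in> L2 \<Omega> \<and> weak_gradient \<Omega> u (wgrad \<Omega> u)"
    unfolding wgrad_def by (rule someI_ex)
  then show "wgrad \<Omega> u \<in> L2 \<Omega>" "weak_gradient \<Omega> u (wgrad \<Omega> u)" by auto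
qed

lemma wgrad_AE_eq:
  assumes "open \<Omega>" "u \<in> L2 \<Omega>" "g \<in> L2 \<Omega>" "weak_gradient \<Omega> u g"
  shows "AE x in lebesgue_on \<Omega>. wgrad \<Omega> u x = g x"
proof -
  have "u \<in> H1 \<Omega>" using assms by (auto simp: H1_def)
  from wgradD[OF this] show ?thesis using weak_gradient_unique[OF assms(1,2) _ _ assms(4,3)] by blast
qed

lemma H10_H1: "u \<in> H10 \<Omega> \<Longrightarrow> u \<in> H1 \<Omega>"
  by (simp add: H10_def)

text \<open>
  The square of the Sobolev distance of \<open>\<phi>\<close> from \<open>u\<close>, computed with a given weak gradient \<open>g\<close>
  of \<open>u\<close> in place of the chosen one.
\<close>

definition H1_gap :: "'a::euclidean_space set \<Rightarrow> ('a \<Rightarrow> real) \<Rightarrow> ('a \<Rightarrow> 'a) \<Rightarrow> ('a \<Rightarrow> real) \<Rightarrow> real" where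
  "H1_gap \<Omega> u g \<phi> = (LINT x|lebesgue_on \<Omega>. (norm (grad \<phi> x - g x))\<^sup>2 + (\<phi> x - u x)\<^sup>2)"

lemma H1_nrm_diff_test_fun:
  assumes "open \<Omega>" "u \<in> L2 \<Omega>" "g \<in> L2 \<Omega>" "weak_gradient \<Omega> u g" "\<phi> \<in> test_fun \<Omega>"
  shows "(H1_nrm \<Omega> (\<lambda>x. \<phi> x - u x))\<^sup>2 = H1_gap \<Omega> u g \<phi>"
proof -
  note t = test_fun_L2[OF assms(1,5)]
  have "weak_gradient \<Omega> (\<lambda>x. \<phi> x - u x) (\<lambda>x. grad \<phi> x - g x)"
    by (rule weak_gradient_diff[OF assms(1) weak_gradient_smooth[OF assms(1) test_funD(1)[OF assms(5)]] assms(4) t assms(2,3)])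
  then have "AE x in lebesgue_on \<Omega>. wgrad \<Omega> (\<lambda>x. \<phi> x - u x) x = grad \<phi> x - g x"
    using assms t by (intro wgrad_AE_eq L2_diff)
  then have e: "(LINT x|lebesgue_on \<Omega>. (norm (wgrad \<Omega> (\<lambda>x. \<phi> x - u x) x))\<^sup>2 + (\<phi> x - u x)\<^sup>2) = H1_gap \<Omega> u g \<phi>"
  proof -
    assume ae: "AE x in lebesgue_on \<Omega>. wgrad \<Omega> (\<lambda>x. \<phi> x - u x) x = grad \<phi> x - g x"
    have d: "(\<lambda>x. \<phi> x - u x) \<in> H1 \<Omega>"
      unfolding H1_def using \<open>weak_gradient \<Omega> (\<lambda>x. \<phi> x - u x) _\<close> L2_diff[OF t(1) assms(2)] L2_diff[OF t(2) assms(3)] by auto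
    have m: "u \<in> borel_measurable (lebesgue_on \<Omega>)" "g \<in> borel_measurable (lebesgue_on \<Omega>)"
      "\<phi> \<in> borel_measurable (lebesgue_on \<Omega>)" "grad \<phi> \<in> borel_measurable (lebesgue_on \<Omega>)"
      "wgrad \<Omega> (\<lambda>x. \<phi> x - u x) \<in> borel_measurable (lebesgue_on \<Omega>)"
      using assms(2,3) t wgradD(2)[OF d] by (auto dest: L2D(1))
    show ?thesis unfolding H1_gap_def
    proof (rule integral_cong_AE)
      show "AE x in lebesgue_on \<Omega>. (norm (wgrad \<Omega> (\<lambda>x. \<phi> x - u x) x))\<^sup>2 + (\<phi> x - u x)\<^sup>2 = (norm (grad \<phi> x - g x))\<^sup>2 + (\<phi> x - u x)\<^sup>2"
        using ae by eventually_elim simp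
    qed (use m in measurable)
  qed
  have "0 \<le> H1_gap \<Omega> u g \<phi>" by (simp add: H1_gap_def)
  then show ?thesis using e by (simp add: H1_nrm_def)
qed

lemma H10_approximation:
  assumes "open \<Omega>" "u \<in> H10 \<Omega>"
  obtains \<phi> :: "nat \<Rightarrow> 'a::euclidean_space \<Rightarrow> real" where "\<And>k. \<phi> k \<in> test_fun \<Omega>"
    "(\<lambda>k. H1_gap \<Omega> u (wgrad \<Omega> u) (\<phi> k)) \<longlonglongrightarrow> 0"
proof -
  obtain \<phi> :: "nat \<Rightarrow> 'a \<Rightarrow> real" where \<phi>: "\<And>k. \<phi> k \<in> test_fun \<Omega>"
    "(\<lambda>k. H1_nrm \<Omega> (\<lambda>x. \<phi> k x - u x)) \<longlonglongrightarrow> 0"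
    using assms(2) unfolding H10_def by blast
  have "(\<lambda>k. (H1_nrm \<Omega> (\<lambda>x. \<phi> k x - u x))\<^sup>2) \<longlonglongrightarrow> 0"
    using tendsto_power[OF \<phi>(2), of 2] by simp
  then show thesis
    using that[OF \<phi>(1)] H1_nrm_diff_test_fun[OF assms(1) wgradD[OF H10_H1[OF assms(2)]] \<phi>(1)] by simp
qed

lemma H10I:
  assumes "open \<Omega>" "u \<in> L2 \<Omega>" "g \<in> L2 \<Omega>" "weak_gradient \<Omega> u g"
    "\<And>k. \<phi> k \<in> test_fun \<Omega>" "(\<lambda>k. H1_gap \<Omega> u g (\<phi> k)) \<longlonglongrightarrow> 0"
  shows "u \<in> H10 \<Omega>"
proof -
  have "(\<lambda>k. (H1_nrm \<Omega> (\<lambda>x. \<phi> k x - u x))\<^sup>2) \<longlonglongrightarrow> 0"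
    using assms(6) by (simp add: H1_nrm_diff_test_fun[OF assms(1-5)])
  from tendsto_real_sqrt[OF this] have "(\<lambda>k. H1_nrm \<Omega> (\<lambda>x. \<phi> k x - u x)) \<longlonglongrightarrow> 0"
    by (simp add: H1_nrm_def)
  then show ?thesis
    using assms unfolding H10_def H1_def by blast
qed

text \<open>
  Multiplication by \<open>\<eta>\<close> maps test functions to test functions and is bounded in the Sobolev
  norm, so it preserves their closure.
\<close>

lemma H10_smooth_mult:
  fixes u \<eta> :: "'a::euclidean_space \<Rightarrow> real"
  assumes \<Omega>: "open \<Omega>" and u: "u \<in> H10 \<Omega>" and sm: "smooth \<eta>"
    and c: "\<And>x. \<bar>\<eta> x\<bar> \<le> c" and L: "\<And>x. norm (grad \<eta> x) \<le> L"
  shows "(\<lambda>x. \<eta> x * u x) \<in> H10 \<Omega>"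
    "AE x in lebesgue_on \<Omega>. wgrad \<Omega> (\<lambda>x. \<eta> x * u x) x = \<eta> x *\<^sub>R wgrad \<Omega> u x + u x *\<^sub>R grad \<eta> x"
proof -
  note w = wgradD[OF H10_H1[OF u]]
  have L0: "0 \<le> L" using order_trans[OF norm_ge_zero L] .
  have m: "\<eta> \<in> borel_measurable (lebesgue_on \<Omega>)" "grad \<eta> \<in> borel_measurable (lebesgue_on \<Omega>)"
    by (auto intro!: measurable_restrict_space1 measurable_completion borel_measurable_continuous_onI
        Ck_continuous[OF sm[rule_format]] continuous_on_grad[OF sm])
  have u\<eta>: "(\<lambda>x. \<eta> x * u x) \<in> L2 \<Omega>"
    using L2_bounded_scaleR[OF w(1) m(1), of c] c by simp
  have ug: "(\<lambda>x. u x *\<^sub>R grad \<eta> x) \<in> L2 \<Omega>"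
  proof -
    have "integrable (lebesgue_on \<Omega>) (\<lambda>x. (norm (u x *\<^sub>R grad \<eta> x))\<^sup>2)"
    proof (rule Bochner_Integration.integrable_bound)
      show "integrable (lebesgue_on \<Omega>) (\<lambda>x. L\<^sup>2 * (norm (u x))\<^sup>2)"
        by (intro integrable_mult_right L2D(2)[OF w(1)])
      show "(\<lambda>x. (norm (u x *\<^sub>R grad \<eta> x))\<^sup>2) \<in> borel_measurable (lebesgue_on \<Omega>)"
        using m L2D(1)[OF w(1)] by measurable
      have "(norm (grad \<eta> x))\<^sup>2 \<le> L\<^sup>2" for x using L by (intro power_mono) auto
      then show "AE x in lebesgue_on \<Omega>. norm ((norm (u x *\<^sub>R grad \<eta> x))\<^sup>2) \<le> norm (L\<^sup>2 * (norm (u x))\<^sup>2)"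
        by (auto simp: power_mult_distrib mult.commute[of "(u _)\<^sup>2"] intro!: mult_right_mono)
    qed
    then show ?thesis using m L2D(1)[OF w(1)] by (simp add: L2_def)
  qed
  define g where "g x = \<eta> x *\<^sub>R wgrad \<Omega> u x + u x *\<^sub>R grad \<eta> x" for x
  have g: "g \<in> L2 \<Omega>"
    unfolding g_def using c by (intro L2_add ug L2_bounded_scaleR[OF w(2) m(1), of c]) auto
  have wg: "weak_gradient \<Omega> (\<lambda>x. \<eta> x * u x) g"
    unfolding weak_gradient_def
  proof (intro ballI)
    fix \<psi> b assume \<psi>: "\<psi> \<in> test_fun \<Omega>" and b: "b \<in> (Basis :: 'a set)"
    note \<eta>\<psi> = test_fun_mult_smooth[OF sm \<psi>]
    note d = smooth_differentiable[OF sm] smooth_differentiable[OF test_funD(1)[OF \<psi>]]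
    have fd: "frechet_derivative (\<lambda>x. \<eta> x * \<psi> x) (at x) b = \<eta> x * frechet_derivative \<psi> (at x) b + (grad \<eta> x \<bullet> b) * \<psi> x" for x
      using d by (simp add: frechet_derivative_eq_grad[OF smooth_differentiable[OF test_funD(1)[OF \<eta>\<psi>]]]
          frechet_derivative_eq_grad grad_mult[OF d] inner_add_left mult.commute)
    have e: "(LINT x|lebesgue_on \<Omega>. u x * frechet_derivative (\<lambda>x. \<eta> x * \<psi> x) (at x) b) =
        - (LINT x|lebesgue_on \<Omega>. (wgrad \<Omega> u x \<bullet> b) * (\<eta> x * \<psi> x))"
      using w(3) \<eta>\<psi> b unfolding weak_gradient_def by blast
    have i1: "integrable (lebesgue_on \<Omega>) (\<lambda>x. (\<eta> x * u x) * frechet_derivative \<psi> (at x) b)"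
      by (rule weak_gradient_integrable(1)[OF \<Omega> \<psi> b u\<eta> g])
    have i2: "integrable (lebesgue_on \<Omega>) (\<lambda>x. ((u x *\<^sub>R grad \<eta> x) \<bullet> b) * \<psi> x)"
      by (rule weak_gradient_integrable(2)[OF \<Omega> \<psi> b u\<eta> ug])
    have i3: "integrable (lebesgue_on \<Omega>) (\<lambda>x. (wgrad \<Omega> u x \<bullet> b) * (\<eta> x * \<psi> x))"
      by (rule weak_gradient_integrable(2)[OF \<Omega> \<eta>\<psi> b u\<eta> w(2)])
    have "(LINT x|lebesgue_on \<Omega>. u x * frechet_derivative (\<lambda>x. \<eta> x * \<psi> x) (at x) b) =
        (LINT x|lebesgue_on \<Omega>. (\<eta> x * u x) * frechet_derivative \<psi> (at x) b) +
        (LINT x|lebesgue_on \<Omega>. ((u x *\<^sub>R grad \<eta> x) \<bullet> b) * \<psi> x)"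
      unfolding fd using i1 i2 by (subst Bochner_Integration.integral_add[symmetric]) (auto simp: algebra_simps)
    moreover have "(LINT x|lebesgue_on \<Omega>. (g x \<bullet> b) * \<psi> x) =
        (LINT x|lebesgue_on \<Omega>. (wgrad \<Omega> u x \<bullet> b) * (\<eta> x * \<psi> x)) +
        (LINT x|lebesgue_on \<Omega>. ((u x *\<^sub>R grad \<eta> x) \<bullet> b) * \<psi> x)"
      using i3 i2 by (subst Bochner_Integration.integral_add[symmetric]) (auto simp: g_def inner_add_left algebra_simps)
    ultimately show "(LINT x|lebesgue_on \<Omega>. (\<eta> x * u x) * frechet_derivative \<psi> (at x) b) =
        - (LINT x|lebesgue_on \<Omega>. (g x \<bullet> b) * \<psi> x)"
      using e by simp
  qed
  show "AE x in lebesgue_on \<Omega>. wgrad \<Omega> (\<lambda>x. \<eta> x * u x) x = \<eta> x *\<^sub>R wgrad \<Omega> u x + u x *\<^sub>R grad \<eta> x"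
    using wgrad_AE_eq[OF \<Omega> u\<eta> g wg] by (simp add: g_def)
  obtain \<phi> where \<phi>: "\<And>k. \<phi> k \<in> test_fun \<Omega>" "(\<lambda>k. H1_gap \<Omega> u (wgrad \<Omega> u) (\<phi> k)) \<longlonglongrightarrow> 0"
    using H10_approximation[OF \<Omega> u] by metis
  define K where "K = 2 * c\<^sup>2 + 2 * L\<^sup>2 + c\<^sup>2"
  have up: "H1_gap \<Omega> (\<lambda>x. \<eta> x * u x) g (\<lambda>x. \<eta> x * \<phi> k x) \<le> K * H1_gap \<Omega> u (wgrad \<Omega> u) (\<phi> k)" for k
  proof -
    note t = test_fun_L2[OF \<Omega> \<phi>(1)[of k]] test_fun_L2[OF \<Omega> test_fun_mult_smooth[OF sm \<phi>(1)[of k]]]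
    have pt: "(norm (grad (\<lambda>x. \<eta> x * \<phi> k x) x - g x))\<^sup>2 + (\<eta> x * \<phi> k x - \<eta> x * u x)\<^sup>2
        \<le> K * ((norm (grad (\<phi> k) x - wgrad \<Omega> u x))\<^sup>2 + (\<phi> k x - u x)\<^sup>2)" for x
    proof -
      have c2: "(\<eta> x)\<^sup>2 \<le> c\<^sup>2" using power_mono[OF c[of x], of 2] by simp
      have L2: "(norm (grad \<eta> x))\<^sup>2 \<le> L\<^sup>2" using L by (intro power_mono) auto
      let ?A = "(norm (grad (\<phi> k) x - wgrad \<Omega> u x))\<^sup>2" and ?B = "(\<phi> k x - u x)\<^sup>2"
      have "grad (\<lambda>x. \<eta> x * \<phi> k x) x - g x = \<eta> x *\<^sub>R (grad (\<phi> k) x - wgrad \<Omega> u x) + (\<phi> k x - u x) *\<^sub>R grad \<eta> x"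
        by (simp add: g_def grad_mult[OF smooth_differentiable[OF sm] smooth_differentiable[OF test_funD(1)[OF \<phi>(1)]]] algebra_simps)
      then have "(norm (grad (\<lambda>x. \<eta> x * \<phi> k x) x - g x))\<^sup>2 \<le> 2 * ((\<eta> x)\<^sup>2 * ?A) + 2 * (?B * (norm (grad \<eta> x))\<^sup>2)"
        using norm_add_square_le[of "\<eta> x *\<^sub>R (grad (\<phi> k) x - wgrad \<Omega> u x)" "(\<phi> k x - u x) *\<^sub>R grad \<eta> x"]
        by (simp add: power_mult_distrib)
      also have "\<dots> \<le> 2 * (c\<^sup>2 * ?A) + 2 * (?B * L\<^sup>2)"
        using c2 L2 by (intro add_mono mult_left_mono mult_right_mono) auto
      finally have 1: "(norm (grad (\<lambda>x. \<eta> x * \<phi> k x) x - g x))\<^sup>2 \<le> 2 * (c\<^sup>2 * ?A) + 2 * (?B * L\<^sup>2)" .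
      have "(\<eta> x * \<phi> k x - \<eta> x * u x)\<^sup>2 = (\<eta> x)\<^sup>2 * ?B"
        by (simp add: power_mult_distrib flip: right_diff_distrib)
      also have "\<dots> \<le> c\<^sup>2 * ?B" using c2 by (intro mult_right_mono) auto
      finally have 2: "(\<eta> x * \<phi> k x - \<eta> x * u x)\<^sup>2 \<le> c\<^sup>2 * ?B" .
      have "K * (?A + ?B) = 3 * (c\<^sup>2 * ?A) + 2 * (L\<^sup>2 * ?A) + 3 * (c\<^sup>2 * ?B) + 2 * (?B * L\<^sup>2)"
        by (simp add: K_def algebra_simps)
      moreover have "0 \<le> c\<^sup>2 * ?A" "0 \<le> L\<^sup>2 * ?A" "0 \<le> c\<^sup>2 * ?B" by simp_all
      ultimately show ?thesis using 1 2 by linarith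
    qed
    have i1: "integrable (lebesgue_on \<Omega>) (\<lambda>x. (norm (grad (\<lambda>x. \<eta> x * \<phi> k x) x - g x))\<^sup>2 + (\<eta> x * \<phi> k x - \<eta> x * u x)\<^sup>2)"
      using L2D(2)[OF L2_diff[OF t(4) g]] L2D(2)[OF L2_diff[OF t(3) u\<eta>]] by simp
    have i2: "integrable (lebesgue_on \<Omega>) (\<lambda>x. K * ((norm (grad (\<phi> k) x - wgrad \<Omega> u x))\<^sup>2 + (\<phi> k x - u x)\<^sup>2))"
      using L2D(2)[OF L2_diff[OF t(2) w(2)]] L2D(2)[OF L2_diff[OF t(1) w(1)]] by simp
    from integral_mono[OF i1 i2 pt] show ?thesis by (simp add: H1_gap_def)
  qed
  have lo: "0 \<le> H1_gap \<Omega> (\<lambda>x. \<eta> x * u x) g (\<lambda>x. \<eta> x * \<phi> k x)" for k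
    by (simp add: H1_gap_def)
  have "(\<lambda>k. K * H1_gap \<Omega> u (wgrad \<Omega> u) (\<phi> k)) \<longlonglongrightarrow> 0"
    using tendsto_mult_left[OF \<phi>(2), of K] by simp
  then have "(\<lambda>k. H1_gap \<Omega> (\<lambda>x. \<eta> x * u x) g (\<lambda>x. \<eta> x * \<phi> k x)) \<longlonglongrightarrow> 0"
    by (rule tendsto_sandwich[OF always_eventually[OF allI[OF lo]] always_eventually[OF allI[OF up]] tendsto_const])
  then show "(\<lambda>x. \<eta> x * u x) \<in> H10 \<Omega>"
    by (intro H10I[OF \<Omega> u\<eta> g wg test_fun_mult_smooth[OF sm \<phi>(1)]])
qed

definition h1sq :: "'a::euclidean_space set \<Rightarrow> ('a \<Rightarrow> real) \<Rightarrow> real" where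
  "h1sq \<Omega> u = (LINT x|lebesgue_on \<Omega>. (norm (wgrad \<Omega> u x))\<^sup>2 + (u x)\<^sup>2)"

lemma h1sq_nonneg: "0 \<le> h1sq \<Omega> u"
  by (simp add: h1sq_def)

lemma h1sq_integrable:
  assumes "u \<in> H1 \<Omega>"
  shows "integrable (lebesgue_on \<Omega>) (\<lambda>x. (norm (wgrad \<Omega> u x))\<^sup>2)" "integrable (lebesgue_on \<Omega>) (\<lambda>x. (u x)\<^sup>2)"
  using L2D(2)[OF wgradD(1)[OF assms]] L2D(2)[OF wgradD(2)[OF assms]] by simp_all

lemma sobolev_scaled:
  assumes "sobolev_embedding TYPE('a::euclidean_space) p"
  obtains C where "0 < C" "\<And>(\<phi>::'a \<Rightarrow> real) A. smooth \<phi> \<Longrightarrow> 0 < A \<Longrightarrow>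
     square_mass \<phi> \<le> ennreal A \<Longrightarrow> dirichlet \<phi> \<le> ennreal A \<Longrightarrow>
     powr_mass p \<phi> \<le> ennreal (C * A powr (p / 2))"
proof -
  obtain C where C: "0 < C" "\<And>\<phi>::'a \<Rightarrow> real. smooth \<phi> \<Longrightarrow>
     square_mass \<phi> \<le> 1 \<Longrightarrow> dirichlet \<phi> \<le> 1 \<Longrightarrow>
     powr_mass p \<phi> \<le> ennreal C"
    using assms unfolding sobolev_embedding_def by blast
  have "powr_mass p \<phi> \<le> ennreal (C * A powr (p / 2))"
    if sm: "smooth \<phi>" and A: "0 < A" and 1: "square_mass \<phi> \<le> ennreal A"
      and 2: "dirichlet \<phi> \<le> ennreal A" for \<phi> :: "'a \<Rightarrow> real" and A
  proof -
    define s where "s = 1 / sqrt A"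
    have s: "0 < s" "s\<^sup>2 * A = 1" using A by (auto simp: s_def power_divide)
    have m: "\<phi> \<in> borel_measurable borel" "grad \<phi> \<in> borel_measurable borel"
      by (auto intro!: borel_measurable_continuous_onI Ck_continuous[OF sm[rule_format]] continuous_on_grad[OF sm])
    have g0: "grad (\<lambda>x. s) x = 0" for x :: 'a by (rule grad_unique) simp
    have gr: "grad (\<lambda>x. s * \<phi> x) x = s *\<^sub>R grad \<phi> x" for x
    proof -
      have "(\<lambda>x::'a. s) differentiable (at x)" by simp
      from grad_mult[OF this smooth_differentiable[OF sm]] show ?thesis by (simp add: g0)
    qed
    have scale: "ennreal (s\<^sup>2) * I \<le> 1" if "I \<le> ennreal A" for I
    proof -
      have "ennreal (s\<^sup>2) * I \<le> ennreal (s\<^sup>2) * ennreal A" by (rule mult_left_mono[OF that]) simp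
      also have "\<dots> = 1" using s A by (simp flip: ennreal_mult)
      finally show ?thesis .
    qed
    have "(\<integral>\<^sup>+x. ennreal (\<bar>s * \<phi> x\<bar> powr p) \<partial>lborel) \<le> ennreal C"
    proof (rule C(2))
      show "smooth (\<lambda>x. s * \<phi> x)" using sm Ck_mult Ck_const by blast
      show "(\<integral>\<^sup>+x. ennreal ((s * \<phi> x)\<^sup>2) \<partial>lborel) \<le> 1"
        using scale[OF 1] m(1) by (simp add: power_mult_distrib ennreal_mult nn_integral_cmult)
      show "(\<integral>\<^sup>+x. ennreal ((norm (grad (\<lambda>x. s * \<phi> x) x))\<^sup>2) \<partial>lborel) \<le> 1"
        using scale[OF 2] m(2) by (simp add: gr power_mult_distrib ennreal_mult nn_integral_cmult)
    qed
    then have le: "ennreal (s powr p) * powr_mass p \<phi> \<le> ennreal C"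
      using m(1) s by (simp add: abs_mult powr_mult ennreal_mult nn_integral_cmult)
    have sA: "s powr p * A powr (p / 2) = 1"
      using A by (simp add: s_def powr_divide powr_half_sqrt[symmetric] powr_powr)
    have "powr_mass p \<phi>
        = ennreal (A powr (p / 2)) * (ennreal (s powr p) * powr_mass p \<phi>)"
      unfolding mult.assoc[symmetric] by (subst ennreal_mult[symmetric]) (auto simp: sA mult.commute[of "A powr _"])
    also have "\<dots> \<le> ennreal (A powr (p / 2)) * ennreal C"
      by (rule mult_left_mono[OF le]) simp
    also have "\<dots> = ennreal (C * A powr (p / 2))"
      using C(1) by (simp add: ennreal_mult mult.commute)
    finally show ?thesis .
  qed
  with C(1) that show thesis by blast
qed

lemma nn_integral_lebesgue_on_le:
  fixes f :: "'a::euclidean_space \<Rightarrow> ennreal"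
  assumes "open \<Omega>" "f \<in> borel_measurable borel"
  shows "(\<integral>\<^sup>+x. f x \<partial>lebesgue_on \<Omega>) \<le> (\<integral>\<^sup>+x. f x \<partial>lborel)"
proof -
  have "(\<integral>\<^sup>+x. f x \<partial>lebesgue_on \<Omega>) = (\<integral>\<^sup>+x. f x * indicator \<Omega> x \<partial>lebesgue)"
    using assms(1) by (subst nn_integral_restrict_space) auto
  also have "\<dots> \<le> (\<integral>\<^sup>+x. f x \<partial>lebesgue)"
    by (intro nn_integral_mono) (auto simp: indicator_def)
  also have "\<dots> = (\<integral>\<^sup>+x. f x \<partial>lborel)"
    by (rule nn_integral_completion)
  finally show ?thesis .
qed

lemma nn_integral_lborel_square_L2:
  fixes f :: "'a::euclidean_space \<Rightarrow> 'b::euclidean_space"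
  assumes "open \<Omega>" "f \<in> L2 \<Omega>" "\<And>x. x \<notin> \<Omega> \<Longrightarrow> f x = 0"
  shows "(\<integral>\<^sup>+x. ennreal ((norm (f x))\<^sup>2) \<partial>lborel) = ennreal (LINT x|lebesgue_on \<Omega>. (norm (f x))\<^sup>2)"
proof -
  have "(\<integral>\<^sup>+x. ennreal ((norm (f x))\<^sup>2) \<partial>lborel) = (\<integral>\<^sup>+x. ennreal ((norm (f x))\<^sup>2) \<partial>lebesgue)"
    by (rule nn_integral_completion[symmetric])
  also have "\<dots> = (\<integral>\<^sup>+x. ennreal ((norm (f x))\<^sup>2) * indicator \<Omega> x \<partial>lebesgue)"
    using assms(3) by (intro nn_integral_cong) (auto simp: indicator_def)
  also have "\<dots> = (\<integral>\<^sup>+x. ennreal ((norm (f x))\<^sup>2) \<partial>lebesgue_on \<Omega>)"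
    using assms(1) by (subst nn_integral_restrict_space) auto
  also have "\<dots> = ennreal (LINT x|lebesgue_on \<Omega>. (norm (f x))\<^sup>2)"
    by (rule nn_integral_eq_integral[OF L2D(2)[OF assms(2)]]) simp
  finally show ?thesis .
qed

lemma test_fun_energy_le:
  fixes u :: "'a::euclidean_space \<Rightarrow> real"
  assumes \<Omega>: "open \<Omega>" and u: "u \<in> H1 \<Omega>" and \<phi>: "\<phi> \<in> test_fun \<Omega>"
  defines "A \<equiv> 2 * H1_gap \<Omega> u (wgrad \<Omega> u) \<phi> + 2 * h1sq \<Omega> u"
  shows "square_mass \<phi> \<le> ennreal A" "dirichlet \<phi> \<le> ennreal A"
proof -
  note w = wgradD[OF u]
  note t = test_fun_L2[OF \<Omega> \<phi>]
  note i = L2D(2)[OF L2_diff[OF t(2) w(2)]] L2D(2)[OF L2_diff[OF t(1) w(1)]] L2D(2)[OF w(1)] L2D(2)[OF w(2)] L2D(2)[OF t(1)] L2D(2)[OF t(2)]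
  let ?B = "\<lambda>x. 2 * ((norm (grad \<phi> x - wgrad \<Omega> u x))\<^sup>2 + (\<phi> x - u x)\<^sup>2) + 2 * ((norm (wgrad \<Omega> u x))\<^sup>2 + (u x)\<^sup>2)"
  have B: "integrable (lebesgue_on \<Omega>) ?B" using i by simp
  have A: "(LINT x|lebesgue_on \<Omega>. ?B x) = A"
    using i by (simp add: A_def H1_gap_def h1sq_def)
  have 1: "(norm (\<phi> x))\<^sup>2 \<le> ?B x" for x
  proof -
    have "(norm (\<phi> x))\<^sup>2 \<le> 2 * (norm (\<phi> x - u x))\<^sup>2 + 2 * (norm (u x))\<^sup>2"
      using norm_add_square_le[of "\<phi> x - u x" "u x"] by simp
    then have "(norm (\<phi> x))\<^sup>2 \<le> 2 * (\<phi> x - u x)\<^sup>2 + 2 * (u x)\<^sup>2" by simp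
    moreover have "0 \<le> (norm (grad \<phi> x - wgrad \<Omega> u x))\<^sup>2" "0 \<le> (norm (wgrad \<Omega> u x))\<^sup>2" by simp_all
    ultimately show ?thesis unfolding distrib_left by linarith
  qed
  have 2: "(norm (grad \<phi> x))\<^sup>2 \<le> ?B x" for x
  proof -
    have "(norm (grad \<phi> x))\<^sup>2 \<le> 2 * (norm (grad \<phi> x - wgrad \<Omega> u x))\<^sup>2 + 2 * (norm (wgrad \<Omega> u x))\<^sup>2"
      using norm_add_square_le[of "grad \<phi> x - wgrad \<Omega> u x" "wgrad \<Omega> u x"] by simp
    moreover have "0 \<le> (\<phi> x - u x)\<^sup>2" "0 \<le> (u x)\<^sup>2" by simp_all
    ultimately show ?thesis unfolding distrib_left by linarith
  qed
  have "(LINT x|lebesgue_on \<Omega>. (norm (\<phi> x))\<^sup>2) \<le> A" "(LINT x|lebesgue_on \<Omega>. (norm (grad \<phi> x))\<^sup>2) \<le> A"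
    unfolding A[symmetric] by (rule integral_mono[OF i(5) B 1], rule integral_mono[OF i(6) B 2])
  then show "square_mass \<phi> \<le> ennreal A" "dirichlet \<phi> \<le> ennreal A"
    using nn_integral_lborel_square_L2[OF \<Omega> t(1) test_funD(2)[OF \<phi>]]
      nn_integral_lborel_square_L2[OF \<Omega> t(2) test_funD(3)[OF \<phi>]]
    by (simp_all add: ennreal_leI)
qed

text \<open>
  The inequality passes from test functions to their limits by Fatou's lemma along an almost
  everywhere convergent subsequence. A strictly positive bound \<open>A\<close> in place of \<open>h1sq \<Omega> u\<close>
  includes the case \<open>u = 0\<close> without a division by zero.
\<close>

lemma H10_sobolev:
  fixes \<Omega> :: "'a::euclidean_space set"
  assumes \<Omega>: "open \<Omega>" and S: "sobolev_embedding TYPE('a) p" and p: "0 < p"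
  obtains C where "0 < C" "\<And>u A. u \<in> H10 \<Omega> \<Longrightarrow> 0 < A \<Longrightarrow> h1sq \<Omega> u \<le> A \<Longrightarrow> integrable (lebesgue_on \<Omega>) (\<lambda>x. \<bar>u x\<bar> powr p)"
    "\<And>u A. u \<in> H10 \<Omega> \<Longrightarrow> 0 < A \<Longrightarrow> h1sq \<Omega> u \<le> A \<Longrightarrow> (LINT x|lebesgue_on \<Omega>. \<bar>u x\<bar> powr p) \<le> C * A powr (p / 2)"
proof -
  obtain C where C: "0 < C" "\<And>(\<phi>::'a \<Rightarrow> real) A. smooth \<phi> \<Longrightarrow> 0 < A \<Longrightarrow>
     square_mass \<phi> \<le> ennreal A \<Longrightarrow> dirichlet \<phi> \<le> ennreal A \<Longrightarrow>
     powr_mass p \<phi> \<le> ennreal (C * A powr (p / 2))"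
    using sobolev_scaled[OF S] by metis
  have main: "(\<integral>\<^sup>+x. ennreal (\<bar>u x\<bar> powr p) \<partial>lebesgue_on \<Omega>) \<le> ennreal (C * (4 * A) powr (p / 2))"
    if u: "u \<in> H10 \<Omega>" and A: "0 < A" "h1sq \<Omega> u \<le> A" for u A
  proof -
    note w = wgradD[OF H10_H1[OF u]]
    obtain \<phi> where \<phi>: "\<And>k. \<phi> k \<in> test_fun \<Omega>" "(\<lambda>k. H1_gap \<Omega> u (wgrad \<Omega> u) (\<phi> k)) \<longlonglongrightarrow> 0"
      using H10_approximation[OF \<Omega> u] by metis
    note t = test_fun_L2[OF \<Omega> \<phi>(1)]
    have mphi: "\<phi> k \<in> borel_measurable borel" for k
      by (rule borel_measurable_continuous_onI[OF Ck_continuous[OF test_funD(1)[OF \<phi>(1), rule_format]]])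
    have gap: "(LINT x|lebesgue_on \<Omega>. norm ((\<phi> k x - u x)\<^sup>2)) \<le> H1_gap \<Omega> u (wgrad \<Omega> u) (\<phi> k)" for k
      unfolding H1_gap_def
      using L2D(2)[OF L2_diff[OF t(2) w(2)]] L2D(2)[OF L2_diff[OF t(1) w(1)]]
      by (intro integral_mono Bochner_Integration.integrable_add) auto
    have "(\<lambda>k. LINT x|lebesgue_on \<Omega>. norm ((\<phi> k x - u x)\<^sup>2)) \<longlonglongrightarrow> 0"
      by (rule tendsto_sandwich[OF _ _ tendsto_const \<phi>(2)]) (use gap in \<open>auto intro!: always_eventually\<close>)
    moreover have "integrable (lebesgue_on \<Omega>) (\<lambda>x. (\<phi> k x - u x)\<^sup>2)" for k
      using L2D(2)[OF L2_diff[OF t(1) w(1)]] by simp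
    ultimately obtain r where r: "strict_mono r" "AE x in lebesgue_on \<Omega>. (\<lambda>k. (\<phi> (r k) x - u x)\<^sup>2) \<longlonglongrightarrow> 0"
      using tendsto_L1_AE_subseq[of "lebesgue_on \<Omega>" "\<lambda>k x. (\<phi> k x - u x)\<^sup>2"] by blast
    have lim: "AE x in lebesgue_on \<Omega>. (\<lambda>k. ennreal (\<bar>\<phi> (r k) x\<bar> powr p)) \<longlonglongrightarrow> ennreal (\<bar>u x\<bar> powr p)"
      using r(2)
    proof eventually_elim
      case (elim x)
      from tendsto_real_sqrt[OF elim] have "(\<lambda>k. \<bar>\<phi> (r k) x - u x\<bar>) \<longlonglongrightarrow> 0" by simp
      then have "(\<lambda>k. \<phi> (r k) x) \<longlonglongrightarrow> u x"
        by (simp add: tendsto_rabs_zero_iff LIM_zero_iff)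
      then have "(\<lambda>k. \<bar>\<phi> (r k) x\<bar> powr p) \<longlonglongrightarrow> \<bar>u x\<bar> powr p"
        using p by (intro tendsto_powr2 tendsto_rabs tendsto_const) auto
      then show ?case by (rule tendsto_ennrealI)
    qed
    have ev: "\<forall>\<^sub>F k in sequentially. (\<integral>\<^sup>+x. ennreal (\<bar>\<phi> (r k) x\<bar> powr p) \<partial>lebesgue_on \<Omega>) \<le> ennreal (C * (4 * A) powr (p / 2))"
    proof -
      have "(\<lambda>k. H1_gap \<Omega> u (wgrad \<Omega> u) (\<phi> (r k))) \<longlonglongrightarrow> 0"
        using LIMSEQ_subseq_LIMSEQ[OF \<phi>(2) r(1)] by (simp add: o_def)
      then have "\<forall>\<^sub>F k in sequentially. H1_gap \<Omega> u (wgrad \<Omega> u) (\<phi> (r k)) < A"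
        using A(1) by (rule order_tendstoD)
      then show ?thesis
      proof eventually_elim
        case (elim k)
        then have "ennreal (2 * H1_gap \<Omega> u (wgrad \<Omega> u) (\<phi> (r k)) + 2 * h1sq \<Omega> u) \<le> ennreal (4 * A)"
          using A by (intro ennreal_leI) linarith
        note le = test_fun_energy_le[OF \<Omega> H10_H1[OF u] \<phi>(1)[of "r k"], THEN order_trans, OF this]
        have "(\<integral>\<^sup>+x. ennreal (\<bar>\<phi> (r k) x\<bar> powr p) \<partial>lebesgue_on \<Omega>) \<le> (\<integral>\<^sup>+x. ennreal (\<bar>\<phi> (r k) x\<bar> powr p) \<partial>lborel)"
          using mphi[of "r k"] by (intro nn_integral_lebesgue_on_le[OF \<Omega>]) measurable
        also have "\<dots> \<le> ennreal (C * (4 * A) powr (p / 2))"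
          using A(1) by (intro C(2) test_funD(1)[OF \<phi>(1)] le) simp
        finally show ?case .
      qed
    qed
    have mk: "\<phi> k \<in> borel_measurable (lebesgue_on \<Omega>)" for k using L2D(1)[OF t(1)] .
    have "(\<integral>\<^sup>+x. ennreal (\<bar>u x\<bar> powr p) \<partial>lebesgue_on \<Omega>) = (\<integral>\<^sup>+x. liminf (\<lambda>k. ennreal (\<bar>\<phi> (r k) x\<bar> powr p)) \<partial>lebesgue_on \<Omega>)"
      using lim by (intro nn_integral_cong_AE, eventually_elim) (rule lim_imp_Liminf[OF sequentially_bot, symmetric])
    also have "\<dots> \<le> liminf (\<lambda>k. \<integral>\<^sup>+x. ennreal (\<bar>\<phi> (r k) x\<bar> powr p) \<partial>lebesgue_on \<Omega>)"
      using mk by (intro nn_integral_liminf) measurable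
    also have "\<dots> \<le> ennreal (C * (4 * A) powr (p / 2))"
    proof -
      have "liminf (\<lambda>k. \<integral>\<^sup>+x. ennreal (\<bar>\<phi> (r k) x\<bar> powr p) \<partial>lebesgue_on \<Omega>) \<le> limsup (\<lambda>k. \<integral>\<^sup>+x. ennreal (\<bar>\<phi> (r k) x\<bar> powr p) \<partial>lebesgue_on \<Omega>)"
        by (rule Liminf_le_Limsup) simp
      also have "\<dots> \<le> ennreal (C * (4 * A) powr (p / 2))"
        by (rule Limsup_bounded[OF ev])
      finally show ?thesis .
    qed
    finally show ?thesis .
  qed
  define C' where "C' = C * 4 powr (p / 2)"
  have i: "integrable (lebesgue_on \<Omega>) (\<lambda>x. \<bar>u x\<bar> powr p)" if u: "u \<in> H10 \<Omega>" and A: "0 < A" "h1sq \<Omega> u \<le> A" for u A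
  proof (rule integrableI_bounded)
    show "(\<lambda>x. \<bar>u x\<bar> powr p) \<in> borel_measurable (lebesgue_on \<Omega>)"
      using L2D(1)[OF wgradD(1)[OF H10_H1[OF u]]] by measurable
    show "(\<integral>\<^sup>+x. ennreal (norm (\<bar>u x\<bar> powr p)) \<partial>lebesgue_on \<Omega>) < \<infinity>"
      using main[OF u A] by (simp add: le_less_trans)
  qed
  show thesis
  proof
    show "0 < C'" using C(1) by (simp add: C'_def)
    show "integrable (lebesgue_on \<Omega>) (\<lambda>x. \<bar>u x\<bar> powr p)" if "u \<in> H10 \<Omega>" "0 < A" "h1sq \<Omega> u \<le> A" for u A
      using i[OF that] .
    show "(LINT x|lebesgue_on \<Omega>. \<bar>u x\<bar> powr p) \<le> C' * A powr (p / 2)" if u: "u \<in> H10 \<Omega>" and A: "0 < A" "h1sq \<Omega> u \<le> A" for u A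
    proof -
      have "ennreal (LINT x|lebesgue_on \<Omega>. \<bar>u x\<bar> powr p) \<le> ennreal (C * (4 * A) powr (p / 2))"
        using main[OF u A] nn_integral_eq_integral[OF i[OF u A]] by simp
      then show ?thesis using C(1) A(1) by (simp add: C'_def powr_mult mult.assoc)
    qed
  qed
qed

lemma abs_powr_split:
  assumes "0 < l" "p \<le> (r::real)" "0 < p"
  shows "\<bar>y\<bar> powr p \<le> l powr p + l powr (p - r) * \<bar>y\<bar> powr r"
proof (cases "\<bar>y\<bar> \<le> l")
  case True
  then have "\<bar>y\<bar> powr p \<le> l powr p" using assms by (intro powr_mono2) auto
  moreover have "0 \<le> l powr (p - r) * \<bar>y\<bar> powr r" by simp
  ultimately show ?thesis by linarith
next
  case False
  then have "\<bar>y\<bar> powr (p - r) \<le> l powr (p - r)"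
    using assms by (intro powr_mono2') auto
  then have "\<bar>y\<bar> powr (p - r) * \<bar>y\<bar> powr r \<le> l powr (p - r) * \<bar>y\<bar> powr r"
    by (intro mult_right_mono) auto
  moreover have "\<bar>y\<bar> powr (p - r) * \<bar>y\<bar> powr r = \<bar>y\<bar> powr p" by (simp flip: powr_add)
  moreover have "0 \<le> l powr p" by simp
  ultimately show ?thesis by linarith
qed

lemma indicator_lebesgue_on:
  assumes \<Omega>: "\<Omega> \<in> sets lebesgue" and S: "S \<in> lmeasurable"
  shows "integrable (lebesgue_on \<Omega>) (indicator S :: 'a::euclidean_space \<Rightarrow> real)"
    "(LINT x|lebesgue_on \<Omega>. indicator S x) \<le> measure lebesgue S"
proof -
  have SO: "S \<inter> \<Omega> \<in> lmeasurable" using S \<Omega> by (rule fmeasurable_Int_fmeasurable)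
  have e: "(\<lambda>x. indicator \<Omega> x * (indicator S x :: real)) = indicator (S \<inter> \<Omega>)"
    by (auto simp: indicator_def)
  show "integrable (lebesgue_on \<Omega>) (indicator S :: 'a \<Rightarrow> real)"
    using \<Omega> SO by (simp add: integrable_restrict_space e flip: lmeasurable_iff_integrable)
  show "(LINT x|lebesgue_on \<Omega>. indicator S x) \<le> measure lebesgue S"
    using \<Omega> SO S by (simp add: measure_restrict_space measure_mono_fmeasurable fmeasurableD)
qed

text \<open>
  Split at the level \<open>l\<close> times the norm: above it, the higher power integral makes the
  contribution small if \<open>l\<close> is large; below it, the contribution is small if the measure is.
\<close>

lemma H10_small_set:
  fixes \<Omega> :: "'a::euclidean_space set"
  assumes \<Omega>: "open \<Omega>" and S: "sobolev_embedding TYPE('a) r" and p: "0 < p" "p < r" and \<eta>: "0 < \<eta>"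
  obtains d where "0 < d" "\<And>S u A. S \<in> lmeasurable \<Longrightarrow> measure lebesgue S \<le> d \<Longrightarrow> u \<in> H10 \<Omega> \<Longrightarrow> 0 < A \<Longrightarrow> h1sq \<Omega> u \<le> A \<Longrightarrow>
    (LINT x|lebesgue_on \<Omega>. indicator S x * \<bar>u x\<bar> powr p) \<le> \<eta> * A powr (p / 2)"
proof -
  have \<Omega>': "\<Omega> \<in> sets lebesgue" using \<Omega> by auto
  obtain C where C: "0 < C" "\<And>u A. u \<in> H10 \<Omega> \<Longrightarrow> 0 < A \<Longrightarrow> h1sq \<Omega> u \<le> A \<Longrightarrow> integrable (lebesgue_on \<Omega>) (\<lambda>x. \<bar>u x\<bar> powr r)"
    "\<And>u A. u \<in> H10 \<Omega> \<Longrightarrow> 0 < A \<Longrightarrow> h1sq \<Omega> u \<le> A \<Longrightarrow> (LINT x|lebesgue_on \<Omega>. \<bar>u x\<bar> powr r) \<le> C * A powr (r / 2)"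
    by (rule H10_sobolev[OF \<Omega> S less_trans[OF p]]) (rule that)
  define l where "l = (2 * C / \<eta>) powr (1 / (r - p))"
  have l: "0 < l" using C \<eta> by (simp add: l_def)
  have lr: "l powr (p - r) * C = \<eta> / 2"
  proof -
    have "l powr (p - r) = inverse (2 * C / \<eta>)"
    proof -
      have "1 / (r - p) * (p - r) = - 1" using p by (simp add: field_simps)
      then show ?thesis using C \<eta> unfolding l_def powr_powr by (simp add: powr_minus)
    qed
    then show ?thesis using C \<eta> by (simp add: field_simps)
  qed
  define d where "d = \<eta> / (2 * l powr p)"
  have d: "0 < d" "l powr p * d = \<eta> / 2" using \<eta> l by (auto simp: d_def)
  show thesis
  proof (rule that[OF d(1)])
    fix S :: "'a set" and u A
    assume S: "S \<in> lmeasurable" "measure lebesgue S \<le> d" and u: "u \<in> H10 \<Omega>" and A: "0 < A" "h1sq \<Omega> u \<le> A"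
    have m: "u \<in> borel_measurable (lebesgue_on \<Omega>)" using L2D(1)[OF wgradD(1)[OF H10_H1[OF u]]] .
    note iS = indicator_lebesgue_on[OF \<Omega>' S(1)]
    \<comment> \<open>The splitting level scales like the norm, so that both parts are homogeneous of degree \<open>p\<close>.\<close>
    let ?l = "l * A powr (1 / 2)"
    have l': "0 < ?l" using l A by simp
    have pt: "indicator S x * \<bar>u x\<bar> powr p \<le> ?l powr p * indicator S x + ?l powr (p - r) * \<bar>u x\<bar> powr r" for x
      using abs_powr_split[OF l', of p r "u x"] p by (auto simp: indicator_def)
    have iR: "integrable (lebesgue_on \<Omega>) (\<lambda>x. ?l powr p * indicator S x + ?l powr (p - r) * \<bar>u x\<bar> powr r)"
      using iS C(2)[OF u A] by (intro Bochner_Integration.integrable_add integrable_mult_right)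
    have "integrable (lebesgue_on \<Omega>) (\<lambda>x. indicator S x * \<bar>u x\<bar> powr p)"
    proof (rule Bochner_Integration.integrable_bound[OF iR])
      show "(\<lambda>x. indicator S x * \<bar>u x\<bar> powr p) \<in> borel_measurable (lebesgue_on \<Omega>)"
        using m borel_measurable_integrable[OF iS(1)] by measurable
      show "AE x in lebesgue_on \<Omega>. norm (indicator S x * \<bar>u x\<bar> powr p) \<le> norm (?l powr p * indicator S x + ?l powr (p - r) * \<bar>u x\<bar> powr r)"
        using pt by (intro AE_I2) (auto simp: abs_of_nonneg)
    qed
    from integral_mono[OF this iR pt]
    have "(LINT x|lebesgue_on \<Omega>. indicator S x * \<bar>u x\<bar> powr p) \<le> ?l powr p * (LINT x|lebesgue_on \<Omega>. indicator S x) + ?l powr (p - r) * (LINT x|lebesgue_on \<Omega>. \<bar>u x\<bar> powr r)"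
      using iS C(2)[OF u A] by simp
    also have "\<dots> \<le> ?l powr p * d + ?l powr (p - r) * (C * A powr (r / 2))"
      using C(3)[OF u A] iS(2) S(2) by (intro add_mono mult_left_mono) auto
    also have "\<dots> = \<eta> * A powr (p / 2)"
    proof -
      have e1: "?l powr p * d = (l powr p * d) * A powr (p / 2)"
        using l A by (simp add: powr_mult powr_powr)
      have e2: "?l powr (p - r) * (C * A powr (r / 2)) = (l powr (p - r) * C) * (A powr ((p - r) / 2) * A powr (r / 2))"
        using l A by (simp add: powr_mult powr_powr)
      have e3: "A powr ((p - r) / 2) * A powr (r / 2) = A powr (p / 2)"
        by (simp add: diff_divide_distrib flip: powr_add)
      show ?thesis unfolding e1 e2 e3 lr d(2) by (simp add: algebra_simps)
    qed
    finally show "(LINT x|lebesgue_on \<Omega>. indicator S x * \<bar>u x\<bar> powr p) \<le> \<eta> * A powr (p / 2)" .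
  qed
qed

section \<open>Coercivity of the energy\<close>

lemma Linf_bound:
  assumes "f \<in> Linf \<Omega>" "Linf_nrm \<Omega> f \<le> ereal B"
  shows "f \<in> borel_measurable (lebesgue_on \<Omega>)" "AE x in lebesgue_on \<Omega>. \<bar>f x\<bar> \<le> B"
proof -
  show "f \<in> borel_measurable (lebesgue_on \<Omega>)" using assms(1) by (simp add: Linf_def)
  have "AE x in lebesgue_on \<Omega>. ereal \<bar>f x\<bar> \<le> Linf_nrm \<Omega> f"
    unfolding Linf_nrm_def by (rule esssup_AE)
  then show "AE x in lebesgue_on \<Omega>. \<bar>f x\<bar> \<le> B"
  proof eventually_elim
    case (elim x)
    then have "ereal \<bar>f x\<bar> \<le> ereal B" using assms(2) by (rule order_trans)
    then show ?case by simp
  qed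
qed

lemma Linf_bounded:
  assumes "f \<in> Linf \<Omega>"
  obtains B where "0 \<le> B" "AE x in lebesgue_on \<Omega>. \<bar>f x\<bar> \<le> B"
proof -
  have "Linf_nrm \<Omega> f < \<infinity>" using assms by (simp add: Linf_def)
  then obtain B where B: "Linf_nrm \<Omega> f \<le> ereal B" by (cases "Linf_nrm \<Omega> f") auto
  have "Linf_nrm \<Omega> f \<le> ereal (max B 0)" using B by (rule order_trans) simp
  from Linf_bound(2)[OF assms this] show thesis using that[of "max B 0"] by simp
qed

lemma form_integrable:
  assumes "W \<in> borel_measurable (lebesgue_on \<Omega>)" "AE x in lebesgue_on \<Omega>. \<bar>W x\<bar> \<le> B" "u \<in> H1 \<Omega>" "v \<in> H1 \<Omega>"
  shows "integrable (lebesgue_on \<Omega>) (\<lambda>x. W x * u x * v x)"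
    "integrable (lebesgue_on \<Omega>) (\<lambda>x. wgrad \<Omega> u x \<bullet> wgrad \<Omega> v x)"
proof -
  have "(\<lambda>x. W x * u x) \<in> L2 \<Omega>"
    using L2_bounded_scaleR[OF wgradD(1)[OF assms(3)] assms(1,2)] by simp
  then show "integrable (lebesgue_on \<Omega>) (\<lambda>x. W x * u x * v x)"
    using L2_product_integrable wgradD(1)[OF assms(4)] by blast
  show "integrable (lebesgue_on \<Omega>) (\<lambda>x. wgrad \<Omega> u x \<bullet> wgrad \<Omega> v x)"
    by (rule L2_mult_integrable[OF wgradD(2)[OF assms(3)] wgradD(2)[OF assms(4)]])
qed

text \<open>
  Write \<open>a\<close> for the bilinear form of the energy. Since \<open>0\<close> lies in the resolvent set, \<open>v\<close> is
  the image under the operator of some \<open>u\<close> with \<open>\<parallel>u\<parallel> \<le> C \<parallel>v\<parallel>\<close> in \<open>L\<^sup>2\<close>. Then \<open>\<parallel>v\<parallel>\<^sup>2 = a(u,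
  v)\<close>, which by the Cauchy-Schwarz inequality for the nonnegative form \<open>a\<close> is at most the
  square root of \<open>a(u, u) a(v, v)\<close>, and \<open>a(u, u) = (v, u) \<le> C \<parallel>v\<parallel>\<^sup>2\<close>. So \<open>\<parallel>v\<parallel>\<^sup>2 \<le> C a(v, v)\<close>.
\<close>

lemma energy_coercive:
  fixes \<Omega> :: "'a::euclidean_space set"
  assumes \<Omega>: "open \<Omega>" and V: "V \<in> Linf \<Omega>" "AE x in lebesgue_on \<Omega>. 0 \<le> V x" and sp: "spectrum \<Omega> V \<subseteq> {0<..}"
  obtains c where "0 < c" "\<And>u. u \<in> H10 \<Omega> \<Longrightarrow> c * h1sq \<Omega> u \<le> energy \<Omega> \<Omega> V u"
proof -
  obtain B where B: "AE x in lebesgue_on \<Omega>. \<bar>V x\<bar> \<le> B" using Linf_bounded[OF V(1)] by metis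
  have mV: "V \<in> borel_measurable (lebesgue_on \<Omega>)" using V(1) by (simp add: Linf_def)
  have "0 \<in> resolvent_set \<Omega> V" using sp by (auto simp: spectrum_def)
  then obtain C0 where ex: "\<And>f. f \<in> L2 \<Omega> \<Longrightarrow> \<exists>u. schroedinger_graph \<Omega> V u f"
    and C0: "\<And>f u. f \<in> L2 \<Omega> \<Longrightarrow> schroedinger_graph \<Omega> V u f \<Longrightarrow> L2_nrm \<Omega> u \<le> C0 * L2_nrm \<Omega> f"
    by (auto simp: resolvent_set_def)
  \<comment> \<open>A positive constant is needed for the weights in Young's inequality.\<close>
  define C where "C = max C0 1"
  have C: "1 \<le> C" by (simp add: C_def)
  have poincare: "(LINT x|lebesgue_on \<Omega>. (v x)\<^sup>2) \<le> C * energy \<Omega> \<Omega> V v" if v: "v \<in> H10 \<Omega>" for v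
  proof -
    note hv = H10_H1[OF v]
    note wv = wgradD[OF hv]
    obtain u where u: "schroedinger_graph \<Omega> V u v" using ex[OF wv(1)] by blast
    then have u10: "u \<in> H10 \<Omega>" and
      ueq: "\<And>\<phi>. \<phi> \<in> H10 \<Omega> \<Longrightarrow> (LINT x|lebesgue_on \<Omega>. wgrad \<Omega> u x \<bullet> wgrad \<Omega> \<phi> x + V x * u x * \<phi> x) = (LINT x|lebesgue_on \<Omega>. v x * \<phi> x)"
      by (auto simp: schroedinger_graph_def)
    note hu = H10_H1[OF u10]
    note wu = wgradD[OF hu]
    let ?n = "LINT x|lebesgue_on \<Omega>. (v x)\<^sup>2" and ?m = "LINT x|lebesgue_on \<Omega>. (u x)\<^sup>2"
    have "L2_nrm \<Omega> u \<le> C * L2_nrm \<Omega> v"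
    proof -
      have "L2_nrm \<Omega> u \<le> C0 * L2_nrm \<Omega> v" using C0[OF wv(1) u] .
      also have "\<dots> \<le> C * L2_nrm \<Omega> v" by (intro mult_right_mono) (auto simp: C_def L2_nrm_def)
      finally show ?thesis .
    qed
    then have "(L2_nrm \<Omega> u)\<^sup>2 \<le> (C * L2_nrm \<Omega> v)\<^sup>2" by (intro power_mono) (auto simp: L2_nrm_def)
    then have m: "?m \<le> C\<^sup>2 * ?n" by (simp add: L2_nrm_def power_mult_distrib)
    note i = L2D(2)[OF wv(1), simplified] L2D(2)[OF wu(1), simplified] L2_product_integrable[OF wv(1) wu(1)]
    note fi = form_integrable[OF mV B]
    have Eu: "energy \<Omega> \<Omega> V u = (LINT x|lebesgue_on \<Omega>. v x * u x)"
      using ueq[OF u10] by (simp add: energy_def power2_norm_eq_inner power2_eq_square[of "u x" for x] power2_eq_square[of "v x" for x] mult.assoc)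
    have "(LINT x|lebesgue_on \<Omega>. v x * u x) \<le> (LINT x|lebesgue_on \<Omega>. C / 2 * (v x)\<^sup>2 + 1 / (2 * C) * (u x)\<^sup>2)"
    proof (rule integral_mono[OF i(3)])
      show "integrable (lebesgue_on \<Omega>) (\<lambda>x. C / 2 * (v x)\<^sup>2 + 1 / (2 * C) * (u x)\<^sup>2)"
        using i by (intro Bochner_Integration.integrable_add integrable_mult_right)
      fix x
      have "0 \<le> (C * v x - u x)\<^sup>2 / (2 * C)" using C by simp
      also have "\<dots> = C / 2 * (v x)\<^sup>2 + 1 / (2 * C) * (u x)\<^sup>2 - v x * u x"
        using C by (simp add: power2_diff power_mult_distrib field_simps power2_eq_square)
      finally show "v x * u x \<le> C / 2 * (v x)\<^sup>2 + 1 / (2 * C) * (u x)\<^sup>2" by simp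
    qed
    also have "\<dots> = C / 2 * ?n + 1 / (2 * C) * ?m"
      using i by simp
    also have "\<dots> \<le> C / 2 * ?n + 1 / (2 * C) * (C\<^sup>2 * ?n)"
      using m C by (intro add_left_mono mult_left_mono) auto
    also have "\<dots> = C * ?n" using C by (simp add: power2_eq_square)
    finally have Eule: "energy \<Omega> \<Omega> V u \<le> C * ?n" using Eu by simp
    have "?n = (LINT x|lebesgue_on \<Omega>. wgrad \<Omega> u x \<bullet> wgrad \<Omega> v x + V x * u x * v x)"
      using ueq[OF v] by (simp add: power2_eq_square)
    also have "\<dots> \<le> (LINT x|lebesgue_on \<Omega>. 1 / (2 * C) * ((norm (wgrad \<Omega> u x))\<^sup>2 + V x * (u x)\<^sup>2) + C / 2 * ((norm (wgrad \<Omega> v x))\<^sup>2 + V x * (v x)\<^sup>2))"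
    proof (rule integral_mono_AE)
      show "integrable (lebesgue_on \<Omega>) (\<lambda>x. wgrad \<Omega> u x \<bullet> wgrad \<Omega> v x + V x * u x * v x)"
        using fi[OF hu hv] by simp
      show "integrable (lebesgue_on \<Omega>) (\<lambda>x. 1 / (2 * C) * ((norm (wgrad \<Omega> u x))\<^sup>2 + V x * (u x)\<^sup>2) + C / 2 * ((norm (wgrad \<Omega> v x))\<^sup>2 + V x * (v x)\<^sup>2))"
        using fi[OF hu hu] fi[OF hv hv] by (simp add: power2_norm_eq_inner power2_eq_square[of "u x" for x] power2_eq_square[of "v x" for x] mult.assoc)
      show "AE x in lebesgue_on \<Omega>. wgrad \<Omega> u x \<bullet> wgrad \<Omega> v x + V x * u x * v x \<le>
          1 / (2 * C) * ((norm (wgrad \<Omega> u x))\<^sup>2 + V x * (u x)\<^sup>2) + C / 2 * ((norm (wgrad \<Omega> v x))\<^sup>2 + V x * (v x)\<^sup>2)"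
        using V(2)
      proof eventually_elim
        case (elim x)
        let ?a = "wgrad \<Omega> u x" and ?b = "wgrad \<Omega> v x"
        have "0 \<le> ((norm (?a - C *\<^sub>R ?b))\<^sup>2 + V x * (u x - C * v x)\<^sup>2) / (2 * C)" using C elim by simp
        also have "(norm (?a - C *\<^sub>R ?b))\<^sup>2 = (norm ?a)\<^sup>2 - 2 * C * (?a \<bullet> ?b) + C\<^sup>2 * (norm ?b)\<^sup>2"
          by (simp add: power2_norm_eq_inner inner_diff_left inner_diff_right inner_commute power2_eq_square[of C] algebra_simps)
        finally show ?case using C by (simp add: field_simps power2_eq_square)
      qed
    qed
    also have "\<dots> = 1 / (2 * C) * energy \<Omega> \<Omega> V u + C / 2 * energy \<Omega> \<Omega> V v"
      using fi[OF hu hu] fi[OF hv hv] by (simp add: energy_def power2_norm_eq_inner power2_eq_square[of "u x" for x] power2_eq_square[of "v x" for x] mult.assoc)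
    also have "\<dots> \<le> 1 / (2 * C) * (C * ?n) + C / 2 * energy \<Omega> \<Omega> V v"
      using Eule C by (intro add_right_mono mult_left_mono) auto
    also have "\<dots> = ?n / 2 + C / 2 * energy \<Omega> \<Omega> V v" using C by simp
    finally show ?thesis by simp
  qed
  show thesis
  proof (rule that[of "1 / (1 + C)"])
    show "0 < 1 / (1 + C)" using C by simp
    fix v assume v: "v \<in> H10 \<Omega>"
    note hv = H10_H1[OF v]
    note fi = form_integrable[OF mV B hv hv]
    have "(LINT x|lebesgue_on \<Omega>. (norm (wgrad \<Omega> v x))\<^sup>2) \<le> energy \<Omega> \<Omega> V v"
      unfolding energy_def
    proof (rule integral_mono_AE)
      show "AE x in lebesgue_on \<Omega>. (norm (wgrad \<Omega> v x))\<^sup>2 \<le> (norm (wgrad \<Omega> v x))\<^sup>2 + V x * (v x)\<^sup>2"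
        using V(2) by eventually_elim simp
    qed (use fi in \<open>simp_all add: power2_norm_eq_inner power2_eq_square[of "v x" for x] mult.assoc\<close>)
    then have "h1sq \<Omega> v \<le> energy \<Omega> \<Omega> V v + C * energy \<Omega> \<Omega> V v"
      using poincare[OF v] h1sq_integrable[OF hv] by (simp add: h1sq_def)
    then show "1 / (1 + C) * h1sq \<Omega> v \<le> energy \<Omega> \<Omega> V v"
      using C by (simp add: field_simps)
  qed
qed

section \<open>Weak solutions\<close>

lemma integrable_bounded_mult:
  fixes f b :: "'a \<Rightarrow> real"
  assumes "integrable M f" "b \<in> borel_measurable M" "AE x in M. \<bar>b x\<bar> \<le> c"
  shows "integrable M (\<lambda>x. b x * f x)"
proof (rule Bochner_Integration.integrable_bound)
  show "integrable M (\<lambda>x. c * f x)" using assms(1) by simp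
  show "(\<lambda>x. b x * f x) \<in> borel_measurable M" using assms by measurable
  show "AE x in M. norm (b x * f x) \<le> norm (c * f x)"
    using assms(3) by eventually_elim (auto simp: abs_mult intro!: mult_right_mono)
qed

lemma grad_power:
  assumes "smooth f"
  shows "grad (\<lambda>x. f x ^ Suc m) x = (real (Suc m) * f x ^ m) *\<^sub>R grad f x"
proof (rule grad_unique)
  have "((\<lambda>x. f x ^ Suc m) has_derivative (\<lambda>h. real (Suc m) * (grad f x \<bullet> h) * f x ^ (Suc m - 1))) (at x)"
    by (rule has_derivative_power[OF has_derivative_grad[OF smooth_differentiable[OF assms]]])
  then show "((\<lambda>x. f x ^ Suc m) has_derivative (\<bullet>) ((real (Suc m) * f x ^ m) *\<^sub>R grad f x)) (at x)"
    by (rule has_derivative_eq_rhs) (simp add: fun_eq_iff mult_ac)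
qed

lemma Ck_power: "Ck k f \<Longrightarrow> Ck k (\<lambda>x. f x ^ m)"
  by (induction m) (auto intro: Ck_const Ck_mult)

lemma abs_powr_mult_square: "\<bar>y\<bar> powr (p - 2) * y\<^sup>2 = \<bar>y::real\<bar> powr p"
  by (cases "y = 0") (auto simp: powr_diff powr_numeral)

text \<open>
  Test the equation with \<open>\<eta>\<^sup>2 u\<close> and use that \<open>|\<nabla>(\<eta> u)|\<^sup>2 = \<nabla>u \<bullet> \<nabla>(\<eta>\<^sup>2 u) + |\<nabla>\<eta>|\<^sup>2 u\<^sup>2\<close>: the
  mixed terms have disappeared.
\<close>

lemma weak_solution_cutoff_identity:
  fixes \<Omega> :: "'a::euclidean_space set"
  assumes \<Omega>: "open \<Omega>" and sol: "weak_solution \<Omega> p W Q u"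
    and W: "W \<in> borel_measurable (lebesgue_on \<Omega>)" "AE x in lebesgue_on \<Omega>. \<bar>W x\<bar> \<le> B"
    and \<eta>: "smooth \<eta>" "\<And>x. \<bar>\<eta> x\<bar> \<le> 1" "\<And>x. norm (grad \<eta> x) \<le> L"
  shows "energy \<Omega> \<Omega> W (\<lambda>x. \<eta> x * u x) =
    (LINT x|lebesgue_on \<Omega>. (\<eta> x)\<^sup>2 * (Q x * \<bar>u x\<bar> powr p)) + (LINT x|lebesgue_on \<Omega>. (norm (grad \<eta> x))\<^sup>2 * (u x)\<^sup>2)"
proof -
  have u: "u \<in> H10 \<Omega>" using sol by (simp add: weak_solution_def)
  have L0: "0 \<le> L" using order_trans[OF norm_ge_zero \<eta>(3)] .
  note v = H10_smooth_mult[OF \<Omega> u \<eta>]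
  have \<eta>2: "smooth (\<lambda>x. \<eta> x ^ 2)" "\<bar>\<eta> x ^ 2\<bar> \<le> 1" "norm (grad (\<lambda>x. \<eta> x ^ 2) x) \<le> 2 * L"
    and g2: "grad (\<lambda>x. \<eta> x ^ 2) x = (2 * \<eta> x) *\<^sub>R grad \<eta> x" for x
  proof -
    show "smooth (\<lambda>x. \<eta> x ^ 2)" using \<eta>(1) Ck_power by blast
    show "\<bar>\<eta> x ^ 2\<bar> \<le> 1" using \<eta>(2)[of x] by (simp add: abs_square_le_1)
    show g: "grad (\<lambda>x. \<eta> x ^ 2) x = (2 * \<eta> x) *\<^sub>R grad \<eta> x"
      using grad_power[OF \<eta>(1), of 1 x] by (simp add: numeral_2_eq_2)
    have "\<bar>\<eta> x\<bar> * norm (grad \<eta> x) \<le> 1 * L" using \<eta>(2,3) L0 by (intro mult_mono) auto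
    then show "norm (grad (\<lambda>x. \<eta> x ^ 2) x) \<le> 2 * L" by (simp add: g abs_mult)
  qed
  note \<phi> = H10_smooth_mult[OF \<Omega> u \<eta>2]
  let ?v = "\<lambda>x. \<eta> x * u x" and ?\<phi> = "\<lambda>x. \<eta> x ^ 2 * u x"
  note i = form_integrable[OF W H10_H1[OF u] H10_H1[OF \<phi>(1)]]
  note iv = form_integrable[OF W H10_H1[OF v(1)] H10_H1[OF v(1)]]
  have mg: "grad \<eta> \<in> borel_measurable (lebesgue_on \<Omega>)"
    by (auto intro!: measurable_restrict_space1 measurable_completion borel_measurable_continuous_onI continuous_on_grad[OF \<eta>(1)])
  have ig: "integrable (lebesgue_on \<Omega>) (\<lambda>x. (norm (grad \<eta> x))\<^sup>2 * (u x)\<^sup>2)"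
  proof (rule integrable_bounded_mult[where c="L\<^sup>2"])
    show "integrable (lebesgue_on \<Omega>) (\<lambda>x. (u x)\<^sup>2)" using h1sq_integrable(2)[OF H10_H1[OF u]] .
    have "(norm (grad \<eta> x))\<^sup>2 \<le> L\<^sup>2" for x using \<eta>(3) by (intro power_mono) auto
    then show "AE x in lebesgue_on \<Omega>. \<bar>(norm (grad \<eta> x))\<^sup>2\<bar> \<le> L\<^sup>2" by simp
  qed (use mg in measurable)
  have "energy \<Omega> \<Omega> W ?v = (LINT x|lebesgue_on \<Omega>. (wgrad \<Omega> u x \<bullet> wgrad \<Omega> ?\<phi> x + W x * u x * ?\<phi> x) + (norm (grad \<eta> x))\<^sup>2 * (u x)\<^sup>2)"
    unfolding energy_def
  proof (rule integral_cong_AE)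
    show "(\<lambda>x. (norm (wgrad \<Omega> ?v x))\<^sup>2 + W x * (?v x)\<^sup>2) \<in> borel_measurable (lebesgue_on \<Omega>)"
      using iv[THEN borel_measurable_integrable] unfolding power2_norm_eq_inner power2_eq_square[of "?v x" for x] mult.assoc[symmetric]
      by (intro borel_measurable_add)
    show "(\<lambda>x. (wgrad \<Omega> u x \<bullet> wgrad \<Omega> ?\<phi> x + W x * u x * ?\<phi> x) + (norm (grad \<eta> x))\<^sup>2 * (u x)\<^sup>2) \<in> borel_measurable (lebesgue_on \<Omega>)"
      using i[THEN borel_measurable_integrable] ig[THEN borel_measurable_integrable] by (intro borel_measurable_add)
    show "AE x in lebesgue_on \<Omega>. (norm (wgrad \<Omega> ?v x))\<^sup>2 + W x * (?v x)\<^sup>2 =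
        (wgrad \<Omega> u x \<bullet> wgrad \<Omega> ?\<phi> x + W x * u x * ?\<phi> x) + (norm (grad \<eta> x))\<^sup>2 * (u x)\<^sup>2"
      using v(2) \<phi>(2)
    proof eventually_elim
      case (elim x)
      show ?case unfolding elim g2
        by (simp add: power2_norm_eq_inner inner_add_left inner_add_right inner_commute power2_eq_square[of "\<eta> x"] power2_eq_square[of "u x"] power_mult_distrib algebra_simps)
    qed
  qed
  also have "\<dots> = (LINT x|lebesgue_on \<Omega>. wgrad \<Omega> u x \<bullet> wgrad \<Omega> ?\<phi> x + W x * u x * ?\<phi> x) + (LINT x|lebesgue_on \<Omega>. (norm (grad \<eta> x))\<^sup>2 * (u x)\<^sup>2)"
    using i ig by (intro Bochner_Integration.integral_add Bochner_Integration.integrable_add)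
  also have "(LINT x|lebesgue_on \<Omega>. wgrad \<Omega> u x \<bullet> wgrad \<Omega> ?\<phi> x + W x * u x * ?\<phi> x) = (LINT x|lebesgue_on \<Omega>. Q x * \<bar>u x\<bar> powr (p - 2) * u x * ?\<phi> x)"
    using sol \<phi>(1) by (simp add: weak_solution_def)
  also have "\<dots> = (LINT x|lebesgue_on \<Omega>. (\<eta> x)\<^sup>2 * (Q x * \<bar>u x\<bar> powr p))"
  proof (rule Bochner_Integration.integral_cong)
    fix x
    show "Q x * \<bar>u x\<bar> powr (p - 2) * u x * ?\<phi> x = (\<eta> x)\<^sup>2 * (Q x * \<bar>u x\<bar> powr p)"
      by (subst abs_powr_mult_square[of "u x" p, symmetric]) (simp add: power2_eq_square mult_ac)
  qed simp
  finally show ?thesis .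
qed

lemma weak_solution_energy_eq:
  assumes "weak_solution \<Omega> p W Q u"
  shows "energy \<Omega> \<Omega> W u = Jfun \<Omega> p Q u"
proof -
  have "energy \<Omega> \<Omega> W u = (LINT x|lebesgue_on \<Omega>. wgrad \<Omega> u x \<bullet> wgrad \<Omega> u x + W x * u x * u x)"
    by (simp add: energy_def power2_norm_eq_inner power2_eq_square[of "u x" for x] mult.assoc)
  also have "\<dots> = (LINT x|lebesgue_on \<Omega>. Q x * \<bar>u x\<bar> powr (p - 2) * u x * u x)"
    using assms by (simp add: weak_solution_def)
  also have "\<dots> = Jfun \<Omega> p Q u"
  proof -
    have "Q x * \<bar>u x\<bar> powr (p - 2) * u x * u x = Q x * \<bar>u x\<bar> powr p" for x
      by (subst abs_powr_mult_square[of "u x" p, symmetric]) (simp add: power2_eq_square mult_ac)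
    then show ?thesis by (simp only: Jfun_def)
  qed
  finally show ?thesis .
qed

text \<open>
  By the Lindelof property, countably many of the open sets on which the function vanishes
  almost everywhere cover the complement of the support.
\<close>

lemma AE_zero_off_ess_supp:
  assumes "ess_supp \<Omega> f \<subseteq> T"
  shows "AE x in lebesgue_on \<Omega>. x \<notin> T \<longrightarrow> f x = 0"
proof -
  define \<U> where "\<U> = {U. open U \<and> (AE y in lebesgue_on \<Omega>. y \<in> U \<longrightarrow> f y = 0)}"
  obtain \<C> where \<C>: "\<C> \<subseteq> \<U>" "countable \<C>" "\<Union>\<C> = \<Union>\<U>"
    using Lindelof[of \<U>] by (auto simp: \<U>_def)
  have "AE y in lebesgue_on \<Omega>. \<forall>U\<in>\<C>. y \<in> U \<longrightarrow> f y = 0"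
    using \<C>(1) by (subst AE_ball_countable[OF \<C>(2)]) (auto simp: \<U>_def)
  moreover have "AE y in lebesgue_on \<Omega>. y \<in> space (lebesgue_on \<Omega>)" by (rule AE_space)
  ultimately show ?thesis
  proof eventually_elim
    case (elim x)
    show ?case
    proof
      assume "x \<notin> T"
      then have "x \<in> \<Union>\<U>"
        using assms elim(2) by (auto simp: ess_supp_def \<U>_def)
      then show "f x = 0" using elim(1) \<C>(3) by blast
    qed
  qed
qed

lemma small_balls:
  fixes a b :: "'a::euclidean_space"
  assumes "0 < d"
  obtains \<epsilon> where "0 < \<epsilon>" "ball a \<epsilon> \<union> ball b \<epsilon> \<in> lmeasurable" "measure lebesgue (ball a \<epsilon> \<union> ball b \<epsilon>) \<le> d"
proof -
  define \<omega> where "\<omega> = unit_ball_vol (real DIM('a))"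
  have \<omega>: "0 < \<omega>" by (simp add: \<omega>_def)
  define \<epsilon> where "\<epsilon> = min 1 (d / (2 * \<omega>))"
  have \<epsilon>: "0 < \<epsilon>" "\<epsilon> \<le> 1" "\<omega> * \<epsilon> \<le> d / 2"
    using assms \<omega> by (auto simp: \<epsilon>_def min_def field_simps)
  have m: "measure lebesgue (ball c \<epsilon>) \<le> d / 2" for c :: 'a
  proof -
    have "\<epsilon> ^ DIM('a) \<le> \<epsilon> ^ 1" using \<epsilon> DIM_positive[where 'a='a] by (intro power_decreasing) auto
    then have "\<omega> * \<epsilon> ^ DIM('a) \<le> d / 2" using \<epsilon> \<omega> by (metis mult_left_mono less_imp_le order_trans power_one_right)
    then show ?thesis using \<epsilon> content_ball[of \<epsilon> c] by (simp add: \<omega>_def)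
  qed
  have "measure lebesgue (ball a \<epsilon> \<union> ball b \<epsilon>) \<le> measure lebesgue (ball a \<epsilon>) + measure lebesgue (ball b \<epsilon>)"
    by (rule measure_Un_le) auto
  also have "\<dots> \<le> d" using m[of a] m[of b] by simp
  finally show thesis using that[OF \<epsilon>(1)] by (simp add: fmeasurable.Un)
qed

lemma lebesgue_on_subset_integral:
  fixes f :: "'a::euclidean_space \<Rightarrow> real"
  assumes "open \<Omega>" "B \<in> sets borel"
  shows "(LINT x|lebesgue_on (\<Omega> - B). f x) = (LINT x|lebesgue_on \<Omega>. indicator (- B) x * f x)"
proof -
  have s: "\<Omega> \<in> sets lebesgue" "\<Omega> - B \<in> sets lebesgue" using assms by auto
  have "(\<lambda>x. indicator (\<Omega> - B) x *\<^sub>R f x) = (\<lambda>x. indicator \<Omega> x *\<^sub>R (indicator (- B) x * f x))"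
    by (auto simp: indicator_def)
  then show ?thesis using s by (simp add: integral_restrict_space)
qed

lemma condition_A3_commute: "condition_A3 \<Omega> x1 x2 V K \<Longrightarrow> condition_A3 \<Omega> x2 x1 V K"
  by (simp add: condition_A3_def Un_commute)

lemma condition_A4_commute: "condition_A4 \<Omega> x1 x2 Q \<Longrightarrow> condition_A4 \<Omega> x2 x1 Q"
  by (simp add: condition_A4_def Un_commute insert_commute)

section \<open>Concentration of ground states\<close>

text \<open>
  The Landau symbol \<open>O(1)\<close>. Finitely many indices, where the hypotheses give nothing, are
  disregarded.
\<close>

definition ev_bounded :: "(nat \<Rightarrow> real) \<Rightarrow> bool" where
  "ev_bounded f \<longleftrightarrow> (\<exists>G. \<forall>\<^sub>F n in sequentially. \<bar>f n\<bar> \<le> G)"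

lemma ev_boundedI: "\<forall>\<^sub>F n in sequentially. \<bar>f n\<bar> \<le> G \<Longrightarrow> ev_bounded f"
  by (auto simp: ev_bounded_def)

lemma ev_boundedE:
  assumes "ev_bounded f"
  obtains G where "0 < G" "\<forall>\<^sub>F n in sequentially. \<bar>f n\<bar> \<le> G"
proof -
  obtain G where G: "\<forall>\<^sub>F n in sequentially. \<bar>f n\<bar> \<le> G" using assms by (auto simp: ev_bounded_def)
  have "\<forall>\<^sub>F n in sequentially. \<bar>f n\<bar> \<le> max G 1" using G by eventually_elim simp
  then show thesis using that[of "max G 1"] by simp
qed

lemma ev_bounded_mono:
  assumes "ev_bounded g" "\<forall>\<^sub>F n in sequentially. \<bar>f n\<bar> \<le> g n"
  shows "ev_bounded f"
proof -
  obtain G where "\<forall>\<^sub>F n in sequentially. \<bar>g n\<bar> \<le> G" using assms(1) by (auto simp: ev_bounded_def)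
  with assms(2) have "\<forall>\<^sub>F n in sequentially. \<bar>f n\<bar> \<le> G" by eventually_elim linarith
  then show ?thesis by (rule ev_boundedI)
qed

lemma ev_bounded_add:
  assumes "ev_bounded f" "ev_bounded g"
  shows "ev_bounded (\<lambda>n. f n + g n)"
proof -
  obtain F G where "\<forall>\<^sub>F n in sequentially. \<bar>f n\<bar> \<le> F" "\<forall>\<^sub>F n in sequentially. \<bar>g n\<bar> \<le> G"
    using assms by (auto simp: ev_bounded_def)
  then have "\<forall>\<^sub>F n in sequentially. \<bar>f n + g n\<bar> \<le> F + G" by eventually_elim linarith
  then show ?thesis by (rule ev_boundedI)
qed

lemma ev_bounded_cmult: "ev_bounded f \<Longrightarrow> ev_bounded (\<lambda>n. c * f n)"
proof -
  assume "ev_bounded f"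
  then obtain G where "\<forall>\<^sub>F n in sequentially. \<bar>f n\<bar> \<le> G" by (auto simp: ev_bounded_def)
  then have "\<forall>\<^sub>F n in sequentially. \<bar>c * f n\<bar> \<le> \<bar>c\<bar> * G"
    by eventually_elim (simp add: abs_mult mult_left_mono)
  then show ?thesis by (rule ev_boundedI)
qed

lemma ev_bounded_diff: "ev_bounded f \<Longrightarrow> ev_bounded g \<Longrightarrow> ev_bounded (\<lambda>n. f n - g n)"
  using ev_bounded_add[of f "\<lambda>n. (-1) * g n"] ev_bounded_cmult[of g "-1"] by simp

lemma ev_bounded_div_at_top:
  assumes "ev_bounded f" "filterlim E at_top sequentially"
  shows "(\<lambda>n. f n / E n) \<longlonglongrightarrow> 0"
proof -
  obtain G where G: "\<forall>\<^sub>F n in sequentially. \<bar>f n\<bar> \<le> G" using assms(1) by (auto simp: ev_bounded_def)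
  have E: "\<forall>\<^sub>F n in sequentially. 0 < E n" using assms(2) by (simp add: filterlim_at_top_dense)
  have "(\<lambda>n. G / E n) \<longlonglongrightarrow> 0"
    by (intro real_tendsto_divide_at_top[OF tendsto_const assms(2)])
  moreover have "\<forall>\<^sub>F n in sequentially. norm (f n / E n) \<le> G / E n"
    using G E by eventually_elim (simp add: divide_right_mono)
  ultimately show ?thesis by (rule Lim_null_comparison[rotated])
qed

lemma ev_bounded_cong:
  assumes "ev_bounded f" "\<forall>\<^sub>F n in sequentially. f n = g n"
  shows "ev_bounded g"
proof -
  obtain G where "\<forall>\<^sub>F n in sequentially. \<bar>f n\<bar> \<le> G" using assms(1) by (auto simp: ev_bounded_def)
  with assms(2) have "\<forall>\<^sub>F n in sequentially. \<bar>g n\<bar> \<le> G" by eventually_elim simp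
  then show ?thesis by (rule ev_boundedI)
qed

text \<open>
  If \<open>e / E\<close> is small, then \<open>E (e / E) powr q = e (e / E) powr (q - 1)\<close> is at most half of \<open>e\<close>
  and can be absorbed.
\<close>

lemma ev_bounded_of_superlinear:
  assumes e: "\<forall>\<^sub>F n in sequentially. 0 \<le> e n" and E: "\<forall>\<^sub>F n in sequentially. 0 < E n"
    and lim: "(\<lambda>n. e n / E n) \<longlonglongrightarrow> 0" and q: "1 < q"
    and le: "\<forall>\<^sub>F n in sequentially. e n \<le> E n * (e n / E n) powr q + G"
  shows "ev_bounded e"
proof -
  define t where "t = (1 / 2 :: real) powr (1 / (q - 1))"
  have t: "0 < t" "t powr (q - 1) = 1 / 2" using q by (auto simp: t_def powr_powr)
  have "\<forall>\<^sub>F n in sequentially. e n / E n < t" using lim t(1) by (rule order_tendstoD)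
  with e E le have "\<forall>\<^sub>F n in sequentially. \<bar>e n\<bar> \<le> 2 * G"
  proof eventually_elim
    case (elim n)
    define z where "z = e n / E n"
    have z: "0 \<le> z" "z \<le> t" "e n = E n * z" using elim by (auto simp: z_def)
    have "z powr q = z * z powr (q - 1)"
      using z(1) q by (cases "z = 0") (auto simp: powr_diff)
    also have "\<dots> \<le> z * (1 / 2)"
      unfolding t(2)[symmetric] using z q by (intro mult_left_mono powr_mono2) auto
    finally have "E n * z powr q \<le> E n * (z * (1 / 2))" using elim(2) by (intro mult_left_mono) auto
    also have "\<dots> = e n / 2" using z(3) by simp
    finally have "E n * z powr q \<le> e n / 2" .
    then show ?case using elim(1,3) by (simp add: z_def)
  qed
  then show ?thesis by (rule ev_boundedI)
qed

text \<open>
  The loss of two powers of the cutoff \<open>e\<close> in the gradient term is compensated when the power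
  is so high that \<open>e ^ (2 * k) * y\<^sup>2\<close> is at most the square of the \<open>p\<close>-th root of \<open>(e ^ Suc
  k)\<^sup>2 * |y| powr p\<close>.
\<close>

lemma cutoff_young:
  assumes e: "0 \<le> e" "e \<le> 1" and p: "2 < (p::real)" and k: "1 \<le> k" "p \<le> real (Suc k) * (p - 2)" and l: "0 < l"
  shows "e ^ (2 * k) * y\<^sup>2 \<le> l powr 2 + l powr (2 - p) * ((e ^ Suc k)\<^sup>2 * \<bar>y\<bar> powr p)"
proof (cases "e = 0")
  case True
  then show ?thesis using k(1) by (simp add: power_0_left)
next
  case False
  then have e0: "0 < e" using e by simp
  define s where "s = 2 * real (Suc k) / p"
  have s: "2 * s \<le> real (2 * k)" "s * p = real (2 * Suc k)"
    using k(2) p by (auto simp: s_def field_simps)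
  define z where "z = e powr s * \<bar>y\<bar>"
  have z0: "0 \<le> z" by (simp add: z_def)
  have "e ^ (2 * k) = e powr real (2 * k)" by (rule powr_realpow[OF e0, symmetric])
  also have "\<dots> \<le> e powr (2 * s)" using e0 e(2) s(1) by (intro powr_mono') auto
  finally have "e ^ (2 * k) * y\<^sup>2 \<le> e powr (2 * s) * y\<^sup>2" by (rule mult_right_mono) simp
  also have "e powr (2 * s) = (e powr s)\<^sup>2"
    unfolding power2_eq_square powr_add[symmetric] by simp
  also have "(e powr s)\<^sup>2 * y\<^sup>2 = \<bar>z\<bar> powr 2"
    using z0 by (simp add: z_def power_mult_distrib powr_numeral)
  also have "\<bar>z\<bar> powr 2 \<le> l powr 2 + l powr (2 - p) * \<bar>z\<bar> powr p"
    using abs_powr_split[OF l, of 2 p z] p by simp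
  also have "\<bar>z\<bar> powr p = e powr (s * p) * \<bar>y\<bar> powr p"
    using z0 e0 by (simp add: z_def powr_mult powr_powr)
  also have "e powr (s * p) = (e ^ Suc k)\<^sup>2"
    unfolding s(2) power_mult[symmetric] using e0 by (subst powr_realpow) (auto simp: mult.commute)
  finally show ?thesis .
qed

lemma grad_eq_0_on_open:
  assumes "open U" "x \<in> U" "\<And>y. y \<in> U \<Longrightarrow> f y = c"
  shows "grad f x = 0"
proof (rule grad_unique)
  have "((\<lambda>x. c) has_derivative (\<lambda>h. 0 \<bullet> h)) (at x)" by simp
  then show "(f has_derivative (\<lambda>h. 0 \<bullet> h)) (at x)"
    by (rule has_derivative_transform_within_open[OF _ assms(1,2)]) (simp add: assms(3))
qed

text \<open>
  The hypotheses on the data are symmetric in the two points (\<open>swap\<close>) and inherited by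
  subsequences (\<open>subsequence\<close>), so that concentration need only be studied at \<open>x1\<close> and for the
  whole sequence.
\<close>

locale concentrating_ground_states =
  fixes \<Omega> :: "'a::euclidean_space set" and x1 x2 :: 'a and p :: real
    and V :: "'a \<Rightarrow> real" and K W Q u :: "nat \<Rightarrow> 'a \<Rightarrow> real"
  assumes open_\<Omega>: "open \<Omega>" and distinct: "x1 \<noteq> x2"
    and p2: "2 < p" and subcritical: "ereal p < crit_exponent DIM('a)"
    and W_eq: "\<And>n x. W n x = V x + K n x"
    and A3: "condition_A3 \<Omega> x1 x2 V K"
    and A4: "condition_A4 \<Omega> x1 x2 Q"
    and ground: "\<forall>\<^sub>F n in sequentially. ground_state \<Omega> p (W n) (Q n) (u n)"
begin

abbreviation M where "M \<equiv> lebesgue_on \<Omega>"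

definition S where "S \<epsilon> = ball x1 \<epsilon> \<union> ball x2 \<epsilon>"

definition E where "E n = energy \<Omega> \<Omega> (W n) (u n)"

abbreviation dens where "dens n x \<equiv> (norm (wgrad \<Omega> (u n) x))\<^sup>2 + \<bar>W n x\<bar> * (u n x)\<^sup>2"

abbreviation pot where "pot n x \<equiv> \<bar>Q n x\<bar> * \<bar>u n x\<bar> powr p"

abbreviation cut_energy where "cut_energy \<eta> n \<equiv> energy \<Omega> \<Omega> (W n) (\<lambda>x. \<eta> x * u n x)"

subsection \<open>Uniform bounds on the data, and divergence of the energy\<close>

lemma S_sets [measurable, simp]: "S \<epsilon> \<in> sets borel" "S \<epsilon> \<in> sets lebesgue"
  by (auto simp: S_def)

lemma indicator_measurable [measurable]:
  "A \<in> sets borel \<Longrightarrow> (indicator A :: 'a \<Rightarrow> real) \<in> borel_measurable M"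
  by (rule measurable_restrict_space1) (auto intro: measurable_completion)

lemma integrable_indicator_mult:
  fixes f :: "'a \<Rightarrow> real"
  assumes "integrable M f" "A \<in> sets borel"
  shows "integrable M (\<lambda>x. indicator A x * f x)"
  by (rule integrable_bounded_mult[OF assms(1) indicator_measurable[OF assms(2)], where c=1])
     (simp add: indicator_def)

lemma swap: "concentrating_ground_states \<Omega> x2 x1 p V K W Q u"
  using open_\<Omega> distinct p2 subcritical W_eq A3 A4 ground
  by (simp add: concentrating_ground_states_def condition_A3_commute condition_A4_commute)

lemma W_bounded:
  obtains B where "0 \<le> B" "\<And>n. W n \<in> borel_measurable M" "\<And>n. AE x in M. \<bar>W n x\<bar> \<le> B"
proof -
  have V: "V \<in> Linf \<Omega>" and K: "\<And>n. K n \<in> Linf \<Omega>" using A3 by (auto simp: condition_A3_def)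
  obtain B1 where B1: "0 \<le> B1" "AE x in M. \<bar>V x\<bar> \<le> B1" using Linf_bounded[OF V] by metis
  obtain B2 where B2: "\<And>n. Linf_nrm \<Omega> (K n) \<le> ereal B2" using A3 by (auto simp: condition_A3_def)
  note b = Linf_bound[OF K B2]
  have Wf: "W n = (\<lambda>x. V x + K n x)" for n using W_eq by auto
  have m: "W n \<in> borel_measurable M" for n
    unfolding Wf using V b(1) by (auto simp: Linf_def)
  have "AE x in M. \<bar>W n x\<bar> \<le> B1 + \<bar>B2\<bar>" for n
    using B1(2) b(2)[of n] by eventually_elim (simp add: W_eq)
  then show thesis using that[of "B1 + \<bar>B2\<bar>"] m B1(1) by simp
qed

lemma Q_bounded:
  obtains C where "0 < C" "\<And>n. Q n \<in> borel_measurable M" "\<And>n. AE x in M. \<bar>Q n x\<bar> \<le> C"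
proof -
  have Q: "\<And>n. Q n \<in> Linf \<Omega>" using A4 by (auto simp: condition_A4_def)
  obtain C where C: "\<And>n. Linf_nrm \<Omega> (Q n) \<le> ereal C" using A4 by (auto simp: condition_A4_def)
  note b = Linf_bound[OF Q C]
  have "AE x in M. \<bar>Q n x\<bar> \<le> \<bar>C\<bar> + 1" for n using b(2)[of n] by eventually_elim simp
  then show thesis using that[of "\<bar>C\<bar> + 1"] b(1) by simp
qed

lemma K_zero_off: "0 < \<epsilon> \<Longrightarrow> \<forall>\<^sub>F n in sequentially. AE x in M. x \<notin> S \<epsilon> \<longrightarrow> K n x = 0"
proof -
  assume "0 < \<epsilon>"
  then obtain N where "\<And>n. N \<le> n \<Longrightarrow> ess_supp \<Omega> (K n) \<subseteq> S \<epsilon>"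
    using A3 unfolding condition_A3_def S_def by meson
  then show ?thesis unfolding eventually_sequentially using AE_zero_off_ess_supp by blast
qed

lemma V_nonneg: "AE x in M. 0 \<le> V x"
  using A3 by (simp add: condition_A3_def)

lemma W_nonneg_off:
  assumes "0 < \<epsilon>"
  shows "\<forall>\<^sub>F n in sequentially. AE x in M. x \<notin> S \<epsilon> \<longrightarrow> 0 \<le> W n x"
  using K_zero_off[OF assms]
proof eventually_elim
  case (elim n)
  with V_nonneg show ?case by eventually_elim (simp add: W_eq)
qed

lemma Q_neg_off:
  assumes "0 < \<epsilon>"
  obtains \<delta> where "0 < \<delta>" "\<forall>\<^sub>F n in sequentially. AE x in M. x \<notin> S \<epsilon> \<longrightarrow> Q n x \<le> - \<delta>"
proof -
  obtain \<delta> N where "0 < \<delta>" "\<And>n. N \<le> n \<Longrightarrow> AE x in M. x \<notin> S \<epsilon> \<longrightarrow> Q n x \<le> - \<delta>"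
    using A4 assms unfolding condition_A4_def S_def by meson
  then show thesis using that[of \<delta>] by (auto simp: eventually_sequentially)
qed

lemma embedding: "sobolev_embedding TYPE('a) p"
  using sobolev_embedding_subcritical[OF _ subcritical] p2 by simp

lemma powr_integrable:
  assumes "v \<in> H10 \<Omega>"
  shows "integrable M (\<lambda>x. \<bar>v x\<bar> powr p)"
proof -
  have p: "0 < p" using p2 by simp
  have A: "0 < h1sq \<Omega> v + 1" "h1sq \<Omega> v \<le> h1sq \<Omega> v + 1" using h1sq_nonneg[of \<Omega> v] by auto
  obtain C where "\<And>u A. u \<in> H10 \<Omega> \<Longrightarrow> 0 < A \<Longrightarrow> h1sq \<Omega> u \<le> A \<Longrightarrow> integrable M (\<lambda>x. \<bar>u x\<bar> powr p)"
    by (rule H10_sobolev[OF open_\<Omega> embedding p]) (rule that)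
  from this[OF assms A] show ?thesis .
qed

text \<open>
  The perturbation \<open>K n\<close> lives in small balls, where the square integral is a small part of
  the Sobolev norm.
\<close>

lemma coercive:
  obtains c where "0 < c" "\<forall>\<^sub>F n in sequentially. \<forall>v\<in>H10 \<Omega>. c * h1sq \<Omega> v \<le> energy \<Omega> \<Omega> (W n) v"
proof -
  have V: "V \<in> Linf \<Omega>" "spectrum \<Omega> V \<subseteq> {0<..}" and K: "\<And>n. K n \<in> Linf \<Omega>"
    using A3 by (auto simp: condition_A3_def)
  obtain B where B: "\<And>n. Linf_nrm \<Omega> (K n) \<le> ereal B" using A3 by (auto simp: condition_A3_def)
  note Kb = Linf_bound[OF K B]
  obtain BV where BV: "AE x in M. \<bar>V x\<bar> \<le> BV" using Linf_bounded[OF V(1)] by metis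
  have mV: "V \<in> borel_measurable M" using V by (simp add: Linf_def)
  define B' where "B' = max B 1"
  have B': "0 < B'" by (simp add: B'_def)
  obtain c where c: "0 < c" "\<And>v. v \<in> H10 \<Omega> \<Longrightarrow> c * h1sq \<Omega> v \<le> energy \<Omega> \<Omega> V v"
    by (rule energy_coercive[OF open_\<Omega> V(1) V_nonneg V(2)]) (rule that)
  have \<eta>: "0 < c / (2 * B')" using c B' by simp
  have p20: "0 < (2::real)" by simp
  obtain d where d: "0 < d" "\<And>T u A. T \<in> lmeasurable \<Longrightarrow> measure lebesgue T \<le> d \<Longrightarrow> u \<in> H10 \<Omega> \<Longrightarrow> 0 < A \<Longrightarrow> h1sq \<Omega> u \<le> A \<Longrightarrow>
    (LINT x|M. indicator T x * \<bar>u x\<bar> powr 2) \<le> c / (2 * B') * A powr (2 / 2)"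
    by (rule H10_small_set[OF open_\<Omega> embedding p20 p2 \<eta>]) (rule that)
  obtain \<epsilon> where \<epsilon>: "0 < \<epsilon>" "S \<epsilon> \<in> lmeasurable" "measure lebesgue (S \<epsilon>) \<le> d"
    by (rule small_balls[OF d(1), of x1 x2, folded S_def]) (rule that)
  have small: "(LINT x|M. indicator (S \<epsilon>) x * (v x)\<^sup>2) \<le> c / (2 * B') * h1sq \<Omega> v" if v: "v \<in> H10 \<Omega>" for v
  proof -
    have le: "(LINT x|M. indicator (S \<epsilon>) x * (v x)\<^sup>2) \<le> c / (2 * B') * A" if "0 < A" "h1sq \<Omega> v \<le> A" for A
      using d(2)[OF \<epsilon>(2,3) v that] that by (simp add: powr_numeral)
    show ?thesis
    proof (cases "h1sq \<Omega> v = 0")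
      case False
      then show ?thesis using le[of "h1sq \<Omega> v"] h1sq_nonneg[of \<Omega> v] by simp
    next
      case True
      have "(LINT x|M. indicator (S \<epsilon>) x * (v x)\<^sup>2) \<le> 0 + e" if "0 < e" for e
        using le[of "e / (c / (2 * B'))"] True \<eta> that c B' by simp
      then show ?thesis using field_le_epsilon[of _ "0::real"] True by simp
    qed
  qed
  have "\<forall>\<^sub>F n in sequentially. \<forall>v\<in>H10 \<Omega>. c / 2 * h1sq \<Omega> v \<le> energy \<Omega> \<Omega> (W n) v"
    using K_zero_off[OF \<epsilon>(1)]
  proof eventually_elim
    case (elim n)
    show ?case
    proof
      fix v assume v: "v \<in> H10 \<Omega>"
      note hv = H10_H1[OF v]
      have iv: "integrable M (\<lambda>x. (v x)\<^sup>2)" "integrable M (\<lambda>x. (norm (wgrad \<Omega> v x))\<^sup>2)"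
        using h1sq_integrable[OF hv] by auto
      have iVv: "integrable M (\<lambda>x. V x * (v x)\<^sup>2)" "integrable M (\<lambda>x. K n x * (v x)\<^sup>2)"
        by (rule integrable_bounded_mult[OF iv(1) mV BV], rule integrable_bounded_mult[OF iv(1) Kb])
      have iS: "integrable M (\<lambda>x. indicator (S \<epsilon>) x * (v x)\<^sup>2)"
        by (rule integrable_indicator_mult[OF iv(1)]) simp
      have "energy \<Omega> \<Omega> (W n) v = energy \<Omega> \<Omega> V v + (LINT x|M. K n x * (v x)\<^sup>2)"
        unfolding energy_def W_eq using iv iVv
        by (subst Bochner_Integration.integral_add[symmetric]) (auto simp: algebra_simps)
      moreover have "- B' * (LINT x|M. indicator (S \<epsilon>) x * (v x)\<^sup>2) \<le> (LINT x|M. K n x * (v x)\<^sup>2)"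
      proof -
        have "(LINT x|M. - B' * (indicator (S \<epsilon>) x * (v x)\<^sup>2)) \<le> (LINT x|M. K n x * (v x)\<^sup>2)"
        proof (rule integral_mono_AE)
          show "AE x in M. - B' * (indicator (S \<epsilon>) x * (v x)\<^sup>2) \<le> K n x * (v x)\<^sup>2"
            using elim Kb(2)[of n]
          proof eventually_elim
            case (elim x)
            show ?case
            proof (cases "x \<in> S \<epsilon>")
              case True
              have "- B' \<le> K n x" using elim(2) by (simp add: B'_def)
              then have "- B' * (v x)\<^sup>2 \<le> K n x * (v x)\<^sup>2" by (rule mult_right_mono) simp
              with True show ?thesis by simp
            qed (use elim in simp)
          qed
        qed (use iS iVv in auto)
        then show ?thesis by simp
      qed
      moreover have "B' * (LINT x|M. indicator (S \<epsilon>) x * (v x)\<^sup>2) \<le> B' * (c / (2 * B') * h1sq \<Omega> v)"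
        using small[OF v] B' by (intro mult_left_mono) auto
      moreover have "B' * (c / (2 * B') * h1sq \<Omega> v) = c / 2 * h1sq \<Omega> v" using B' by simp
      ultimately show "c / 2 * h1sq \<Omega> v \<le> energy \<Omega> \<Omega> (W n) v" using c(2)[OF v] by simp
    qed
  qed
  then show thesis using that[of "c / 2"] c(1) by simp
qed

lemma ground_facts:
  "\<forall>\<^sub>F n in sequentially. weak_solution \<Omega> p (W n) (Q n) (u n) \<and> u n \<in> H10 \<Omega> \<and> 0 < E n \<and> Jfun \<Omega> p (Q n) (u n) = E n"
  using ground
proof eventually_elim
  case (elim n)
  then show ?case
    using weak_solution_energy_eq[of \<Omega> p "W n" "Q n" "u n"]
    by (auto simp: ground_state_def E_def weak_solution_def)
qed

lemma Q_powr_integrable: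
  assumes "v \<in> H10 \<Omega>"
  shows "integrable M (\<lambda>x. Q n x * \<bar>v x\<bar> powr p)" "integrable M (\<lambda>x. \<bar>Q n x\<bar> * \<bar>v x\<bar> powr p)"
proof -
  obtain C where C: "0 < C" "\<And>n. Q n \<in> borel_measurable M" "\<And>n. AE x in M. \<bar>Q n x\<bar> \<le> C"
    by (rule Q_bounded) (rule that)
  show "integrable M (\<lambda>x. Q n x * \<bar>v x\<bar> powr p)"
    by (rule integrable_bounded_mult[OF powr_integrable[OF assms] C(2,3)])
  show "integrable M (\<lambda>x. \<bar>Q n x\<bar> * \<bar>v x\<bar> powr p)"
    by (rule integrable_bounded_mult[OF powr_integrable[OF assms], where c=C]) (use C in auto)
qed

text \<open>
  As \<open>Q n \<le> 0\<close> off small balls, \<open>E n = J(u n)\<close> is at most \<open>C\<close> times the \<open>p\<close>-th power integral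
  over these balls, hence at most \<open>\<eta> C (E n / c) powr (p / 2)\<close> with \<open>\<eta>\<close> as small as desired.
  Since \<open>p / 2 > 1\<close>, this is a lower bound for \<open>E n\<close>.
\<close>

lemma E_at_top: "filterlim E at_top sequentially"
proof -
  obtain C where C: "0 < C" "\<And>n. Q n \<in> borel_measurable M" "\<And>n. AE x in M. \<bar>Q n x\<bar> \<le> C"
    by (rule Q_bounded) (rule that)
  obtain c where c: "0 < c" "\<forall>\<^sub>F n in sequentially. \<forall>v\<in>H10 \<Omega>. c * h1sq \<Omega> v \<le> energy \<Omega> \<Omega> (W n) v"
    by (rule coercive) (rule that)
  have "\<exists>r. p < r \<and> ereal r < crit_exponent DIM('a)"
    using ereal_dense2[OF subcritical] by auto
  then obtain r where r: "p < r" "ereal r < crit_exponent DIM('a)" by blast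
  have Sr: "sobolev_embedding TYPE('a) r"
    using sobolev_embedding_subcritical[OF _ r(2)] p2 r(1) by simp
  have p0: "0 < p" using p2 by simp
  have "\<forall>\<^sub>F n in sequentially. R \<le> E n" if R: "0 < R" for R
  proof -
    \<comment> \<open>This value turns the resulting inequality into \<open>R powr (p / 2 - 1) \<le> E n powr (p / 2 - 1)\<close>.\<close>
    define \<eta> where "\<eta> = c powr (p / 2) / (C * R powr (p / 2 - 1))"
    have \<eta>: "0 < \<eta>" using c C R by (simp add: \<eta>_def)
    obtain d where d: "0 < d" "\<And>T u A. T \<in> lmeasurable \<Longrightarrow> measure lebesgue T \<le> d \<Longrightarrow> u \<in> H10 \<Omega> \<Longrightarrow> 0 < A \<Longrightarrow> h1sq \<Omega> u \<le> A \<Longrightarrow>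
      (LINT x|M. indicator T x * \<bar>u x\<bar> powr p) \<le> \<eta> * A powr (p / 2)"
      by (rule H10_small_set[OF open_\<Omega> Sr p0 r(1) \<eta>]) (rule that)
    obtain \<epsilon> where \<epsilon>: "0 < \<epsilon>" "S \<epsilon> \<in> lmeasurable" "measure lebesgue (S \<epsilon>) \<le> d"
      by (rule small_balls[OF d(1), of x1 x2, folded S_def]) (rule that)
    obtain \<delta> where \<delta>: "0 < \<delta>" "\<forall>\<^sub>F n in sequentially. AE x in M. x \<notin> S \<epsilon> \<longrightarrow> Q n x \<le> - \<delta>"
      by (rule Q_neg_off[OF \<epsilon>(1)]) (rule that)
    show ?thesis
      using ground_facts c(2) \<delta>(2)
    proof eventually_elim
      case (elim n)
      have u: "u n \<in> H10 \<Omega>" and E: "0 < E n" "Jfun \<Omega> p (Q n) (u n) = E n" using elim(1) by auto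
      have h: "h1sq \<Omega> (u n) \<le> E n / c"
        using elim(2) u c(1) by (simp add: E_def field_simps)
      have iS: "integrable M (\<lambda>x. indicator (S \<epsilon>) x * \<bar>u n x\<bar> powr p)"
        by (rule integrable_indicator_mult[OF powr_integrable[OF u]]) simp
      have "E n \<le> (LINT x|M. C * (indicator (S \<epsilon>) x * \<bar>u n x\<bar> powr p))"
        unfolding E(2)[symmetric] Jfun_def
      proof (rule integral_mono_AE[OF Q_powr_integrable(1)[OF u] integrable_mult_right[OF iS]])
        show "AE x in M. Q n x * \<bar>u n x\<bar> powr p \<le> C * (indicator (S \<epsilon>) x * \<bar>u n x\<bar> powr p)"
          using elim(3) C(3)[of n]
        proof eventually_elim
          case (elim x)
          show ?case
          proof (cases "x \<in> S \<epsilon>")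
            case True
            have "Q n x * \<bar>u n x\<bar> powr p \<le> C * \<bar>u n x\<bar> powr p"
              using elim(2) by (intro mult_right_mono) auto
            with True show ?thesis by simp
          next
            case False
            then have "Q n x * \<bar>u n x\<bar> powr p \<le> 0"
              using elim(1) \<delta>(1) by (intro mult_nonpos_nonneg) auto
            with False show ?thesis by simp
          qed
        qed
      qed
      also have "\<dots> \<le> C * (\<eta> * (E n / c) powr (p / 2))"
        using d(2)[OF \<epsilon>(2,3) u _ h] E(1) c(1) C(1) by simp
      also have "\<dots> = E n powr (p / 2) / R powr (p / 2 - 1)"
        using C c E(1) by (simp add: \<eta>_def powr_divide)
      finally have "R powr (p / 2 - 1) \<le> E n powr (p / 2) / E n"
        using E(1) R by (simp add: field_simps)
      also have "\<dots> = E n powr (p / 2 - 1)" using E(1) by (simp add: powr_diff)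
      finally show "R \<le> E n"
        using R E(1) p2 powr_less_mono2[of "p / 2 - 1" "E n" R] by (cases "R \<le> E n") auto
    qed
  qed
  then show ?thesis
    by (subst filterlim_at_top_gt[where c=0]) auto
qed


subsection \<open>Bounds away from the two points\<close>

lemma complement_cutoff:
  assumes \<epsilon>: "0 < \<epsilon>"
  obtains \<eta> L where "smooth \<eta>" "\<And>x. 0 \<le> \<eta> x" "\<And>x. \<eta> x \<le> 1" "\<And>x. x \<in> S (\<epsilon> / 2) \<Longrightarrow> \<eta> x = 0"
    "\<And>x. x \<notin> S \<epsilon> \<Longrightarrow> \<eta> x = 1" "\<And>x. x \<notin> S \<epsilon> \<Longrightarrow> grad \<eta> x = 0" "0 \<le> L" "\<And>x. norm (grad \<eta> x) \<le> L"
    "\<And>x. x \<notin> cball x1 \<epsilon> \<union> cball x2 \<epsilon> \<Longrightarrow> grad \<eta> x = 0"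
proof -
  have r: "0 < \<epsilon> / 2" "\<epsilon> / 2 < 3 * \<epsilon> / 4" using \<epsilon> by auto
  obtain f where f: "smooth f" "\<And>x. 0 \<le> f x" "\<And>x. f x \<le> 1" "\<And>x. dist x1 x \<le> \<epsilon> / 2 \<Longrightarrow> f x = 1" "\<And>x. 3 * \<epsilon> / 4 \<le> dist x1 x \<Longrightarrow> f x = 0"
    using smooth_cutoff[OF r, of x1] by blast
  obtain g where g: "smooth g" "\<And>x. 0 \<le> g x" "\<And>x. g x \<le> 1" "\<And>x. dist x2 x \<le> \<epsilon> / 2 \<Longrightarrow> g x = 1" "\<And>x. 3 * \<epsilon> / 4 \<le> dist x2 x \<Longrightarrow> g x = 0"
    using smooth_cutoff[OF r, of x2] by blast
  define \<eta> where "\<eta> x = (1 - f x) * (1 - g x)" for x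
  have sm: "smooth \<eta>" unfolding \<eta>_def using f(1) g(1) by (intro allI Ck_mult Ck_diff Ck_const) auto
  have g0: "grad \<eta> x = 0" if "x \<notin> S \<epsilon>" for x
  proof (rule grad_eq_0_on_open)
    show "open (- (cball x1 (3 * \<epsilon> / 4) \<union> cball x2 (3 * \<epsilon> / 4)))" by (intro open_Compl closed_Un closed_cball)
    show "x \<in> - (cball x1 (3 * \<epsilon> / 4) \<union> cball x2 (3 * \<epsilon> / 4))" using that \<epsilon> by (auto simp: S_def)
    show "\<eta> y = 1" if "y \<in> - (cball x1 (3 * \<epsilon> / 4) \<union> cball x2 (3 * \<epsilon> / 4))" for y
      using that f(5)[of y] g(5)[of y] by (auto simp: \<eta>_def)
  qed
  have out: "grad \<eta> x = 0" if "x \<notin> cball x1 \<epsilon> \<union> cball x2 \<epsilon>" for x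
    using that by (intro g0) (auto simp: S_def)
  obtain L where L: "0 \<le> L" "\<And>x. norm (grad \<eta> x) \<le> L"
    by (rule bounded_compact_support[OF continuous_on_grad[OF sm] compact_Un[OF compact_cball[of x1 \<epsilon>] compact_cball[of x2 \<epsilon>]] out], assumption) (rule that)
  show thesis
  proof (rule that[OF sm _ _ _ _ g0 L out])
    show "0 \<le> \<eta> x" "\<eta> x \<le> 1" for x
      using f(2,3)[of x] g(2,3)[of x] by (auto simp: \<eta>_def intro!: mult_le_one)
    show "\<eta> x = 0" if "x \<in> S (\<epsilon> / 2)" for x
      using that f(4)[of x] g(4)[of x] by (auto simp: \<eta>_def S_def)
    show "\<eta> x = 1" if "x \<notin> S \<epsilon>" for x
      using that f(5)[of x] g(5)[of x] \<epsilon> by (auto simp: \<eta>_def S_def)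
  qed
qed

lemma smooth_measurable:
  assumes "smooth \<eta>"
  shows "\<eta> \<in> borel_measurable M" "grad \<eta> \<in> borel_measurable M"
proof -
  have "continuous_on UNIV \<eta>" by (rule Ck_continuous[OF assms[rule_format]])
  then show "\<eta> \<in> borel_measurable M"
    by (intro measurable_restrict_space1 measurable_completion) (simp add: borel_measurable_continuous_onI)
  show "grad \<eta> \<in> borel_measurable M"
    using continuous_on_grad[OF assms]
    by (intro measurable_restrict_space1 measurable_completion) (simp add: borel_measurable_continuous_onI)
qed

text \<open>
  For large \<open>n\<close>, off the balls of half the radius, the potential \<open>W n\<close> is nonnegative and \<open>Q n
  \<le> - \<delta>\<close>. With \<open>\<zeta> = \<eta>\<^sup>k\<^sup>+\<^sup>1\<close> the cutoff identity then equates the energy of \<open>\<zeta> u\<close> plus the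
  integral of \<open>\<zeta>\<^sup>2 |Q| |u|\<^sup>p\<close> with the integral of \<open>|\<nabla>\<zeta>|\<^sup>2 u\<^sup>2\<close>. By Young's inequality the
  latter is at most a constant plus half of the integral of \<open>\<zeta>\<^sup>2 |Q| |u|\<^sup>p\<close>, because \<open>\<nabla>\<zeta>\<close> has
  bounded support.
\<close>

lemma local_bound:
  assumes \<epsilon>: "0 < \<epsilon>"
  shows "ev_bounded (\<lambda>n. LINT x|M. indicator (- S \<epsilon>) x * dens n x)"
    and "ev_bounded (\<lambda>n. LINT x|M. indicator (- S \<epsilon>) x * pot n x)"
    and "ev_bounded (\<lambda>n. LINT x|M. indicator (- S \<epsilon>) x * \<bar>u n x\<bar> powr p)"
proof -
  obtain \<eta> L where \<eta>: "smooth \<eta>" "\<And>x. 0 \<le> \<eta> x" "\<And>x. \<eta> x \<le> 1" "\<And>x. x \<in> S (\<epsilon> / 2) \<Longrightarrow> \<eta> x = 0"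
    "\<And>x. x \<notin> S \<epsilon> \<Longrightarrow> \<eta> x = 1" "\<And>x. x \<notin> S \<epsilon> \<Longrightarrow> grad \<eta> x = 0" "0 \<le> L" "\<And>x. norm (grad \<eta> x) \<le> L"
    "\<And>x. x \<notin> cball x1 \<epsilon> \<union> cball x2 \<epsilon> \<Longrightarrow> grad \<eta> x = 0"
    using complement_cutoff[OF \<epsilon>] by metis
  have \<epsilon>2: "0 < \<epsilon> / 2" using \<epsilon> by simp
  obtain \<delta> where \<delta>: "0 < \<delta>" "\<forall>\<^sub>F n in sequentially. AE x in M. x \<notin> S (\<epsilon> / 2) \<longrightarrow> Q n x \<le> - \<delta>"
    by (rule Q_neg_off[OF \<epsilon>2]) (rule that)
  obtain B where B: "0 \<le> B" "\<And>n. W n \<in> borel_measurable M" "\<And>n. AE x in M. \<bar>W n x\<bar> \<le> B"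
    by (rule W_bounded) (rule that)
  \<comment> \<open>The power of the cutoff, high enough for \<open>cutoff_young\<close>.\<close>
  obtain k0 :: nat where k0: "p / (p - 2) < real k0" using reals_Archimedean2 by blast
  define k where "k = Suc k0"
  have k: "1 \<le> k" "p \<le> real (Suc k) * (p - 2)"
  proof -
    have "p < real k0 * (p - 2)" using k0 p2 by (simp add: field_simps)
    also have "\<dots> \<le> real (Suc k) * (p - 2)" using p2 by (intro mult_right_mono) (auto simp: k_def)
    finally show "p \<le> real (Suc k) * (p - 2)" by simp
  qed (simp add: k_def)
  define T where "T = cball x1 \<epsilon> \<union> cball x2 \<epsilon>"
  have TL: "T \<in> lmeasurable" by (auto simp: T_def intro!: fmeasurable.Un lmeasurable_compact)
  have iT: "integrable M (indicator T :: 'a \<Rightarrow> real)"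
    using open_\<Omega> by (intro indicator_lebesgue_on(1) TL) auto
  define D where "D = (real (Suc k) * L)\<^sup>2"
  \<comment> \<open>The parameter in Young's inequality is large enough to leave at most half of the nonlinear term.\<close>
  define l where "l = (2 * D / \<delta> + 1) powr (1 / (p - 2))"
  have D0: "0 \<le> D" by (simp add: D_def)
  have l: "0 < l" "D * l powr (2 - p) \<le> \<delta> / 2"
  proof -
    have pos: "0 < 2 * D / \<delta> + 1" using D0 \<delta>(1) by (simp add: add_nonneg_pos)
    then show "0 < l" by (simp add: l_def)
    have "1 / (p - 2) * (2 - p) = - 1" using p2 by (simp add: field_simps)
    then have "l powr (2 - p) = 1 / (2 * D / \<delta> + 1)"
      using pos unfolding l_def powr_powr by (simp add: powr_minus divide_inverse)
    moreover have "D \<le> \<delta> / 2 * (2 * D / \<delta> + 1)" using D0 \<delta>(1) by (simp add: field_simps)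
    ultimately show "D * l powr (2 - p) \<le> \<delta> / 2" using pos by (simp add: pos_divide_le_eq)
  qed

  define \<zeta> where "\<zeta> x = \<eta> x ^ Suc k" for x
  have \<zeta>: "smooth \<zeta>" "\<And>x. \<bar>\<zeta> x\<bar> \<le> 1" and g\<zeta>: "\<And>x. grad \<zeta> x = (real (Suc k) * \<eta> x ^ k) *\<^sub>R grad \<eta> x"
    and \<zeta>L: "\<And>x. norm (grad \<zeta> x) \<le> real (Suc k) * L"
  proof -
    show "smooth \<zeta>" unfolding \<zeta>_def using \<eta>(1) Ck_power by blast
    show "\<bar>\<zeta> x\<bar> \<le> 1" for x unfolding \<zeta>_def using \<eta>(2,3)[of x] by (simp add: power_abs[symmetric] power_le_one del: power_Suc)
    show g: "grad \<zeta> x = (real (Suc k) * \<eta> x ^ k) *\<^sub>R grad \<eta> x" for x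
      unfolding \<zeta>_def by (rule grad_power[OF \<eta>(1)])
    show "norm (grad \<zeta> x) \<le> real (Suc k) * L" for x
    proof -
      have "\<bar>\<eta> x\<bar> ^ k \<le> 1" using \<eta>(2,3)[of x] by (simp add: power_le_one)
      then have "real (Suc k) * \<bar>\<eta> x\<bar> ^ k * norm (grad \<eta> x) \<le> real (Suc k) * 1 * L"
        using \<eta>(8)[of x] by (intro mult_mono mult_left_mono) auto
      then show ?thesis by (simp add: g abs_mult power_abs)
    qed
  qed
  define G where "G = D * l powr 2 * (LINT x|M. indicator T x)"
  have G0: "0 \<le> G" using D0 by (simp add: G_def)
  have main: "\<forall>\<^sub>F n in sequentially.
      (LINT x|M. indicator (- S \<epsilon>) x * dens n x) \<le> G \<and>
      (LINT x|M. indicator (- S \<epsilon>) x * pot n x) \<le> 2 * G \<and>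
      (LINT x|M. indicator (- S \<epsilon>) x * \<bar>u n x\<bar> powr p) \<le> 2 * G / \<delta>"
    using ground_facts \<delta>(2) W_nonneg_off[OF \<epsilon>2]
  proof eventually_elim
    case (elim n)
    note Qn = elim(2) and Wn = elim(3)
    have sol: "weak_solution \<Omega> p (W n) (Q n) (u n)" and un: "u n \<in> H10 \<Omega>" using elim(1) by auto
    note hu = H10_H1[OF un]
    note v = H10_smooth_mult[OF open_\<Omega> un \<zeta> \<zeta>L]
    let ?v = "\<lambda>x. \<zeta> x * u n x"
    note iv = h1sq_integrable[OF H10_H1[OF v(1)]]
    note iu = h1sq_integrable[OF hu]
    have iWv: "integrable M (\<lambda>x. W n x * (?v x)\<^sup>2)" by (rule integrable_bounded_mult[OF iv(2) B(2,3)])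
    have iWu: "integrable M (\<lambda>x. \<bar>W n x\<bar> * (u n x)\<^sup>2)"
      by (rule integrable_bounded_mult[OF iu(2), where c=B]) (use B in auto)
    have \<zeta>2m: "(\<lambda>x. (\<zeta> x)\<^sup>2) \<in> borel_measurable M" using smooth_measurable(1)[OF \<zeta>(1)] by measurable
    have \<zeta>2b: "AE x in M. \<bar>(\<zeta> x)\<^sup>2\<bar> \<le> 1" using \<zeta>(2) by (simp add: abs_square_le_1)
    have iQ: "integrable M (\<lambda>x. (\<zeta> x)\<^sup>2 * (Q n x * \<bar>u n x\<bar> powr p))" "integrable M (\<lambda>x. (\<zeta> x)\<^sup>2 * pot n x)"
      by (rule integrable_bounded_mult[OF Q_powr_integrable(1)[OF un] \<zeta>2m \<zeta>2b],
          rule integrable_bounded_mult[OF Q_powr_integrable(2)[OF un] \<zeta>2m \<zeta>2b])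
    have ig: "integrable M (\<lambda>x. (norm (grad \<zeta> x))\<^sup>2 * (u n x)\<^sup>2)"
    proof (rule integrable_bounded_mult[OF iu(2), where c=D])
      show "(\<lambda>x. (norm (grad \<zeta> x))\<^sup>2) \<in> borel_measurable M" using smooth_measurable(2)[OF \<zeta>(1)] by measurable
      have "(norm (grad \<zeta> x))\<^sup>2 \<le> D" for x unfolding D_def using \<zeta>L by (intro power_mono) auto
      then show "AE x in M. \<bar>(norm (grad \<zeta> x))\<^sup>2\<bar> \<le> D" by simp
    qed
    define a where "a = (LINT x|M. (\<zeta> x)\<^sup>2 * pot n x)"
    have Qa: "(LINT x|M. (\<zeta> x)\<^sup>2 * (Q n x * \<bar>u n x\<bar> powr p)) = - a"
    proof -
      have "(LINT x|M. (\<zeta> x)\<^sup>2 * (Q n x * \<bar>u n x\<bar> powr p)) = (LINT x|M. - ((\<zeta> x)\<^sup>2 * pot n x))"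
      proof (rule integral_cong_AE)
        show "AE x in M. (\<zeta> x)\<^sup>2 * (Q n x * \<bar>u n x\<bar> powr p) = - ((\<zeta> x)\<^sup>2 * pot n x)"
          using Qn
        proof eventually_elim
          case (elim x)
          show ?case
          proof (cases "x \<in> S (\<epsilon> / 2)")
            case True
            then show ?thesis using \<eta>(4) by (simp add: \<zeta>_def)
          next
            case False
            then have "Q n x < 0" using elim \<delta>(1) by auto
            then show ?thesis by simp
          qed
        qed
      qed (use iQ in auto)
      then show ?thesis by (simp add: a_def)
    qed
    have g: "(LINT x|M. (norm (grad \<zeta> x))\<^sup>2 * (u n x)\<^sup>2) \<le> G + a / 2"
    proof -
      have "(LINT x|M. (norm (grad \<zeta> x))\<^sup>2 * (u n x)\<^sup>2) \<le>
          (LINT x|M. D * l powr 2 * indicator T x + 1 / 2 * ((\<zeta> x)\<^sup>2 * pot n x))"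
      proof (rule integral_mono_AE[OF ig])
        show "integrable M (\<lambda>x. D * l powr 2 * indicator T x + 1 / 2 * ((\<zeta> x)\<^sup>2 * pot n x))"
          using iT iQ(2) by (intro Bochner_Integration.integrable_add integrable_mult_right)
        show "AE x in M. (norm (grad \<zeta> x))\<^sup>2 * (u n x)\<^sup>2 \<le> D * l powr 2 * indicator T x + 1 / 2 * ((\<zeta> x)\<^sup>2 * pot n x)"
          using Qn
        proof eventually_elim
          case (elim x)
          show ?case
          proof (cases "x \<in> T")
            case False
            then have "grad \<zeta> x = 0" using \<eta>(9) by (simp add: g\<zeta> T_def)
            then show ?thesis using False by simp
          next
            case True
            let ?P = "(\<zeta> x)\<^sup>2 * \<bar>u n x\<bar> powr p"
            have "(norm (grad \<eta> x))\<^sup>2 \<le> L\<^sup>2" using \<eta>(8) by (intro power_mono) auto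
            then have "(real (Suc k))\<^sup>2 * (\<eta> x ^ (2 * k) * (u n x)\<^sup>2) * (norm (grad \<eta> x))\<^sup>2 \<le> (real (Suc k))\<^sup>2 * (\<eta> x ^ (2 * k) * (u n x)\<^sup>2) * L\<^sup>2"
              using \<eta>(2)[of x] by (intro mult_left_mono) auto
            then have "(norm (grad \<zeta> x))\<^sup>2 * (u n x)\<^sup>2 \<le> D * (\<eta> x ^ (2 * k) * (u n x)\<^sup>2)"
              using \<eta>(2)[of x] by (simp add: g\<zeta> D_def power_mult_distrib power_mult[symmetric] mult.commute[of 2 k] mult_ac)
            also have "\<dots> \<le> D * (l powr 2 + l powr (2 - p) * ?P)"
              unfolding \<zeta>_def using cutoff_young[OF \<eta>(2,3) p2 k l(1), of x "u n x"] D0 by (rule mult_left_mono)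
            also have "\<dots> = D * l powr 2 + (D * l powr (2 - p)) * ?P" by (simp add: algebra_simps)
            also have "\<dots> \<le> D * l powr 2 + \<delta> / 2 * ?P"
              using l(2) by (intro add_left_mono mult_right_mono) auto
            also have "\<delta> / 2 * ?P \<le> 1 / 2 * ((\<zeta> x)\<^sup>2 * pot n x)"
            proof (cases "x \<in> S (\<epsilon> / 2)")
              case True
              then show ?thesis using \<eta>(4) by (simp add: \<zeta>_def)
            next
              case False
              then have "\<delta> \<le> \<bar>Q n x\<bar>" using elim \<delta>(1) by auto
              then have "\<delta> * ?P \<le> \<bar>Q n x\<bar> * ?P" by (intro mult_right_mono) auto
              then show ?thesis by (simp add: mult_ac)
            qed
            finally show ?thesis using True by simp
          qed
        qed
      qed
      also have "\<dots> = G + a / 2" using iT iQ(2) by (simp add: G_def a_def)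
      finally show ?thesis .
    qed
    have id: "energy \<Omega> \<Omega> (W n) ?v = - a + (LINT x|M. (norm (grad \<zeta> x))\<^sup>2 * (u n x)\<^sup>2)"
      unfolding Qa[symmetric] by (rule weak_solution_cutoff_identity[OF open_\<Omega> sol B(2,3) \<zeta> \<zeta>L])
    have a0: "0 \<le> a" by (simp add: a_def)
    let ?I = "LINT x|M. indicator (- S \<epsilon>) x * dens n x"
    have Ie: "?I \<le> energy \<Omega> \<Omega> (W n) ?v"
      unfolding energy_def
    proof (rule integral_mono_AE)
      show "integrable M (\<lambda>x. indicator (- S \<epsilon>) x * dens n x)"
        using iu(1) iWu by (intro integrable_indicator_mult Bochner_Integration.integrable_add) auto
      show "integrable M (\<lambda>x. (norm (wgrad \<Omega> ?v x))\<^sup>2 + W n x * (?v x)\<^sup>2)"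
        using iv(1) iWv by (rule Bochner_Integration.integrable_add)
      show "AE x in M. indicator (- S \<epsilon>) x * dens n x \<le> (norm (wgrad \<Omega> ?v x))\<^sup>2 + W n x * (?v x)\<^sup>2"
        using Wn v(2)
      proof eventually_elim
        case (elim x)
        have sub: "S (\<epsilon> / 2) \<subseteq> S \<epsilon>" using \<epsilon> by (auto simp: S_def)
        show ?case
        proof (cases "x \<in> S \<epsilon>")
          case False
          then have "x \<notin> S (\<epsilon> / 2)" using sub by auto
          then have "0 \<le> W n x" using elim(1) by auto
          moreover have "\<zeta> x = 1" "grad \<zeta> x = 0" using False \<eta>(5,6) by (auto simp: \<zeta>_def g\<zeta>)
          ultimately show ?thesis using False elim(2) by simp
        next
          case True
          have "0 \<le> W n x * (?v x)\<^sup>2"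
          proof (cases "x \<in> S (\<epsilon> / 2)")
            case True
            then show ?thesis using \<eta>(4) by (simp add: \<zeta>_def)
          next
            case False
            then show ?thesis using elim(1) by simp
          qed
          with True show ?thesis by simp
        qed
      qed
    qed
    have I0: "0 \<le> ?I" by simp
    have IG: "?I \<le> G" "a \<le> 2 * G" using Ie id g a0 I0 by linarith+
    have J: "(LINT x|M. indicator (- S \<epsilon>) x * pot n x) \<le> a"
      unfolding a_def
    proof (rule integral_mono[OF integrable_indicator_mult[OF Q_powr_integrable(2)[OF un]] iQ(2)])
      show "indicator (- S \<epsilon>) x * pot n x \<le> (\<zeta> x)\<^sup>2 * pot n x" for x
        using \<eta>(5)[of x] by (cases "x \<in> S \<epsilon>") (auto simp: \<zeta>_def)
    qed simp
    have "\<delta> * (LINT x|M. indicator (- S \<epsilon>) x * \<bar>u n x\<bar> powr p) \<le> (LINT x|M. indicator (- S \<epsilon>) x * pot n x)"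
    proof -
      have "(LINT x|M. \<delta> * (indicator (- S \<epsilon>) x * \<bar>u n x\<bar> powr p)) \<le> (LINT x|M. indicator (- S \<epsilon>) x * pot n x)"
      proof (rule integral_mono_AE)
        show "AE x in M. \<delta> * (indicator (- S \<epsilon>) x * \<bar>u n x\<bar> powr p) \<le> indicator (- S \<epsilon>) x * pot n x"
          using Qn
        proof eventually_elim
          case (elim x)
          show ?case
          proof (cases "x \<in> S \<epsilon>")
            case False
            then have "x \<notin> S (\<epsilon> / 2)" using \<epsilon> by (auto simp: S_def)
            then have "\<delta> \<le> \<bar>Q n x\<bar>" using elim \<delta>(1) by auto
            then have "\<delta> * \<bar>u n x\<bar> powr p \<le> \<bar>Q n x\<bar> * \<bar>u n x\<bar> powr p" by (intro mult_right_mono) auto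
            then show ?thesis using False by simp
          qed simp
        qed
      qed (use integrable_indicator_mult[OF Q_powr_integrable(2)[OF un]] integrable_indicator_mult[OF powr_integrable[OF un]] in auto)
      then show ?thesis by simp
    qed
    then have "\<delta> * (LINT x|M. indicator (- S \<epsilon>) x * \<bar>u n x\<bar> powr p) \<le> 2 * G" using J IG by linarith
    then have "(LINT x|M. indicator (- S \<epsilon>) x * \<bar>u n x\<bar> powr p) \<le> 2 * G / \<delta>"
      using \<delta>(1) by (simp add: pos_le_divide_eq mult.commute)
    then show ?case using IG J by linarith
  qed
  show "ev_bounded (\<lambda>n. LINT x|M. indicator (- S \<epsilon>) x * dens n x)"
    using main by (intro ev_boundedI[where G=G], eventually_elim) simp
  show "ev_bounded (\<lambda>n. LINT x|M. indicator (- S \<epsilon>) x * pot n x)"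
    using main by (intro ev_boundedI[where G="2 * G"], eventually_elim) simp
  show "ev_bounded (\<lambda>n. LINT x|M. indicator (- S \<epsilon>) x * \<bar>u n x\<bar> powr p)"
    using main by (intro ev_boundedI[where G="2 * G / \<delta>"], eventually_elim) simp
qed

text \<open>On a bounded set, \<open>u\<^sup>2 \<le> 1 + |u|\<^sup>p\<close> reduces the claim to the local bound.\<close>

lemma annulus_bound:
  assumes \<epsilon>: "0 < \<epsilon>" and T: "T \<in> sets borel" "bounded T" "T \<inter> S \<epsilon> = {}"
  shows "ev_bounded (\<lambda>n. LINT x|M. indicator T x * (u n x)\<^sup>2)"
proof -
  have TL: "T \<in> lmeasurable" using T by (auto intro!: bounded_set_imp_lmeasurable)
  have iT: "integrable M (indicator T :: 'a \<Rightarrow> real)"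
    using open_\<Omega> by (intro indicator_lebesgue_on(1) TL) auto
  have "ev_bounded (\<lambda>n. (LINT x|M. indicator T x) + (LINT x|M. indicator (- S \<epsilon>) x * \<bar>u n x\<bar> powr p))"
    by (intro ev_bounded_add local_bound(3)[OF \<epsilon>] ev_boundedI[of _ "\<bar>LINT x|M. indicator T x\<bar>"]) simp
  then show ?thesis
  proof (rule ev_bounded_mono)
    show "\<forall>\<^sub>F n in sequentially. \<bar>LINT x|M. indicator T x * (u n x)\<^sup>2\<bar> \<le> (LINT x|M. indicator T x) + (LINT x|M. indicator (- S \<epsilon>) x * \<bar>u n x\<bar> powr p)"
      using ground_facts
    proof eventually_elim
      case (elim n)
      then have un: "u n \<in> H10 \<Omega>" by simp
      note i = integrable_indicator_mult[OF h1sq_integrable(2)[OF H10_H1[OF un]] T(1)]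
        integrable_indicator_mult[OF powr_integrable[OF un], of "- S \<epsilon>"]
      have "(LINT x|M. indicator T x * (u n x)\<^sup>2) \<le> (LINT x|M. indicator T x + indicator (- S \<epsilon>) x * \<bar>u n x\<bar> powr p)"
      proof (rule integral_mono[OF i(1)])
        show "integrable M (\<lambda>x. indicator T x + indicator (- S \<epsilon>) x * \<bar>u n x\<bar> powr p)"
          using iT i(2) by (intro Bochner_Integration.integrable_add) auto
        show "indicator T x * (u n x)\<^sup>2 \<le> indicator T x + indicator (- S \<epsilon>) x * \<bar>u n x\<bar> powr p" for x
        proof (cases "x \<in> T")
          case True
          then have "x \<notin> S \<epsilon>" using T(3) by auto
          moreover have "(u n x)\<^sup>2 \<le> 1 + \<bar>u n x\<bar> powr p"
            using abs_powr_split[of 1 2 p "u n x"] p2 by (simp add: powr_numeral)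
          ultimately show ?thesis using True by simp
        qed simp
      qed
      also have "\<dots> = (LINT x|M. indicator T x) + (LINT x|M. indicator (- S \<epsilon>) x * \<bar>u n x\<bar> powr p)"
        using iT i(2) by (intro Bochner_Integration.integral_add) auto
      finally show ?case by simp
    qed
  qed
qed


subsection \<open>Cutting into two bumps\<close>

text \<open>
  Balls of this radius about the two points are at distance at least \<open>\<rho>\<close> from each other.
\<close>

definition \<rho> where "\<rho> = dist x1 x2 / 3"

lemma \<rho>_pos: "0 < \<rho>"
  using distinct by (simp add: \<rho>_def)

definition is_bump :: "'a \<Rightarrow> ('a \<Rightarrow> real) \<Rightarrow> bool" where
  "is_bump a \<beta> \<longleftrightarrow> smooth \<beta> \<and> (\<forall>x. 0 \<le> \<beta> x \<and> \<beta> x \<le> 1) \<and>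
     (\<forall>x. dist a x \<le> \<rho> / 2 \<longrightarrow> \<beta> x = 1) \<and> (\<forall>x. \<rho> \<le> dist a x \<longrightarrow> \<beta> x = 0)"

lemma bump_exists: obtains \<beta> where "is_bump a \<beta>"
proof -
  have r: "0 < \<rho> / 2" "\<rho> / 2 < \<rho>" using \<rho>_pos by auto
  show thesis
  proof -
    obtain \<beta> where "smooth \<beta>" "\<And>x. 0 \<le> \<beta> x" "\<And>x. \<beta> x \<le> 1" "\<And>x. dist a x \<le> \<rho> / 2 \<Longrightarrow> \<beta> x = 1" "\<And>x. \<rho> \<le> dist a x \<Longrightarrow> \<beta> x = 0"
      using smooth_cutoff[OF r, of a] by blast
    then show thesis by (intro that[of \<beta>]) (auto simp: is_bump_def)
  qed
qed

lemma bumpD: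
  assumes "is_bump a \<beta>"
  shows "smooth \<beta>" "0 \<le> \<beta> x" "\<beta> x \<le> 1" "\<bar>\<beta> x\<bar> \<le> 1" "dist a x \<le> \<rho> / 2 \<Longrightarrow> \<beta> x = 1" "\<rho> \<le> dist a x \<Longrightarrow> \<beta> x = 0"
  using assms by (auto simp: is_bump_def)

text \<open>The balls of radius \<open>\<rho>\<close> are so far apart that a bump is locally constant in both balls of half the radius.\<close>

lemma bump_locally_constant:
  assumes b: "is_bump a \<beta>" and a: "a \<in> {x1, x2}" and x: "x \<in> S (\<rho> / 2)"
  shows "\<beta> x \<in> {0, 1}" "grad \<beta> x = 0"
proof -
  have "(\<exists>c\<in>{0, 1}. \<exists>U. open U \<and> x \<in> U \<and> (\<forall>y\<in>U. \<beta> y = c))"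
  proof (cases "x \<in> ball a (\<rho> / 2)")
    case True
    then show ?thesis
      by (intro bexI[of _ 1] exI[of _ "ball a (\<rho> / 2)"]) (auto intro: bumpD(5)[OF b])
  next
    case False
    define b where "b = (if a = x1 then x2 else x1)"
    have ab: "dist a b = 3 * \<rho>" "x \<in> ball b (\<rho> / 2)"
      using a x False distinct by (auto simp: S_def \<rho>_def b_def dist_commute)
    have "\<beta> y = 0" if "y \<in> ball b (\<rho> / 2)" for y
    proof (rule bumpD(6)[OF assms(1)])
      have "3 * \<rho> \<le> dist a y + dist b y" using ab(1) by (metis dist_commute dist_triangle)
      then show "\<rho> \<le> dist a y" using that \<rho>_pos by simp
    qed
    then show ?thesis using ab(2) by (intro bexI[of _ 0] exI[of _ "ball b (\<rho> / 2)"]) auto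
  qed
  then obtain c U where "c \<in> {0, 1}" "open U" "x \<in> U" "\<And>y. y \<in> U \<Longrightarrow> \<beta> y = c" by blast
  then show "\<beta> x \<in> {0, 1}" "grad \<beta> x = 0" using grad_eq_0_on_open[of U x \<beta> c] by auto
qed

lemma bump_gradient:
  assumes b: "is_bump a \<beta>" and a: "a \<in> {x1, x2}"
  obtains L where "0 \<le> L" "\<And>x. norm (grad \<beta> x) \<le> L" "\<And>x. grad \<beta> x \<noteq> 0 \<Longrightarrow> x \<in> cball a \<rho> - S (\<rho> / 2)"
proof -
  have out: "grad \<beta> x = 0" if "x \<notin> cball a \<rho>" for x
    by (rule grad_eq_0_on_open[of "- cball a \<rho>"]) (use that bumpD(6)[OF b] in auto)
  obtain L where L: "0 \<le> L" "\<And>x. norm (grad \<beta> x) \<le> L"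
    by (rule bounded_compact_support[OF continuous_on_grad[OF bumpD(1)[OF b]] compact_cball[of a \<rho>] out], assumption) (rule that)
  show thesis
    by (rule that[OF L]) (use out bump_locally_constant(2)[OF b a] in blast)
qed

lemma bump_H10:
  assumes "is_bump a \<beta>" "a \<in> {x1, x2}" "v \<in> H10 \<Omega>"
  shows "(\<lambda>x. \<beta> x * v x) \<in> H10 \<Omega>"
    "AE x in M. wgrad \<Omega> (\<lambda>x. \<beta> x * v x) x = \<beta> x *\<^sub>R wgrad \<Omega> v x + v x *\<^sub>R grad \<beta> x"
proof -
  obtain L where L: "0 \<le> L" "\<And>x. norm (grad \<beta> x) \<le> L" "\<And>x. grad \<beta> x \<noteq> 0 \<Longrightarrow> x \<in> cball a \<rho> - S (\<rho> / 2)"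
    using bump_gradient[OF assms(1,2)] by metis
  show "(\<lambda>x. \<beta> x * v x) \<in> H10 \<Omega>"
    "AE x in M. wgrad \<Omega> (\<lambda>x. \<beta> x * v x) x = \<beta> x *\<^sub>R wgrad \<Omega> v x + v x *\<^sub>R grad \<beta> x"
    by (rule H10_smooth_mult[OF open_\<Omega> assms(3) bumpD(1,4)[OF assms(1)] L(2)])+
qed

text \<open>
  Applied to the difference of two weights, this says that weights which agree on both balls of half the
  radius give the same nonlinear term up to a bounded error.
\<close>

lemma weighted_potential_bound:
  assumes f: "f \<in> borel_measurable M" "\<And>x. \<bar>f x\<bar> \<le> 1" "\<And>x. x \<in> S (\<rho> / 2) \<Longrightarrow> f x = 0"
  shows "ev_bounded (\<lambda>n. LINT x|M. f x * (Q n x * \<bar>u n x\<bar> powr p))"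
proof (rule ev_bounded_mono[OF local_bound(2)])
  show "0 < \<rho> / 2" using \<rho>_pos by simp
  show "\<forall>\<^sub>F n in sequentially. \<bar>LINT x|M. f x * (Q n x * \<bar>u n x\<bar> powr p)\<bar> \<le> (LINT x|M. indicator (- S (\<rho> / 2)) x * pot n x)"
    using ground_facts
  proof eventually_elim
    case (elim n)
    then have un: "u n \<in> H10 \<Omega>" by simp
    show ?case
    proof (rule order_trans[OF integral_abs_bound integral_mono])
      show "integrable M (\<lambda>x. \<bar>f x * (Q n x * \<bar>u n x\<bar> powr p)\<bar>)"
        using integrable_bounded_mult[OF Q_powr_integrable(1)[OF un] f(1), of 1] f(2) by auto
      show "integrable M (\<lambda>x. indicator (- S (\<rho> / 2)) x * pot n x)"
        by (rule integrable_indicator_mult[OF Q_powr_integrable(2)[OF un]]) simp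
      show "\<bar>f x * (Q n x * \<bar>u n x\<bar> powr p)\<bar> \<le> indicator (- S (\<rho> / 2)) x * pot n x" for x
      proof (cases "x \<in> S (\<rho> / 2)")
        case False
        have "\<bar>f x\<bar> * pot n x \<le> 1 * pot n x"
          using f(2) by (intro mult_right_mono) auto
        then show ?thesis using False by (simp add: abs_mult)
      qed (simp add: f(3))
    qed
  qed
qed

lemma weighted_integrable:
  assumes "u n \<in> H10 \<Omega>" "f \<in> borel_measurable M" "\<And>x. \<bar>f x\<bar> \<le> 1"
  shows "integrable M (\<lambda>x. f x * (Q n x * \<bar>u n x\<bar> powr p))"
  by (rule integrable_bounded_mult[OF Q_powr_integrable(1)[OF assms(1)] assms(2), of 1]) (simp add: assms(3))

definition J where "J f n = (LINT x|M. f x * (Q n x * \<bar>u n x\<bar> powr p))"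

text \<open>
  The error term of the cutoff identity is supported in an annulus, and \<open>\<beta>\<^sup>2\<close> and \<open>|\<beta>|\<^sup>p\<close>
  agree where \<open>\<beta>\<close> is \<open>0\<close> or \<open>1\<close>.
\<close>

lemma bump_energy:
  assumes b: "is_bump a \<beta>" and a: "a \<in> {x1, x2}"
  shows "ev_bounded (\<lambda>n. cut_energy \<beta> n - J (\<lambda>x. (\<beta> x)\<^sup>2) n)"
    and "ev_bounded (\<lambda>n. J (\<lambda>x. (\<beta> x)\<^sup>2) n - Jfun \<Omega> p (Q n) (\<lambda>x. \<beta> x * u n x))"
proof -
  obtain B where B: "0 \<le> B" "\<And>n. W n \<in> borel_measurable M" "\<And>n. AE x in M. \<bar>W n x\<bar> \<le> B"
    by (rule W_bounded) (rule that)
  obtain L where L: "0 \<le> L" "\<And>x. norm (grad \<beta> x) \<le> L" "\<And>x. grad \<beta> x \<noteq> 0 \<Longrightarrow> x \<in> cball a \<rho> - S (\<rho> / 2)"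
    using bump_gradient[OF b a] by metis
  note bD = bumpD[OF b]
  let ?T = "cball a \<rho> - S (\<rho> / 2)"
  have "ev_bounded (\<lambda>n. LINT x|M. indicator ?T x * (u n x)\<^sup>2)"
    using \<rho>_pos by (intro annulus_bound[of "\<rho> / 2"]) (auto intro: bounded_subset[OF bounded_cball])
  from ev_bounded_cmult[OF this, of "L\<^sup>2"]
  show "ev_bounded (\<lambda>n. cut_energy \<beta> n - J (\<lambda>x. (\<beta> x)\<^sup>2) n)"
  proof (rule ev_bounded_mono)
    show "\<forall>\<^sub>F n in sequentially. \<bar>cut_energy \<beta> n - J (\<lambda>x. (\<beta> x)\<^sup>2) n\<bar> \<le> L\<^sup>2 * (LINT x|M. indicator ?T x * (u n x)\<^sup>2)"
      using ground_facts
    proof eventually_elim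
      case (elim n)
      then have sol: "weak_solution \<Omega> p (W n) (Q n) (u n)" and un: "u n \<in> H10 \<Omega>" by auto
      note iu = h1sq_integrable(2)[OF H10_H1[OF un]]
      have sq: "(norm (grad \<beta> x))\<^sup>2 \<le> L\<^sup>2" for x using L(2) by (intro power_mono) auto
      have "(LINT x|M. (norm (grad \<beta> x))\<^sup>2 * (u n x)\<^sup>2) \<le> (LINT x|M. L\<^sup>2 * (indicator ?T x * (u n x)\<^sup>2))"
      proof (rule integral_mono)
        show "integrable M (\<lambda>x. (norm (grad \<beta> x))\<^sup>2 * (u n x)\<^sup>2)"
        proof (rule integrable_bounded_mult[OF iu, where c="L\<^sup>2"])
          show "(\<lambda>x. (norm (grad \<beta> x))\<^sup>2) \<in> borel_measurable M" using smooth_measurable(2)[OF bD(1)] by measurable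
        qed (use sq in simp)
        show "integrable M (\<lambda>x. L\<^sup>2 * (indicator ?T x * (u n x)\<^sup>2))"
          by (intro integrable_mult_right integrable_indicator_mult[OF iu]) auto
        show "(norm (grad \<beta> x))\<^sup>2 * (u n x)\<^sup>2 \<le> L\<^sup>2 * (indicator ?T x * (u n x)\<^sup>2)" for x
          using L(3)[of x] mult_right_mono[OF sq[of x], of "(u n x)\<^sup>2"] by (cases "grad \<beta> x = 0") auto
      qed
      then show ?case
        using weak_solution_cutoff_identity[OF open_\<Omega> sol B(2,3) bD(1,4) L(2)] by (simp add: J_def)
    qed
  qed
  have m: "(\<lambda>x. (\<beta> x)\<^sup>2 - \<bar>\<beta> x\<bar> powr p) \<in> borel_measurable M"
    using smooth_measurable(1)[OF bD(1)] by measurable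
  have "ev_bounded (\<lambda>n. LINT x|M. ((\<beta> x)\<^sup>2 - \<bar>\<beta> x\<bar> powr p) * (Q n x * \<bar>u n x\<bar> powr p))"
  proof (rule weighted_potential_bound[OF m])
    fix x
    have "0 \<le> (\<beta> x)\<^sup>2" "(\<beta> x)\<^sup>2 \<le> 1" "0 \<le> \<bar>\<beta> x\<bar> powr p" "\<bar>\<beta> x\<bar> powr p \<le> 1"
      using bD(2,3)[of x] p2 by (auto simp: power_le_one powr_le1)
    then show "\<bar>(\<beta> x)\<^sup>2 - \<bar>\<beta> x\<bar> powr p\<bar> \<le> 1" by linarith
    show "(\<beta> x)\<^sup>2 - \<bar>\<beta> x\<bar> powr p = 0" if "x \<in> S (\<rho> / 2)"
      using bump_locally_constant(1)[OF b a that] by auto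
  qed
  then show "ev_bounded (\<lambda>n. J (\<lambda>x. (\<beta> x)\<^sup>2) n - Jfun \<Omega> p (Q n) (\<lambda>x. \<beta> x * u n x))"
  proof (rule ev_bounded_cong)
    show "\<forall>\<^sub>F n in sequentially. (LINT x|M. ((\<beta> x)\<^sup>2 - \<bar>\<beta> x\<bar> powr p) * (Q n x * \<bar>u n x\<bar> powr p)) = J (\<lambda>x. (\<beta> x)\<^sup>2) n - Jfun \<Omega> p (Q n) (\<lambda>x. \<beta> x * u n x)"
      using ground_facts
    proof eventually_elim
      case (elim n)
      then have un: "u n \<in> H10 \<Omega>" by simp
      have i1: "integrable M (\<lambda>x. (\<beta> x)\<^sup>2 * (Q n x * \<bar>u n x\<bar> powr p))"
        by (rule weighted_integrable[OF un]) (use smooth_measurable(1)[OF bD(1)] bD(2,3) in \<open>auto simp: power_le_one\<close>)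
      have i2: "integrable M (\<lambda>x. Q n x * \<bar>\<beta> x * u n x\<bar> powr p)"
        by (rule Q_powr_integrable(1)[OF bump_H10(1)[OF b a un]])
      have "((\<beta> x)\<^sup>2 - \<bar>\<beta> x\<bar> powr p) * (Q n x * \<bar>u n x\<bar> powr p) = (\<beta> x)\<^sup>2 * (Q n x * \<bar>u n x\<bar> powr p) - Q n x * \<bar>\<beta> x * u n x\<bar> powr p" for x
        by (simp add: abs_mult powr_mult algebra_simps)
      then show ?case using i1 i2 by (simp add: J_def Jfun_def)
    qed
  qed
qed

lemma bump_sum:
  assumes b1: "is_bump x1 \<beta>1" and b2: "is_bump x2 \<beta>2"
  shows "ev_bounded (\<lambda>n. E n - J (\<lambda>x. (\<beta>1 x)\<^sup>2) n - J (\<lambda>x. (\<beta>2 x)\<^sup>2) n)"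
proof -
  note D = bumpD[OF b1] bumpD[OF b2]
  have m: "\<beta>1 \<in> borel_measurable M" "\<beta>2 \<in> borel_measurable M"
    using smooth_measurable(1)[OF D(1)] smooth_measurable(1)[OF D(7)] by auto
  let ?f = "\<lambda>x. 1 - (\<beta>1 x)\<^sup>2 - (\<beta>2 x)\<^sup>2"
  have "ev_bounded (\<lambda>n. LINT x|M. ?f x * (Q n x * \<bar>u n x\<bar> powr p))"
  proof (rule weighted_potential_bound)
    show "?f \<in> borel_measurable M" using m by measurable
    fix x
    have "0 \<le> (\<beta>1 x)\<^sup>2" "(\<beta>1 x)\<^sup>2 \<le> 1" "0 \<le> (\<beta>2 x)\<^sup>2" "(\<beta>2 x)\<^sup>2 \<le> 1"
      using D(2,3)[of x] D(8,9)[of x] by (auto simp: power_le_one)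
    then show "\<bar>?f x\<bar> \<le> 1" by linarith
    show "?f x = 0" if "x \<in> S (\<rho> / 2)"
    proof -
      have tri: "3 * \<rho> \<le> dist x1 x + dist x2 x" using dist_triangle[of x1 x2 x] by (simp add: \<rho>_def dist_commute)
      have "dist x1 x < \<rho> / 2 \<or> dist x2 x < \<rho> / 2" using that by (auto simp: S_def)
      then show ?thesis
      proof
        assume "dist x1 x < \<rho> / 2"
        then have "\<beta>1 x = 1" "\<beta>2 x = 0" using tri \<rho>_pos by (auto intro!: D(5) D(12))
        then show ?thesis by simp
      next
        assume "dist x2 x < \<rho> / 2"
        then have "\<beta>2 x = 1" "\<beta>1 x = 0" using tri \<rho>_pos by (auto intro!: D(11) D(6))
        then show ?thesis by simp
      qed
    qed
  qed
  then show ?thesis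
  proof (rule ev_bounded_cong)
    show "\<forall>\<^sub>F n in sequentially. (LINT x|M. ?f x * (Q n x * \<bar>u n x\<bar> powr p)) = E n - J (\<lambda>x. (\<beta>1 x)\<^sup>2) n - J (\<lambda>x. (\<beta>2 x)\<^sup>2) n"
      using ground_facts
    proof eventually_elim
      case (elim n)
      then have un: "u n \<in> H10 \<Omega>" and En: "E n = (LINT x|M. Q n x * \<bar>u n x\<bar> powr p)" by (auto simp: Jfun_def)
      have i: "integrable M (\<lambda>x. (\<beta>1 x)\<^sup>2 * (Q n x * \<bar>u n x\<bar> powr p))" "integrable M (\<lambda>x. (\<beta>2 x)\<^sup>2 * (Q n x * \<bar>u n x\<bar> powr p))"
        by (rule weighted_integrable[OF un]; use m D(2,3,8,9) in \<open>auto simp: power_le_one\<close>)+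
      have "?f x * (Q n x * \<bar>u n x\<bar> powr p) = Q n x * \<bar>u n x\<bar> powr p - (\<beta>1 x)\<^sup>2 * (Q n x * \<bar>u n x\<bar> powr p) - (\<beta>2 x)\<^sup>2 * (Q n x * \<bar>u n x\<bar> powr p)" for x
        by (simp add: algebra_simps)
      then show ?case using i Q_powr_integrable(1)[OF un] by (simp add: J_def En)
    qed
  qed
qed

text \<open>
  By coercivity the quotients are nonnegative, so that \<open>s_inf\<close> is a lower bound for them. With
  \<open>J(u n) = E n\<close> inserted, this is solved for \<open>J(v)\<close>.
\<close>

lemma minimality:
  "\<forall>\<^sub>F n in sequentially. \<forall>v\<in>H10 \<Omega>. 0 \<le> energy \<Omega> \<Omega> (W n) v \<and>
     Jfun \<Omega> p (Q n) v \<le> E n * (energy \<Omega> \<Omega> (W n) v / E n) powr (p / 2)"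
proof -
  obtain c where c: "0 < c" "\<forall>\<^sub>F n in sequentially. \<forall>v\<in>H10 \<Omega>. c * h1sq \<Omega> v \<le> energy \<Omega> \<Omega> (W n) v"
    by (rule coercive) (rule that)
  show ?thesis
    using c(2) ground_facts ground
  proof eventually_elim
    case (elim n)
    have nn: "0 \<le> energy \<Omega> \<Omega> (W n) v" if "v \<in> H10 \<Omega>" for v
    proof -
      have "0 \<le> c * h1sq \<Omega> v" using c(1) h1sq_nonneg[of \<Omega> v] by simp
      also have "\<dots> \<le> energy \<Omega> \<Omega> (W n) v" using elim(1) that by blast
      finally show ?thesis .
    qed
    have E: "0 < E n" using elim(2) by simp
    show ?case
    proof (intro ballI conjI)
      fix v assume v: "v \<in> H10 \<Omega>"
      show "0 \<le> energy \<Omega> \<Omega> (W n) v" by (rule nn[OF v])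
      let ?e = "energy \<Omega> \<Omega> (W n) v" and ?j = "Jfun \<Omega> p (Q n) v"
      show "?j \<le> E n * (?e / E n) powr (p / 2)"
      proof (cases "0 < ?j")
        case False
        have "0 \<le> E n * (?e / E n) powr (p / 2)" using E by simp
        with False show ?thesis by linarith
      next
        case True
        have "E n / E n powr (2 / p) = s_inf \<Omega> p (W n) (Q n)"
          using elim(2,3) by (simp add: ground_state_def E_def)
        also have "\<dots> \<le> ?e / ?j powr (2 / p)"
          unfolding s_inf_def
        proof (rule cInf_lower)
          show "bdd_below {energy \<Omega> \<Omega> (W n) u / Jfun \<Omega> p (Q n) u powr (2 / p) |u. u \<in> H10 \<Omega> \<and> 0 < Jfun \<Omega> p (Q n) u}"
            by (rule bdd_belowI[of _ 0]) (auto intro!: divide_nonneg_nonneg nn)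
        qed (use v True in blast)
        finally have "?j powr (2 / p) \<le> ?e / E n * E n powr (2 / p)"
          using E True by (simp add: field_simps)
        then have "(?j powr (2 / p)) powr (p / 2) \<le> (?e / E n * E n powr (2 / p)) powr (p / 2)"
          using p2 by (intro powr_mono2) auto
        moreover have "(?j powr (2 / p)) powr (p / 2) = ?j" "(E n powr (2 / p)) powr (p / 2) = E n"
          using p2 True E by (simp_all add: powr_powr)
        moreover have "(?e / E n * E n powr (2 / p)) powr (p / 2) = (?e / E n) powr (p / 2) * (E n powr (2 / p)) powr (p / 2)"
          by (rule powr_mult)
        ultimately show ?thesis by (simp only: mult.commute)
      qed
    qed
  qed
qed

lemma bump_energy_superlinear:
  assumes b: "is_bump a \<beta>" and a: "a \<in> {x1, x2}"
  obtains G where "0 < G" "\<forall>\<^sub>F n in sequentially. 0 \<le> cut_energy \<beta> n \<and>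
    cut_energy \<beta> n \<le> E n * (cut_energy \<beta> n / E n) powr (p / 2) + G"
proof -
  obtain G where G: "0 < G" "\<forall>\<^sub>F n in sequentially. \<bar>(cut_energy \<beta> n - J (\<lambda>x. (\<beta> x)\<^sup>2) n) + (J (\<lambda>x. (\<beta> x)\<^sup>2) n - Jfun \<Omega> p (Q n) (\<lambda>x. \<beta> x * u n x))\<bar> \<le> G"
    by (rule ev_boundedE[OF ev_bounded_add[OF bump_energy[OF b a]]]) (rule that)
  show thesis
    by (rule that[OF G(1)])
       (use G(2) minimality ground_facts in eventually_elim, use bump_H10(1)[OF b a] in fastforce)
qed

text \<open>
  The ratio of the energy of the first bump to \<open>E n\<close> has a limit \<open>l\<close> along a subsequence. The
  superlinear bound gives \<open>l \<le> l powr (p / 2)\<close>, hence \<open>l = 0\<close> or \<open>l = 1\<close>. One of the two bumps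
  has a vanishing ratio, and its energy is bounded.
\<close>

lemma dichotomy:
  assumes b1: "is_bump x1 \<beta>1" and b2: "is_bump x2 \<beta>2"
  obtains r :: "nat \<Rightarrow> nat" where "strict_mono r"
    "ev_bounded (\<lambda>n. energy \<Omega> \<Omega> (W (r n)) (\<lambda>x. \<beta>1 x * u (r n) x)) \<or>
     ev_bounded (\<lambda>n. energy \<Omega> \<Omega> (W (r n)) (\<lambda>x. \<beta>2 x * u (r n) x))"
proof -
  define e1 where "e1 n = cut_energy \<beta>1 n" for n
  define e2 where "e2 n = cut_energy \<beta>2 n" for n
  have a: "x1 \<in> {x1, x2}" "x2 \<in> {x1, x2}" by auto
  obtain G1 where G1: "0 < G1" "\<forall>\<^sub>F n in sequentially. 0 \<le> e1 n \<and> e1 n \<le> E n * (e1 n / E n) powr (p / 2) + G1"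
    by (rule bump_energy_superlinear[OF b1 a(1), folded e1_def]) (rule that)
  obtain G2 where G2: "0 < G2" "\<forall>\<^sub>F n in sequentially. 0 \<le> e2 n \<and> e2 n \<le> E n * (e2 n / E n) powr (p / 2) + G2"
    by (rule bump_energy_superlinear[OF b2 a(2), folded e2_def]) (rule that)
  have bd: "ev_bounded (\<lambda>n. E n - e1 n - e2 n)"
  proof -
    have "ev_bounded (\<lambda>n. (E n - J (\<lambda>x. (\<beta>1 x)\<^sup>2) n - J (\<lambda>x. (\<beta>2 x)\<^sup>2) n) - (e1 n - J (\<lambda>x. (\<beta>1 x)\<^sup>2) n) - (e2 n - J (\<lambda>x. (\<beta>2 x)\<^sup>2) n))"
      unfolding e1_def e2_def
      by (intro ev_bounded_diff bump_sum[OF b1 b2] bump_energy(1)[OF b1 a(1)] bump_energy(1)[OF b2 a(2)])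
    then show ?thesis by (simp add: algebra_simps)
  qed
  have Epos: "\<forall>\<^sub>F n in sequentially. 0 < E n" using ground_facts by eventually_elim simp
  have lim0: "(\<lambda>n. (E n - e1 n - e2 n) / E n) \<longlonglongrightarrow> 0"
    by (rule ev_bounded_div_at_top[OF bd E_at_top])
  \<comment> \<open>Clipping places the ratio in a compact interval for all \<open>n\<close>; for large \<open>n\<close> it changes nothing.\<close>
  define \<alpha> where "\<alpha> n = min 2 (max 0 (e1 n / E n))" for n
  have "\<forall>n. \<alpha> n \<in> {0..2}" by (simp add: \<alpha>_def)
  then obtain l r where r: "strict_mono r" "(\<alpha> \<circ> r) \<longlonglongrightarrow> l"
    using compact_imp_seq_compact[OF compact_Icc[of "0::real" 2]] unfolding seq_compact_def by metis
  have sub: "\<forall>\<^sub>F n in sequentially. P (r n)" if "\<forall>\<^sub>F n in sequentially. P n" for P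
    using filterlim_subseq[OF r(1)] that unfolding filterlim_iff by blast
  have E_r: "filterlim (\<lambda>n. E (r n)) at_top sequentially"
    by (rule filterlim_compose[OF E_at_top filterlim_subseq[OF r(1)]])
  have \<alpha>_eq: "\<forall>\<^sub>F n in sequentially. \<alpha> n = e1 n / E n"
  proof -
    have "\<forall>\<^sub>F n in sequentially. - 1 < (E n - e1 n - e2 n) / E n"
      using lim0 by (rule order_tendstoD) simp
    with Epos G1(2) G2(2) show ?thesis
    proof eventually_elim
      case (elim n)
      then have "e1 n / E n \<le> 2" "0 \<le> e1 n / E n" by (auto simp: field_simps)
      then show ?case by (simp add: \<alpha>_def)
    qed
  qed
  have lim1: "(\<lambda>n. e1 (r n) / E (r n)) \<longlonglongrightarrow> l"
    by (rule Lim_transform_eventually[OF r(2)]) (use sub[OF \<alpha>_eq] in simp)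
  have lim2: "(\<lambda>n. e2 (r n) / E (r n)) \<longlonglongrightarrow> 1 - l"
  proof -
    have "(\<lambda>n. (E (r n) - e1 (r n) - e2 (r n)) / E (r n)) \<longlonglongrightarrow> 0"
      using LIMSEQ_subseq_LIMSEQ[OF lim0 r(1)] by (simp add: o_def)
    from tendsto_diff[OF tendsto_diff[OF tendsto_const[of 1] lim1] this]
    have "(\<lambda>n. 1 - e1 (r n) / E (r n) - (E (r n) - e1 (r n) - e2 (r n)) / E (r n)) \<longlonglongrightarrow> 1 - l" by simp
    then show ?thesis
      by (rule Lim_transform_eventually) (use sub[OF Epos] in eventually_elim, simp add: field_simps)
  qed
  have l: "0 \<le> l" "l \<le> 1"
  proof -
    show "0 \<le> l" by (rule LIMSEQ_le_const[OF r(2)]) (auto simp: \<alpha>_def)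
    have "\<forall>\<^sub>F n in sequentially. 0 \<le> e2 (r n) / E (r n)"
      using sub[OF G2(2)] sub[OF Epos] by eventually_elim auto
    then have "0 \<le> 1 - l" by (rule tendsto_lowerbound[OF lim2]) simp
    then show "l \<le> 1" by simp
  qed
  have "l \<le> l powr (p / 2)"
  proof (rule tendsto_le[OF sequentially_bot _ lim1])
    have "(\<lambda>n. G1 / E (r n)) \<longlonglongrightarrow> 0" by (rule real_tendsto_divide_at_top[OF tendsto_const E_r])
    moreover have "(\<lambda>n. \<alpha> (r n) powr (p / 2)) \<longlonglongrightarrow> l powr (p / 2)"
      using r(2) p2 by (intro tendsto_powr2) (auto simp: o_def \<alpha>_def)
    ultimately have "(\<lambda>n. \<alpha> (r n) powr (p / 2) + G1 / E (r n)) \<longlonglongrightarrow> l powr (p / 2) + 0"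
      by (intro tendsto_add)
    then show "(\<lambda>n. \<alpha> (r n) powr (p / 2) + G1 / E (r n)) \<longlonglongrightarrow> l powr (p / 2)" by simp
    show "\<forall>\<^sub>F n in sequentially. e1 (r n) / E (r n) \<le> \<alpha> (r n) powr (p / 2) + G1 / E (r n)"
      using sub[OF G1(2)] sub[OF Epos] sub[OF \<alpha>_eq]
    proof eventually_elim
      case (elim n)
      have "e1 (r n) / E (r n) \<le> (E (r n) * (e1 (r n) / E (r n)) powr (p / 2) + G1) / E (r n)"
        using elim(1,2) by (intro divide_right_mono) auto
      also have "\<dots> = (e1 (r n) / E (r n)) powr (p / 2) + G1 / E (r n)"
        using elim(2) by (simp add: add_divide_distrib)
      finally show ?case by (simp only: elim(3))
    qed
  qed
  moreover have "l powr (p / 2) < l" if "0 < l" "l < 1"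
    using powr_less_mono'[of l 1 "p / 2"] that p2 by simp
  ultimately have "l = 0 \<or> l = 1" using l by force
  then show thesis
  proof
    assume "l = 0"
    have "ev_bounded (\<lambda>n. e1 (r n))"
      by (rule ev_bounded_of_superlinear[where E="\<lambda>n. E (r n)" and q="p / 2" and G=G1])
         (use sub[OF G1(2)] sub[OF Epos] lim1 \<open>l = 0\<close> p2 in \<open>auto elim: eventually_mono\<close>)
    then show thesis using that[OF r(1)] by (simp add: e1_def)
  next
    assume "l = 1"
    have "ev_bounded (\<lambda>n. e2 (r n))"
      by (rule ev_bounded_of_superlinear[where E="\<lambda>n. E (r n)" and q="p / 2" and G=G2])
         (use sub[OF G2(2)] sub[OF Epos] lim2 \<open>l = 1\<close> p2 in \<open>auto elim: eventually_mono\<close>)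
    then show thesis using that[OF r(1)] by (simp add: e2_def)
  qed
qed


subsection \<open>Concentration at one point\<close>

lemma energy_integrable:
  assumes "v \<in> H10 \<Omega>"
  shows "integrable M (\<lambda>x. (norm (wgrad \<Omega> v x))\<^sup>2 + W n x * (v x)\<^sup>2)"
    "integrable M (\<lambda>x. (norm (wgrad \<Omega> v x))\<^sup>2 + \<bar>W n x\<bar> * (v x)\<^sup>2)"
proof -
  obtain B where B: "0 \<le> B" "\<And>n. W n \<in> borel_measurable M" "\<And>n. AE x in M. \<bar>W n x\<bar> \<le> B"
    by (rule W_bounded) (rule that)
  note i = h1sq_integrable[OF H10_H1[OF assms]]
  show "integrable M (\<lambda>x. (norm (wgrad \<Omega> v x))\<^sup>2 + W n x * (v x)\<^sup>2)"
    by (intro Bochner_Integration.integrable_add i(1) integrable_bounded_mult[OF i(2) B(2,3)])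
  show "integrable M (\<lambda>x. (norm (wgrad \<Omega> v x))\<^sup>2 + \<bar>W n x\<bar> * (v x)\<^sup>2)"
    using B by (intro Bochner_Integration.integrable_add i(1) integrable_bounded_mult[OF i(2), where c=B]) auto
qed

lemma weighted_energy_le:
  assumes v: "v \<in> H10 \<Omega>" and A: "A \<in> sets borel"
  shows "\<bar>LINT x|M. indicator A x * ((norm (wgrad \<Omega> v x))\<^sup>2 + W n x * (v x)\<^sup>2)\<bar> \<le>
    (LINT x|M. indicator A x * ((norm (wgrad \<Omega> v x))\<^sup>2 + \<bar>W n x\<bar> * (v x)\<^sup>2))"
proof (rule order_trans[OF integral_abs_bound integral_mono])
  note i = energy_integrable[OF v, of n, THEN integrable_indicator_mult, OF A]
  show "integrable M (\<lambda>x. \<bar>indicator A x * ((norm (wgrad \<Omega> v x))\<^sup>2 + W n x * (v x)\<^sup>2)\<bar>)"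
    using i(1) by simp
  show "integrable M (\<lambda>x. indicator A x * ((norm (wgrad \<Omega> v x))\<^sup>2 + \<bar>W n x\<bar> * (v x)\<^sup>2))" by (rule i(2))
  show "\<bar>indicator A x * ((norm (wgrad \<Omega> v x))\<^sup>2 + W n x * (v x)\<^sup>2)\<bar> \<le> indicator A x * ((norm (wgrad \<Omega> v x))\<^sup>2 + \<bar>W n x\<bar> * (v x)\<^sup>2)" for x
    using abs_triangle_ineq[of "(norm (wgrad \<Omega> v x))\<^sup>2" "W n x * (v x)\<^sup>2"]
    by (auto simp: indicator_def abs_mult)
qed

text \<open>
  Outside the ball about \<open>x1\<close> there is the region off both small balls, where the local bound
  applies, and a part of a small ball about \<open>x2\<close>. There \<open>u n\<close> agrees with the second bump,
  whose full Sobolev norm is bounded by coercivity. All integrands are nonnegative, so it does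
  not matter which part of the ball about \<open>x2\<close> is left over.
\<close>

lemma off_ball_bounded:
  assumes b: "is_bump x2 \<beta>" and ev: "ev_bounded (\<lambda>n. cut_energy \<beta> n)" and \<epsilon>: "0 < \<epsilon>"
  shows "ev_bounded (\<lambda>n. LINT x|M. indicator (- ball x1 \<epsilon>) x * dens n x)"
    and "ev_bounded (\<lambda>n. LINT x|M. indicator (- ball x1 \<epsilon>) x * pot n x)"
proof -
  define \<epsilon>' where "\<epsilon>' = min \<epsilon> (\<rho> / 2)"
  have \<epsilon>': "0 < \<epsilon>'" "\<epsilon>' \<le> \<epsilon>" "\<epsilon>' \<le> \<rho> / 2" using \<epsilon> \<rho>_pos by (auto simp: \<epsilon>'_def)
  have cover: "x \<in> S (\<rho> / 2)" "\<beta> x = 1" if "x \<in> S \<epsilon>'" "x \<notin> ball x1 \<epsilon>" for x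
  proof -
    have "dist x2 x < \<rho> / 2" using that \<epsilon>' by (auto simp: S_def)
    then show "x \<in> S (\<rho> / 2)" "\<beta> x = 1" using bumpD(5)[OF b, of x] by (auto simp: S_def)
  qed
  obtain c where c: "0 < c" "\<forall>\<^sub>F n in sequentially. \<forall>v\<in>H10 \<Omega>. c * h1sq \<Omega> v \<le> energy \<Omega> \<Omega> (W n) v"
    by (rule coercive) (rule that)
  obtain B where B: "0 \<le> B" "\<And>n. W n \<in> borel_measurable M" "\<And>n. AE x in M. \<bar>W n x\<bar> \<le> B"
    by (rule W_bounded) (rule that)
  obtain C where C: "0 < C" "\<And>n. Q n \<in> borel_measurable M" "\<And>n. AE x in M. \<bar>Q n x\<bar> \<le> C"
    by (rule Q_bounded) (rule that)
  have p0: "0 < p" using p2 by simp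
  obtain C' where C': "0 < C'" "\<And>u A. u \<in> H10 \<Omega> \<Longrightarrow> 0 < A \<Longrightarrow> h1sq \<Omega> u \<le> A \<Longrightarrow> integrable M (\<lambda>x. \<bar>u x\<bar> powr p)"
    "\<And>u A. u \<in> H10 \<Omega> \<Longrightarrow> 0 < A \<Longrightarrow> h1sq \<Omega> u \<le> A \<Longrightarrow> (LINT x|M. \<bar>u x\<bar> powr p) \<le> C' * A powr (p / 2)"
    by (rule H10_sobolev[OF open_\<Omega> embedding p0]) (rule that)
  obtain G where G: "0 < G" "\<forall>\<^sub>F n in sequentially. \<bar>cut_energy \<beta> n\<bar> \<le> G"
    by (rule ev_boundedE[OF ev]) (rule that)
  define A where "A = G / c"
  have A: "0 < A" using G(1) c(1) by (simp add: A_def)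
  have x2: "x2 \<in> {x1, x2}" by simp
  have v: "\<forall>\<^sub>F n in sequentially. u n \<in> H10 \<Omega> \<and> (\<lambda>x. \<beta> x * u n x) \<in> H10 \<Omega> \<and> h1sq \<Omega> (\<lambda>x. \<beta> x * u n x) \<le> A"
    using ground_facts c(2) G(2)
  proof eventually_elim
    case (elim n)
    then have v: "(\<lambda>x. \<beta> x * u n x) \<in> H10 \<Omega>" using bump_H10(1)[OF b x2] by simp
    then have "c * h1sq \<Omega> (\<lambda>x. \<beta> x * u n x) \<le> G" using elim(2,3) by fastforce
    then show ?case using v elim(1) c(1) by (simp add: A_def pos_le_divide_eq mult.commute)
  qed
  show "ev_bounded (\<lambda>n. LINT x|M. indicator (- ball x1 \<epsilon>) x * dens n x)"
  proof (rule ev_bounded_mono[OF ev_bounded_add[OF local_bound(1)[OF \<epsilon>'(1)]]])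
    show "ev_bounded (\<lambda>n. (1 + B) * A)" by (rule ev_boundedI[of _ "\<bar>(1 + B) * A\<bar>"]) simp
    show "\<forall>\<^sub>F n in sequentially. \<bar>LINT x|M. indicator (- ball x1 \<epsilon>) x * dens n x\<bar>
        \<le> (LINT x|M. indicator (- S \<epsilon>') x * dens n x) + (1 + B) * A"
      using v
    proof eventually_elim
      case (elim n)
      let ?v = "\<lambda>x. \<beta> x * u n x" and ?d = "dens n"
      note iu = h1sq_integrable[OF H10_H1[of "u n"]] and iv = h1sq_integrable[OF H10_H1[of ?v]]
      have un: "u n \<in> H10 \<Omega>" and vn: "?v \<in> H10 \<Omega>" and h: "h1sq \<Omega> ?v \<le> A" using elim by auto
      have id: "integrable M ?d"
        using iu[OF un] B by (intro Bochner_Integration.integrable_add integrable_bounded_mult[where c=B]) auto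
      have "(LINT x|M. indicator (- ball x1 \<epsilon>) x * ?d x) \<le> (LINT x|M. indicator (- S \<epsilon>') x * ?d x + ((norm (wgrad \<Omega> ?v x))\<^sup>2 + B * (?v x)\<^sup>2))"
      proof (rule integral_mono_AE)
        show "integrable M (\<lambda>x. indicator (- ball x1 \<epsilon>) x * ?d x)"
          by (rule integrable_indicator_mult[OF id]) simp
        show "integrable M (\<lambda>x. indicator (- S \<epsilon>') x * ?d x + ((norm (wgrad \<Omega> ?v x))\<^sup>2 + B * (?v x)\<^sup>2))"
          using iv[OF vn] by (intro Bochner_Integration.integrable_add integrable_mult_right integrable_indicator_mult[OF id]) auto
        show "AE x in M. indicator (- ball x1 \<epsilon>) x * ?d x \<le> indicator (- S \<epsilon>') x * ?d x + ((norm (wgrad \<Omega> ?v x))\<^sup>2 + B * (?v x)\<^sup>2)"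
          using B(3)[of n] bump_H10(2)[OF b x2 un]
        proof eventually_elim
          case (elim x)
          have d0: "0 \<le> ?d x" by simp
          have r0: "0 \<le> (norm (wgrad \<Omega> ?v x))\<^sup>2 + B * (?v x)\<^sup>2" using B(1) by simp
          show ?case
          proof (cases "x \<in> S \<epsilon>' \<and> x \<notin> ball x1 \<epsilon>")
            case True
            then have "x \<in> S (\<rho> / 2)" "\<beta> x = 1" using cover by auto
            then have "grad \<beta> x = 0" using bump_locally_constant(2)[OF b x2] by blast
            then have "wgrad \<Omega> ?v x = wgrad \<Omega> (u n) x" using elim(2) \<open>\<beta> x = 1\<close> by simp
            moreover have "\<bar>W n x\<bar> * (u n x)\<^sup>2 \<le> B * (u n x)\<^sup>2" using elim(1) by (rule mult_right_mono) simp
            ultimately show ?thesis using True \<open>\<beta> x = 1\<close> by simp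
          next
            case False
            then show ?thesis using d0 r0 by (cases "x \<in> S \<epsilon>'") (auto simp: indicator_def simp del: mem_ball)
          qed
        qed
      qed
      also have "\<dots> = (LINT x|M. indicator (- S \<epsilon>') x * ?d x) + ((LINT x|M. (norm (wgrad \<Omega> ?v x))\<^sup>2) + B * (LINT x|M. (?v x)\<^sup>2))"
        using iv[OF vn] integrable_indicator_mult[OF id, of "- S \<epsilon>'"] by simp
      also have "\<dots> \<le> (LINT x|M. indicator (- S \<epsilon>') x * ?d x) + (1 + B) * A"
      proof -
        define a where "a = (LINT x|M. (norm (wgrad \<Omega> ?v x))\<^sup>2)"
        define s where "s = (LINT x|M. (?v x)\<^sup>2)"
        have "a + s \<le> A" using h iv[OF vn] by (simp add: h1sq_def a_def s_def)
        moreover have "0 \<le> a" "0 \<le> s" by (auto simp: a_def s_def)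
        ultimately have "a \<le> A" "s \<le> A" by auto
        then have "a + B * s \<le> A + B * A" using B(1) by (intro add_mono mult_left_mono)
        then show ?thesis by (simp add: a_def s_def algebra_simps)
      qed
      finally show ?case by simp
    qed
  qed
  show "ev_bounded (\<lambda>n. LINT x|M. indicator (- ball x1 \<epsilon>) x * pot n x)"
  proof (rule ev_bounded_mono[OF ev_bounded_add[OF local_bound(2)[OF \<epsilon>'(1)]]])
    show "ev_bounded (\<lambda>n. C * (C' * A powr (p / 2)))" by (rule ev_boundedI[of _ "\<bar>C * (C' * A powr (p / 2))\<bar>"]) simp
    show "\<forall>\<^sub>F n in sequentially. \<bar>LINT x|M. indicator (- ball x1 \<epsilon>) x * pot n x\<bar>
        \<le> (LINT x|M. indicator (- S \<epsilon>') x * pot n x) + C * (C' * A powr (p / 2))"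
      using v
    proof eventually_elim
      case (elim n)
      let ?v = "\<lambda>x. \<beta> x * u n x" and ?d = "pot n"
      have un: "u n \<in> H10 \<Omega>" and vn: "?v \<in> H10 \<Omega>" and h: "h1sq \<Omega> ?v \<le> A" using elim by auto
      note id = Q_powr_integrable(2)[OF un, of n] and iv = powr_integrable[OF vn]
      have "(LINT x|M. indicator (- ball x1 \<epsilon>) x * ?d x) \<le> (LINT x|M. indicator (- S \<epsilon>') x * ?d x + C * \<bar>?v x\<bar> powr p)"
      proof (rule integral_mono_AE)
        show "integrable M (\<lambda>x. indicator (- ball x1 \<epsilon>) x * ?d x)"
          by (rule integrable_indicator_mult[OF id]) simp
        show "integrable M (\<lambda>x. indicator (- S \<epsilon>') x * ?d x + C * \<bar>?v x\<bar> powr p)"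
          using iv by (intro Bochner_Integration.integrable_add integrable_mult_right integrable_indicator_mult[OF id]) auto
        show "AE x in M. indicator (- ball x1 \<epsilon>) x * ?d x \<le> indicator (- S \<epsilon>') x * ?d x + C * \<bar>?v x\<bar> powr p"
          using C(3)[of n]
        proof eventually_elim
          case (elim x)
          have d0: "0 \<le> ?d x" by simp
          have r0: "0 \<le> C * \<bar>?v x\<bar> powr p" using C(1) by simp
          show ?case
          proof (cases "x \<in> S \<epsilon>' \<and> x \<notin> ball x1 \<epsilon>")
            case True
            then have "\<beta> x = 1" using cover by auto
            moreover have "?d x \<le> C * \<bar>u n x\<bar> powr p" using elim by (rule mult_right_mono) simp
            ultimately show ?thesis using True by simp
          next
            case False
            then show ?thesis using d0 r0 by (cases "x \<in> S \<epsilon>'") (auto simp: indicator_def simp del: mem_ball)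
          qed
        qed
      qed
      also have "\<dots> = (LINT x|M. indicator (- S \<epsilon>') x * ?d x) + C * (LINT x|M. \<bar>?v x\<bar> powr p)"
        using iv integrable_indicator_mult[OF id, of "- S \<epsilon>'"] by simp
      also have "\<dots> \<le> (LINT x|M. indicator (- S \<epsilon>') x * ?d x) + C * (C' * A powr (p / 2))"
        using C'(3)[OF vn A h] C(1) by (intro add_left_mono mult_left_mono) auto
      finally show ?case by simp
    qed
  qed
qed

lemma concentration:
  assumes b: "is_bump x2 \<beta>" and ev: "ev_bounded (\<lambda>n. cut_energy \<beta> n)" and \<epsilon>: "0 < \<epsilon>"
  shows "vanishes_off_ball \<Omega> p W Q u x1 \<epsilon>"
proof -
  note bound = off_ball_bounded[OF assms]
  have "ev_bounded (\<lambda>n. energy \<Omega> (\<Omega> - ball x1 \<epsilon>) (W n) (u n))"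
  proof (rule ev_bounded_mono[OF bound(1)])
    show "\<forall>\<^sub>F n in sequentially. \<bar>energy \<Omega> (\<Omega> - ball x1 \<epsilon>) (W n) (u n)\<bar> \<le> (LINT x|M. indicator (- ball x1 \<epsilon>) x * dens n x)"
      using ground_facts by eventually_elim (simp add: energy_def lebesgue_on_subset_integral[OF open_\<Omega>] weighted_energy_le)
  qed
  from ev_bounded_div_at_top[OF this E_at_top]
  have 1: "(\<lambda>n. energy \<Omega> (\<Omega> - ball x1 \<epsilon>) (W n) (u n) / energy \<Omega> \<Omega> (W n) (u n)) \<longlonglongrightarrow> 0"
    by (simp add: E_def)
  have "ev_bounded (\<lambda>n. Jfun (\<Omega> - ball x1 \<epsilon>) p (Q n) (u n))"
  proof (rule ev_bounded_mono[OF bound(2)])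
    show "\<forall>\<^sub>F n in sequentially. \<bar>Jfun (\<Omega> - ball x1 \<epsilon>) p (Q n) (u n)\<bar> \<le> (LINT x|M. indicator (- ball x1 \<epsilon>) x * pot n x)"
    proof (intro always_eventually allI)
      fix n
      show "\<bar>Jfun (\<Omega> - ball x1 \<epsilon>) p (Q n) (u n)\<bar> \<le> (LINT x|M. indicator (- ball x1 \<epsilon>) x * pot n x)"
        using integral_abs_bound[of M "\<lambda>x. indicator (- ball x1 \<epsilon>) x * (Q n x * \<bar>u n x\<bar> powr p)"]
        by (simp add: Jfun_def lebesgue_on_subset_integral[OF open_\<Omega>] abs_mult)
    qed
  qed
  from ev_bounded_div_at_top[OF this E_at_top]
  have "(\<lambda>n. Jfun (\<Omega> - ball x1 \<epsilon>) p (Q n) (u n) / Jfun \<Omega> p (Q n) (u n)) \<longlonglongrightarrow> 0"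
    by (rule Lim_transform_eventually) (use ground_facts in eventually_elim, simp)
  with 1 show ?thesis by (simp add: vanishes_off_ball_def)
qed

text \<open>
  A ball about \<open>x2\<close> of radius \<open>\<epsilon> < dist x1 x2\<close> misses a ball about \<open>x1\<close>, hence has bounded
  energy, so that asymptotically all of \<open>E n\<close> lies outside of it.
\<close>

lemma no_concentration_elsewhere:
  assumes b: "is_bump x2 \<beta>" and ev: "ev_bounded (\<lambda>n. cut_energy \<beta> n)"
    and \<epsilon>: "\<epsilon> < dist x1 x2"
  shows "\<not> vanishes_off_ball \<Omega> p W Q u x2 \<epsilon>"
proof
  assume "vanishes_off_ball \<Omega> p W Q u x2 \<epsilon>"
  then have 0: "(\<lambda>n. energy \<Omega> (\<Omega> - ball x2 \<epsilon>) (W n) (u n) / E n) \<longlonglongrightarrow> 0"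
    by (simp add: vanishes_off_ball_def E_def)
  have disj: "x \<notin> ball x1 (dist x1 x2 - \<epsilon>)" if "x \<in> ball x2 \<epsilon>" for x
    using that dist_triangle[of x1 x2 x] by (auto simp: dist_commute)
  have pos: "0 < dist x1 x2 - \<epsilon>" using \<epsilon> by simp
  have "ev_bounded (\<lambda>n. E n - energy \<Omega> (\<Omega> - ball x2 \<epsilon>) (W n) (u n))"
  proof (rule ev_bounded_mono[OF off_ball_bounded(1)[OF b ev pos]])
    show "\<forall>\<^sub>F n in sequentially. \<bar>E n - energy \<Omega> (\<Omega> - ball x2 \<epsilon>) (W n) (u n)\<bar> \<le>
        (LINT x|M. indicator (- ball x1 (dist x1 x2 - \<epsilon>)) x * dens n x)"
      using ground_facts
    proof eventually_elim
      case (elim n)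
      then have un: "u n \<in> H10 \<Omega>" by simp
      let ?d = "\<lambda>x. (norm (wgrad \<Omega> (u n) x))\<^sup>2 + W n x * (u n x)\<^sup>2"
      note id = energy_integrable[OF un, of n]
      have "E n - energy \<Omega> (\<Omega> - ball x2 \<epsilon>) (W n) (u n) = (LINT x|M. indicator (ball x2 \<epsilon>) x * ?d x)"
      proof -
        have "?d x - indicator (- ball x2 \<epsilon>) x * ?d x = indicator (ball x2 \<epsilon>) x * ?d x" for x
          by (simp add: indicator_def)
        then have "(LINT x|M. indicator (ball x2 \<epsilon>) x * ?d x) = (LINT x|M. ?d x - indicator (- ball x2 \<epsilon>) x * ?d x)"
          by simp
        also have "\<dots> = (LINT x|M. ?d x) - (LINT x|M. indicator (- ball x2 \<epsilon>) x * ?d x)"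
          by (intro Bochner_Integration.integral_diff id(1) integrable_indicator_mult[OF id(1)]) simp
        finally show ?thesis by (simp add: E_def energy_def lebesgue_on_subset_integral[OF open_\<Omega>])
      qed
      moreover have "\<bar>LINT x|M. indicator (ball x2 \<epsilon>) x * ?d x\<bar> \<le> (LINT x|M. indicator (ball x2 \<epsilon>) x * dens n x)"
        by (rule weighted_energy_le[OF un]) simp
      moreover have "\<dots> \<le> (LINT x|M. indicator (- ball x1 (dist x1 x2 - \<epsilon>)) x * dens n x)"
        by (intro integral_mono integrable_indicator_mult[OF id(2)]) (use disj in \<open>auto simp: indicator_def simp del: mem_ball\<close>)
      ultimately show ?case by simp
    qed
  qed
  from ev_bounded_div_at_top[OF this E_at_top]
  have "(\<lambda>n. (E n - energy \<Omega> (\<Omega> - ball x2 \<epsilon>) (W n) (u n)) / E n) \<longlonglongrightarrow> 0" .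
  from tendsto_add[OF this 0]
  have "(\<lambda>n. (E n - energy \<Omega> (\<Omega> - ball x2 \<epsilon>) (W n) (u n)) / E n + energy \<Omega> (\<Omega> - ball x2 \<epsilon>) (W n) (u n) / E n) \<longlonglongrightarrow> 0" by simp
  moreover have "(\<lambda>n. (E n - energy \<Omega> (\<Omega> - ball x2 \<epsilon>) (W n) (u n)) / E n + energy \<Omega> (\<Omega> - ball x2 \<epsilon>) (W n) (u n) / E n) \<longlonglongrightarrow> 1"
    by (rule tendsto_eventually) (use ground_facts in eventually_elim, simp add: add_divide_distrib[symmetric])
  ultimately show False using LIMSEQ_unique by fastforce
qed

lemma subsequence:
  assumes r: "strict_mono r"
  shows "concentrating_ground_states \<Omega> x1 x2 p V (K \<circ> r) (W \<circ> r) (Q \<circ> r) (u \<circ> r)"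
proof
  have r_le: "n \<le> r n" for n using r by (rule seq_suble)
  show "condition_A3 \<Omega> x1 x2 V (K \<circ> r)"
    using A3 unfolding condition_A3_def o_def by (meson order_trans r_le)
  show "condition_A4 \<Omega> x1 x2 (Q \<circ> r)"
    using A4 unfolding condition_A4_def o_def by (meson order_trans r_le)
  show "\<forall>\<^sub>F n in sequentially. ground_state \<Omega> p ((W \<circ> r) n) ((Q \<circ> r) n) ((u \<circ> r) n)"
    using filterlim_subseq[OF r] ground unfolding filterlim_iff o_def by blast
qed (use open_\<Omega> distinct p2 subcritical W_eq in auto)

end

theorem theorem4p1:
  fixes \<Omega> :: "'a::euclidean_space set" and x1 x2 :: 'a and p :: real
    and V :: "'a \<Rightarrow> real" and K Vn Q u :: "nat \<Rightarrow> 'a \<Rightarrow> real"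
  assumes "open \<Omega>" and "connected \<Omega>"
    and "x1 \<in> \<Omega>" and "x2 \<in> \<Omega>" and "x1 \<noteq> x2"
    and "2 < p" and "ereal p < crit_exponent DIM('a)"
    and "\<And>n x. Vn n x = V x + K n x"
    and "condition_A3 \<Omega> x1 x2 V K"
    and "condition_A4 \<Omega> x1 x2 Q"
    and "\<forall>\<^sub>F n in sequentially. ground_state \<Omega> p (Vn n) (Q n) (u n)"
  shows "\<exists>r::nat \<Rightarrow> nat. strict_mono r \<and>
    ((\<forall>\<epsilon>>0. vanishes_off_ball \<Omega> p (Vn \<circ> r) (Q \<circ> r) (u \<circ> r) x1 \<epsilon>) \<or>
     (\<forall>\<epsilon>>0. vanishes_off_ball \<Omega> p (Vn \<circ> r) (Q \<circ> r) (u \<circ> r) x2 \<epsilon>)) \<and>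
    (\<forall>\<epsilon>. 0 < \<epsilon> \<and> \<epsilon> < dist x1 x2 \<longrightarrow>
       \<not> (vanishes_off_ball \<Omega> p (Vn \<circ> r) (Q \<circ> r) (u \<circ> r) x1 \<epsilon> \<and>
          vanishes_off_ball \<Omega> p (Vn \<circ> r) (Q \<circ> r) (u \<circ> r) x2 \<epsilon>))"
proof -
  interpret G: concentrating_ground_states \<Omega> x1 x2 p V K Vn Q u
    by unfold_locales (use assms in auto)
  obtain \<beta>1 where b1: "G.is_bump x1 \<beta>1" by (rule G.bump_exists)
  obtain \<beta>2 where b2: "G.is_bump x2 \<beta>2" by (rule G.bump_exists)
  obtain r where r: "strict_mono r"
    "ev_bounded (\<lambda>n. energy \<Omega> \<Omega> (Vn (r n)) (\<lambda>x. \<beta>1 x * u (r n) x)) \<or>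
     ev_bounded (\<lambda>n. energy \<Omega> \<Omega> (Vn (r n)) (\<lambda>x. \<beta>2 x * u (r n) x))"
    by (rule G.dichotomy[OF b1 b2]) (rule that)
  interpret R: concentrating_ground_states \<Omega> x1 x2 p V "K \<circ> r" "Vn \<circ> r" "Q \<circ> r" "u \<circ> r"
    by (rule G.subsequence[OF r(1)])
  interpret R': concentrating_ground_states \<Omega> x2 x1 p V "K \<circ> r" "Vn \<circ> r" "Q \<circ> r" "u \<circ> r"
    by (rule R.swap)
  have b1': "R'.is_bump x1 \<beta>1"
    using b1 by (simp add: G.is_bump_def R'.is_bump_def G.\<rho>_def R'.\<rho>_def dist_commute)
  show ?thesis
    using r(2)
  proof
    assume "ev_bounded (\<lambda>n. energy \<Omega> \<Omega> (Vn (r n)) (\<lambda>x. \<beta>2 x * u (r n) x))"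
    then have ev: "ev_bounded (\<lambda>n. energy \<Omega> \<Omega> ((Vn \<circ> r) n) (\<lambda>x. \<beta>2 x * (u \<circ> r) n x))" by simp
    show ?thesis
      using r(1) R.concentration[OF b2 ev] R.no_concentration_elsewhere[OF b2 ev] by blast
  next
    assume "ev_bounded (\<lambda>n. energy \<Omega> \<Omega> (Vn (r n)) (\<lambda>x. \<beta>1 x * u (r n) x))"
    then have ev: "ev_bounded (\<lambda>n. energy \<Omega> \<Omega> ((Vn \<circ> r) n) (\<lambda>x. \<beta>1 x * (u \<circ> r) n x))" by simp
    show ?thesis
      using r(1) R'.concentration[OF b1' ev] R'.no_concentration_elsewhere[OF b1' ev] by (metis dist_commute)
  qed
qed

end
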